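(* Let $\mathcal{L}$ be the Leech lattice with Gram matrix $L$ and $\vartheta_{\mathcal{L}}^{(2)}(Z)=\sum_{X\in M_{24,2}(\mathbb{Z})}\exp(\pi i\,\mathrm{tr}({}^t\!XLX\,Z))$ its degree 2 theta series. Then \[ \vartheta_{\mathcal{L}}^{(2)}\equiv 1\pmod{13}, \] i.e. $a(\vartheta_{\mathcal{L}}^{(2)};0_2)=1$ and $a(\vartheta_{\mathcal{L}}^{(2)};T)\equiv 0\pmod{13}$ for every $0_2\ne T\ge 0$ in $Sym_2^*(\mathbb{Z})$.
   Context: The Leech lattice is the unique even unimodular lattice of rank 24 with no vectors of norm 2. Fourier expansion: $\vartheta_{\mathcal{L}}^{(2)}(Z)=\sum_{0\le T\in Sym_2^*(\mathbb{Z})}a(\vartheta_{\mathcal{L}}^{(2)};T)\exp(2\pi i\,\mathrm{tr}(TZ))$, $Z\in\mathbb{H}_2$, where $Sym_2^*(\mathbb{Z})$ is the set of symmetric rational $2\times2$ matrices with integral diagonal and half-integral off-diagonal entries. A congruence $F\equiv G\pmod p$ of formal Fourier series means congruence of all Fourier coefficients. *)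

theory Defs
  imports "HOL-Analysis.Analysis"
begin

definition bform :: "int^24^24 \<Rightarrow> int^24 \<Rightarrow> int^24 \<Rightarrow> int" where
  "bform L x y = (\<Sum>i\<in>UNIV. \<Sum>j\<in>UNIV. x$i * L$i$j * y$j)"

text \<open>Gram matrix of the Leech lattice (w.r.t. some Z-basis): a symmetric, positive definite,
  even (even diagonal), unimodular (det 1) integral 24x24 matrix without vectors of norm 2.
  By uniqueness of the Leech lattice, these are exactly its Gram matrices.\<close>
definition leech_gram :: "int^24^24 \<Rightarrow> bool" where
  "leech_gram L \<longleftrightarrow> transpose L = L
     \<and> (\<forall>i. even (L$i$i))
     \<and> det L = 1
     \<and> (\<forall>x. x \<noteq> 0 \<longrightarrow> bform L x x > 0)
     \<and> (\<forall>x. bform L x x \<noteq> 2)"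

text \<open>T = [[a, b/2],[b/2, c]] in Sym_2^*(Z) is encoded by the integer triple (a,b,c).
  The Fourier coefficient of the degree 2 theta series at T is the number of
  X = (x y) in M_{24,2}(Z) with (1/2) X^t L X = T.\<close>
definition theta2_coeff :: "int^24^24 \<Rightarrow> int \<Rightarrow> int \<Rightarrow> int \<Rightarrow> nat" where
  "theta2_coeff L a b c = card {(x, y). bform L x x = 2 * a \<and> bform L x y = b \<and> bform L y y = 2 * c}"

definition psd2 :: "int \<Rightarrow> int \<Rightarrow> int \<Rightarrow> bool" where
  "psd2 a b c \<longleftrightarrow> a \<ge> 0 \<and> c \<ge> 0 \<and> 4 * a * c - b^2 \<ge> 0"

end

theory Submission
  imports Defs "HOL-Probability.Probability" "HOL-Complex_Analysis.Complex_Analysis"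
    "HOL-Number_Theory.Cong" "HOL-Library.Function_Algebras"
begin

text \<open>
  The theorem is clear for one Leech lattice with an automorphism of order 13 that fixes no nonzero
  vector: such an automorphism acts freely on the pairs with a given Gram matrix \<open>T \<noteq> 0\<close>. The
  lattice \<open>leech13\<close> below has one. Instead of the uniqueness of the Leech lattice it suffices
  that any two even unimodular lattices of rank 24 without vectors of norm 2 have the same pair counts
  \<open>N(m, r, n) = #{(x, y). x\<cdot>x = 2m, x\<cdot>y = r, y\<cdot>y = 2n}\<close>.

  This is proved by induction on \<open>m\<close>. Let \<open>D(m, r, n)\<close> be the difference of the two pair counts;
  by symmetry and induction it vanishes for \<open>n < m\<close>. By Poisson summation the series
  \<open>\<Sum>n r. D(m, r, n) q^n exp(2\<pi>irz)\<close> transforms like a Jacobi form of weight 12 and index \<open>m\<close>, so its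
  first nonzero Taylor coefficient in \<open>z\<close>, of degree \<open>j\<close> say, is a modular form of weight
  \<open>12 + j\<close> vanishing to order \<open>m\<close> at infinity, hence zero if \<open>j \<le> 2m\<close>. Now
  let \<open>n\<close> be minimal with \<open>D(m, r, n) \<noteq> 0\<close> for some \<open>r\<close>. Replacing \<open>y\<close> by \<open>y \<plusminus> x\<close>
  shows that \<open>\<bar>r\<bar> \<le> m\<close>, and the vanishing of the moments \<open>\<Sum>r. D(m, r, n) r^j\<close> for \<open>j \<le> 2m\<close> is a
  nonsingular Vandermonde system.
\<close>

subsection \<open>Fourier series and Poisson summation\<close>


text \<open>The bound on modular forms must leave room for all moments up to j = 2m: with vanishing
  order m it covers weights below 10m, and 12 + 2m < 10m holds exactly for m >= 2. The absence of
  vectors of norm 2 settles the two remaining indices: for m = 1 there are no pairs at all, and for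
  m = 0 the ordinary theta series of weight 12 agree up to q^1, which suffices. No theory of modular
  forms is presupposed: periodicity in \<tau> is built into power series in q, and inversion is
  needed only on the imaginary axis, where it follows from real Poisson summation. Accepting 10
  instead of the sharp constant 12 makes a single comparison of absolute values enough.

  The reference lattice glues two copies of \<open>lattW\<close>. As 5 is a square root of -1 modulo
  13, multiplication by 5 is an anti-isometry of the quotient of the dual of \<open>lattW\<close> by
  \<open>lattW\<close>, and its graph gives a unimodular lattice of rank 12 + 12, on which the
  cyclic shift of the 13 coordinates acts.\<close>

lemma continuous_on_cis_comp [continuous_intros]:
  assumes "continuous_on A f" shows "continuous_on A (\<lambda>x. cis (f x))"
  unfolding cis_conv_exp using assms by (intro continuous_intros)

text \<open>A factor cos is the mean of two characters, so it moves the frequency k to k + 1 and k -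
  1; the induction on the exponent therefore treats all frequencies at once.\<close>

lemma fourier_coeffs_cos_power:
  fixes D :: "real \<Rightarrow> complex"
  assumes zero: "\<And>k::int. ((\<lambda>u. D u * cis (2 * pi * k * u)) has_integral 0) {0..1}"
  shows "((\<lambda>u. D u * of_real (cos (2 * pi * u) ^ l) * cis (2 * pi * of_int k * u)) has_integral 0) {0..1}"
proof (induction l arbitrary: k)
  case 0
  show ?case using zero[of k] by simp
next
  case (Suc l)
  have eq: "D u * of_real (cos (2 * pi * u) ^ Suc l) * cis (2 * pi * of_int k * u) =
     (D u * of_real (cos (2 * pi * u) ^ l) * cis (2 * pi * of_int (k + 1) * u) +
      D u * of_real (cos (2 * pi * u) ^ l) * cis (2 * pi * of_int (k - 1) * u)) / 2" for u
  proof -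
    have a: "cis (2 * pi * of_int (k + 1) * u) = cis (2 * pi * of_int k * u) * cis (2 * pi * u)"
      "cis (2 * pi * of_int (k - 1) * u) = cis (2 * pi * of_int k * u) * cis (- (2 * pi * u))"
      by (simp_all add: cis_mult algebra_simps)
    have c: "of_real (cos (2 * pi * u)) = (cis (2 * pi * u) + cis (- (2 * pi * u))) / 2"
      by (simp add: complex_eq_iff)
    have "of_real (cos (2 * pi * u) ^ Suc l) = (of_real (cos (2 * pi * u)) * of_real (cos (2 * pi * u) ^ l) :: complex)"
      by simp
    thus ?thesis unfolding a by (simp only: c) (simp only: divide_inverse algebra_simps)
  qed
  have "((\<lambda>u. (D u * of_real (cos (2 * pi * u) ^ l) * cis (2 * pi * of_int (k + 1) * u) +
      D u * of_real (cos (2 * pi * u) ^ l) * cis (2 * pi * of_int (k - 1) * u)) / 2) has_integral (0 + 0) / 2) {0..1}"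
    by (intro has_integral_divide has_integral_add Suc.IH)
  thus ?case unfolding eq by simp
qed

text \<open>The even part \<open>E\<close> of \<open>D\<close> is a continuous function of \<open>cos (2 \<pi> u)\<close>, so the
  Weierstrass theorem makes it orthogonal to itself.\<close>
lemma fourier_coeffs_zero_imp_Re_zero:
  fixes D :: "real \<Rightarrow> complex"
  assumes cont: "continuous_on {0..1} D" and per: "D 1 = D 0"
    and zero: "\<And>k::int. ((\<lambda>u. D u * cis (2 * pi * k * u)) has_integral 0) {0..1}"
  shows "Re (D 0) = 0"
proof -
  define E where "E u = Re (D u) + Re (D (1 - u))" for u
  have contR: "continuous_on {0..1} (\<lambda>u. Re (D u))" using cont by (intro continuous_intros)
  have contE: "continuous_on {0..1} E" unfolding E_def
    by (intro continuous_on_add contR continuous_on_compose2[OF contR, of _ "\<lambda>u. 1 - u"] continuous_intros) auto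
  have Esym: "E (1 - u) = E u" for u by (simp add: E_def)
  \<comment> \<open>\<open>arccos\<close> inverts cos (2 pi u) only for u in [0, 1/2]; the symmetry
    \<open>Esym\<close> covers the other half, which is why the even part was taken.\<close>
  define e where "e x = E (arccos x / (2 * pi))" for x
  have conte: "continuous_on {-1..1} e" unfolding e_def
    by (rule continuous_on_compose2[OF contE])
       (use arccos_lbound arccos_ubound in \<open>auto intro!: continuous_intros simp: field_simps\<close>,
        smt (verit) arccos_ubound pi_gt_zero)
  have e_cos: "e (cos (2 * pi * u)) = E u" if "u \<in> {0..1}" for u
  proof (cases "u \<le> 1 / 2")
    case True
    hence "arccos (cos (2 * pi * u)) = 2 * pi * u" using that by (intro arccos_cos) (auto simp: field_simps)
    thus ?thesis by (simp add: e_def)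
  next
    case False
    have "cos (2 * pi * u) = cos (2 * pi * (1 - u))"
      by (simp add: right_diff_distrib cos_diff)
    also have "arccos \<dots> = 2 * pi * (1 - u)" using that False by (intro arccos_cos) (auto simp: field_simps)
    finally show ?thesis using Esym[of u] by (simp add: e_def)
  qed
  have poly0: "((\<lambda>u. E u * p (cos (2 * pi * u))) has_integral 0) {0..1}" if "real_polynomial_function p" for p
  proof -
    from that obtain a n where p: "p = (\<lambda>x. \<Sum>i\<le>n. a i * x ^ i)"
      using real_polynomial_function_iff_sum by auto
    have "((\<lambda>u. \<Sum>i\<le>n. of_real (a i) * (D u * of_real (cos (2 * pi * u) ^ i) * cis (2 * pi * of_int 0 * u)))
        has_integral (\<Sum>i\<le>n. of_real (a i) * 0)) {0..1}"
      by (intro has_integral_sum has_integral_mult_right fourier_coeffs_cos_power zero) auto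
    hence "((\<lambda>u. D u * of_real (p (cos (2 * pi * u)))) has_integral 0) {0..1}"
      by (simp add: p sum_distrib_left mult_ac)
    from has_integral_Re[OF this] have 1: "((\<lambda>u. Re (D u) * p (cos (2 * pi * u))) has_integral 0) {0..1}" by simp
    have "((\<lambda>u. Re (D (1 - u)) * p (cos (2 * pi * (1 - u)))) has_integral 0) {0..1}"
      using has_integral_affinity[OF 1[unfolded cbox_interval[symmetric]], of "-1" 1] by (simp add: cbox_interval)
    hence 2: "((\<lambda>u. Re (D (1 - u)) * p (cos (2 * pi * u))) has_integral 0) {0..1}"
      by (simp add: right_diff_distrib cos_diff)
    show ?thesis using has_integral_add[OF 1 2] by (simp add: E_def algebra_simps)
  qed
  have bdd: "\<exists>B. \<forall>u\<in>{0..1}. \<bar>E u\<bar> \<le> B"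
    using compact_imp_bounded[OF compact_continuous_image[OF contE]] by (auto simp: bounded_iff)
  then obtain B where B: "\<And>u. u \<in> {0..1} \<Longrightarrow> \<bar>E u\<bar> \<le> B" by blast
  have B0: "B \<ge> 0" using B[of 0] by auto
  have intE2: "(\<lambda>u. E u * E u) integrable_on {0..1}"
    by (intro integrable_continuous_real continuous_intros contE)
  have "integral {0..1} (\<lambda>u. E u * E u) \<le> \<epsilon> * B" if "\<epsilon> > 0" for \<epsilon>
  proof -
    obtain p where p: "real_polynomial_function p" "\<And>x. x \<in> {-1..1} \<Longrightarrow> \<bar>e x - p x\<bar> < \<epsilon>"
      using Stone_Weierstrass_real_polynomial_function[OF _ conte \<open>\<epsilon> > 0\<close>] by auto
    \<comment> \<open>The integral of E times the polynomial in cos is 0, so subtracting it replaces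
      one factor of the square by a difference below \<epsilon>.\<close>
    have i2: "((\<lambda>u. E u * E u - E u * p (cos (2 * pi * u))) has_integral (integral {0..1} (\<lambda>u. E u * E u) - 0)) {0..1}"
      by (intro has_integral_diff integrable_integral intE2 poly0 p)
    have c: "((\<lambda>u::real. \<epsilon> * B) has_integral \<epsilon> * B) {0..1}"
      using has_integral_const_real[of "\<epsilon> * B" 0 1] by simp
    have "integral {0..1} (\<lambda>u. E u * E u) - 0 \<le> \<epsilon> * B"
    proof (rule has_integral_le[OF i2 c])
      fix u :: real assume u: "u \<in> {0..1}"
      have "\<bar>E u - p (cos (2 * pi * u))\<bar> < \<epsilon>" using p(2)[of "cos (2 * pi * u)"] e_cos u by auto
      hence "\<bar>E u\<bar> * \<bar>E u - p (cos (2 * pi * u))\<bar> \<le> B * \<epsilon>" using B[of u] u B0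
        by (intro mult_mono) auto
      hence "\<bar>E u * (E u - p (cos (2 * pi * u)))\<bar> \<le> \<epsilon> * B" by (simp add: abs_mult mult.commute)
      thus "E u * E u - E u * p (cos (2 * pi * u)) \<le> \<epsilon> * B"
        unfolding right_diff_distrib by linarith
    qed
    thus ?thesis by simp
  qed note le = this
  have "integral {0..1} (\<lambda>u. E u * E u) \<le> 0"
  proof (rule field_le_epsilon)
    fix \<epsilon> :: real assume "\<epsilon> > 0"
    have "\<epsilon> / (B + 1) * B \<le> \<epsilon>" using \<open>\<epsilon> > 0\<close> B0 by (simp add: field_simps)
    thus "integral {0..1} (\<lambda>u. E u * E u) \<le> 0 + \<epsilon>" using le[of "\<epsilon> / (B + 1)"] \<open>\<epsilon> > 0\<close> B0 by simp
  qed
  moreover have "integral {0..1} (\<lambda>u. E u * E u) \<ge> 0" by (intro integral_nonneg intE2) auto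
  ultimately have "\<forall>u\<in>{0..1}. E u * E u = 0"
    by (subst integral_eq_0_iff[symmetric]) (auto intro!: continuous_intros contE)
  hence "E 0 = 0" by auto
  thus ?thesis using per by (simp add: E_def)
qed

lemma fourier_coeffs_zero_imp_zero:
  fixes D :: "real \<Rightarrow> complex"
  assumes cont: "continuous_on {0..1} D" and per: "D 1 = D 0"
    and zero: "\<And>k::int. ((\<lambda>u. D u * cis (2 * pi * k * u)) has_integral 0) {0..1}"
  shows "D 0 = 0"
proof -
  have "Re (D 0) = 0" by (rule fourier_coeffs_zero_imp_Re_zero[OF assms])
  moreover have "Re (- \<i> * D 0) = 0"
  proof (rule fourier_coeffs_zero_imp_Re_zero[of "\<lambda>u. - \<i> * D u"])
    show "continuous_on {0..1} (\<lambda>u. - \<i> * D u)" by (intro continuous_intros cont)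
    show "((\<lambda>u. - \<i> * D u * cis (2 * pi * k * u)) has_integral 0) {0..1}" for k :: int
      using has_integral_mult_right[OF zero[of k], of "- \<i>"] by (simp add: mult.assoc)
  qed (use per in simp)
  ultimately show ?thesis by (simp add: complex_eq_iff)
qed


text \<open>The majorant \<open>M\<close> gives uniform convergence, hence continuity and termwise
  integration. This serves both the periodization of a function and its Fourier series.\<close>

lemma has_integral_infsum_continuous:
  fixes f :: "'i \<Rightarrow> real \<Rightarrow> complex"
  assumes cont: "\<And>n. continuous_on {0..1} (f n)"
    and bound: "\<And>n x. x \<in> {0..1} \<Longrightarrow> norm (f n x) \<le> M n" and M: "M summable_on UNIV"
    and int: "\<And>n. (f n has_integral I n) {0..1}"
  shows "continuous_on {0..1} (\<lambda>x. \<Sum>\<^sub>\<infinity>n. f n x)"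
    and "\<exists>J. ((\<lambda>x. \<Sum>\<^sub>\<infinity>n. f n x) has_integral J) {0..1} \<and> (I has_sum J) UNIV"
proof -
  have u: "uniform_limit {0..1} (\<lambda>X x. \<Sum>n\<in>X. f n x) (\<lambda>x. \<Sum>\<^sub>\<infinity>n. f n x) (finite_subsets_at_top UNIV)"
    by (rule Weierstrass_m_test_general[OF bound M])
  show "continuous_on {0..1} (\<lambda>x. \<Sum>\<^sub>\<infinity>n. f n x)"
    by (rule uniform_limit_theorem[OF _ u]) (auto intro!: always_eventually continuous_on_sum cont)
  obtain I' J where IJ: "\<And>X. ((\<lambda>x. \<Sum>n\<in>X. f n x) has_integral I' X) {0..1}"
    "((\<lambda>x. \<Sum>\<^sub>\<infinity>n. f n x) has_integral J) {0..1}" "(I' \<longlongrightarrow> J) (finite_subsets_at_top UNIV)"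
    by (rule uniform_limit_integral[OF u]) (blast intro: continuous_on_sum cont | simp)+
  have "I' X = sum I X" if "finite X" for X
    using has_integral_unique[OF IJ(1)[of X] has_integral_sum[OF that, of f I]] int by blast
  hence "eventually (\<lambda>X. I' X = sum I X) (finite_subsets_at_top UNIV)"
    by (auto simp: eventually_finite_subsets_at_top)
  hence "(sum I \<longlongrightarrow> J) (finite_subsets_at_top UNIV)"
    using IJ(3) tendsto_cong by blast
  hence "(I has_sum J) UNIV" by (simp add: has_sum_def)
  thus "\<exists>J. ((\<lambda>x. \<Sum>\<^sub>\<infinity>n. f n x) has_integral J) {0..1} \<and> (I has_sum J) UNIV" using IJ(2) by blast
qed

lemma has_integral_cis:
  "((\<lambda>x. cis (2 * pi * of_int k * x)) has_integral (if k = 0 then 1 else 0)) {0..1}"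
proof (cases "k = 0")
  case True
  have "((\<lambda>x::real. 1 :: complex) has_integral 1) {0..1}" using has_integral_const_real[of "1::complex" 0 1] by simp
  thus ?thesis using True by simp
next
  case False
  define F where "F x = cis (2 * pi * of_int k * x) / (2 * pi * of_int k * \<i>)" for x :: real
  have "(F has_vector_derivative cis (2 * pi * of_int k * x)) (at x within {0..1})" for x
    unfolding F_def has_real_derivative_iff_has_vector_derivative[symmetric] cis_conv_exp using False
    by (auto intro!: derivative_eq_intros has_vector_derivative_real_field simp: field_simps)
  hence "((\<lambda>x. cis (2 * pi * of_int k * x)) has_integral (F 1 - F 0)) {0..1}"
    by (intro fundamental_theorem_of_calculus) auto
  moreover have "cis (2 * pi * of_int k) = 1" by (simp add: cis_multiple_2pi)
  ultimately show ?thesis using False by (simp add: F_def)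
qed

text \<open>The periodization \<open>F\<close> of \<phi> and the trigonometric series
  \<open>G\<close> with coefficients \<open>c\<close> are continuous, periodic and have the same
  Fourier coefficients, so they agree at 0. Evaluation at 0 is enough because translations and
  phases can be put into \<phi>.\<close>

lemma poisson_summation_at_zero:
  fixes \<phi> :: "real \<Rightarrow> complex" and c :: "int \<Rightarrow> complex"
  assumes cont: "continuous_on UNIV \<phi>" and int: "integrable lborel \<phi>"
    and bound: "\<And>n x. x \<in> {0..1} \<Longrightarrow> norm (\<phi> (x + of_int n)) \<le> M n" and M: "M summable_on UNIV"
    and c: "\<And>k. c k = (LBINT x. \<phi> x * cis (- (2 * pi * of_int k * x)))"
    and sc: "(\<lambda>k. norm (c k)) summable_on UNIV"
  shows "(\<Sum>\<^sub>\<infinity>n::int. \<phi> (of_int n)) = (\<Sum>\<^sub>\<infinity>k. c k)"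
proof -
  define F where "F x = (\<Sum>\<^sub>\<infinity>n::int. \<phi> (x + of_int n))" for x
  define G where "G x = (\<Sum>\<^sub>\<infinity>k. c k * cis (2 * pi * of_int k * x))" for x
  have contc: "continuous_on A (\<lambda>x. \<phi> (x + b))" for A b
    by (rule continuous_on_compose2[OF cont]) (auto intro: continuous_intros)
  have contF: "continuous_on {0..1} F" unfolding F_def
    by (rule has_integral_infsum_continuous(1)[OF contc bound M integrable_integral])
       (auto intro!: integrable_continuous_real contc)
  have contG: "continuous_on {0..1} G" unfolding G_def
    by (rule has_integral_infsum_continuous(1)[OF _ _ sc integrable_integral])
       (auto intro!: integrable_continuous_real continuous_intros simp: norm_mult)
  have intG: "((\<lambda>x. G x * cis (2 * pi * of_int k * x)) has_integral c (- k)) {0..1}" for k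
  proof -
    have "((\<lambda>x. \<Sum>\<^sub>\<infinity>l. c l * cis (2 * pi * of_int (l + k) * x)) has_integral c (- k)) {0..1}"
    proof -
      have i: "((\<lambda>x. c l * cis (2 * pi * of_int (l + k) * x)) has_integral (c l * (if l + k = 0 then 1 else 0))) {0..1}" for l
        by (intro has_integral_mult_right has_integral_cis)
      have "\<exists>J. ((\<lambda>x. \<Sum>\<^sub>\<infinity>l. c l * cis (2 * pi * of_int (l + k) * x)) has_integral J) {0..1} \<and>
        ((\<lambda>l. c l * (if l + k = 0 then 1 else 0)) has_sum J) UNIV"
        by (rule has_integral_infsum_continuous(2)[where M = "\<lambda>l. norm (c l)", OF _ _ sc i])
           (auto intro!: continuous_intros simp: norm_mult)
      then obtain J where J: "((\<lambda>x. \<Sum>\<^sub>\<infinity>l. c l * cis (2 * pi * of_int (l + k) * x)) has_integral J) {0..1}"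
        "((\<lambda>l. c l * (if l + k = 0 then 1 else 0)) has_sum J) UNIV" by blast
      have "((\<lambda>l. c l * (if l + k = 0 then 1 else 0)) has_sum (\<Sum>l\<in>{-k}. c l * (if l + k = 0 then 1 else 0))) UNIV"
        by (rule has_sum_finite_neutralI[of "{-k}"]) (auto simp: algebra_simps)
      hence "J = c (- k)" using has_sum_unique[OF J(2)] by simp
      thus ?thesis using J(1) by simp
    qed
    moreover have "(\<Sum>\<^sub>\<infinity>l. c l * cis (2 * pi * of_int (l + k) * x)) = G x * cis (2 * pi * of_int k * x)" for x
      unfolding G_def infsum_cmult_left'[symmetric]
      by (intro infsum_cong) (simp add: cis_mult ring_distribs mult.assoc)
    ultimately show ?thesis by simp
  qed
  have intF: "((\<lambda>x. F x * cis (2 * pi * of_int k * x)) has_integral c (- k)) {0..1}" for k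
  proof -
    define g where "g x = \<phi> x * cis (2 * pi * of_int k * x)" for x
    have contg: "continuous_on A g" for A unfolding g_def
      by (intro continuous_intros continuous_on_subset[OF cont]) auto
    have g_shift: "g (x + of_int n) = \<phi> (x + of_int n) * cis (2 * pi * of_int k * x)" for x and n :: int
    proof -
      have "cis (2 * pi * of_int k * (x + of_int n)) = cis (2 * pi * of_int k * x) * cis (2 * pi * of_int (k * n))"
        by (simp add: cis_mult ring_distribs mult.assoc)
      also have "cis (2 * pi * of_int (k * n)) = 1" using cis_multiple_2pi[of "of_int (k * n)"] by (simp only: Ints_of_int)
      finally show ?thesis by (simp add: g_def)
    qed
    have contg': "continuous_on A (\<lambda>x. g (x + b))" for A b
      by (rule continuous_on_compose2[OF contg[of UNIV]]) (auto intro: continuous_intros)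
    have "\<exists>J. ((\<lambda>x. \<Sum>\<^sub>\<infinity>n::int. g (x + of_int n)) has_integral J) {0..1} \<and>
        ((\<lambda>n::int. integral {0..1} (\<lambda>x. g (x + of_int n))) has_sum J) UNIV"
      by (rule has_integral_infsum_continuous(2)[OF contg' _ M integrable_integral])
         (auto intro!: integrable_continuous_real contg' continuous_intros contc simp: g_shift norm_mult bound)
    then obtain J where J: "((\<lambda>x. \<Sum>\<^sub>\<infinity>n::int. g (x + of_int n)) has_integral J) {0..1}"
        "((\<lambda>n::int. integral {0..1} (\<lambda>x. g (x + of_int n))) has_sum J) UNIV" by blast
    have "J = c (- k)"
    proof -
      \<comment> \<open>The unordered sum is evaluated along the sets -N <= n < N; they are
        half-open because n contributes the integral over [n, n + 1], so that the pieces tile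
        [-N, N].\<close>
      define A where "A N = {- int N..<int N}" for N
      have lim1: "(\<lambda>N. \<Sum>n\<in>A N. integral {0..1} (\<lambda>x. g (x + of_int n))) \<longlonglongrightarrow> J"
      proof -
        have "filterlim A (finite_subsets_at_top UNIV) sequentially"
          unfolding filterlim_finite_subsets_at_top
        proof (intro allI impI)
          fix X :: "int set" assume "finite X \<and> X \<subseteq> UNIV"
          hence X: "finite X" by simp
          obtain B where B: "\<And>x. x \<in> X \<Longrightarrow> \<bar>x\<bar> \<le> B"
            using X by (metis finite_imageI imageI Max_ge)
          show "\<forall>\<^sub>F N in sequentially. finite (A N) \<and> X \<subseteq> A N \<and> A N \<subseteq> UNIV"
            using eventually_gt_at_top[of "nat B"]
          proof eventually_elim
            case (elim N)
            have "x \<in> A N" if "x \<in> X" for x using B[OF that] elim by (auto simp: A_def)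
            thus ?case by (auto simp: A_def)
          qed
        qed
        thus ?thesis using J(2) unfolding has_sum_def by (rule filterlim_compose[rotated])
      qed
      have sum_eq: "(\<Sum>n\<in>A N. integral {0..1} (\<lambda>x. g (x + of_int n))) = integral {- real N..real N} g" for N
      proof (induction N)
        case (Suc N)
        have A: "A (Suc N) = insert (- int (Suc N)) (insert (int N) (A N))" by (auto simp: A_def)
        have sh: "integral {0..1} (\<lambda>x. g (x + of_int n)) = integral {of_int n..of_int n + 1} g" for n :: int
        proof -
          have "(g has_integral integral {of_int n..of_int n + 1} g) (cbox (of_int n) (of_int n + 1))"
            using integrable_continuous_real[OF contg] by (simp add: integrable_integral)
          from has_integral_affinity[OF this, of 1 "of_int n"]
          have "((\<lambda>x. g (x + of_int n)) has_integral integral {of_int n..of_int n + 1} g) {0..1}"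
            by (simp add: cbox_interval)
          thus ?thesis by (rule integral_unique)
        qed
        have "integral {- real (Suc N)..real (Suc N)} g = integral {- real (Suc N)..- real N} g + integral {- real N..real N} g + integral {real N..real (Suc N)} g"
          by (subst Henstock_Kurzweil_Integration.integral_combine; (intro integrable_continuous_real contg)?; simp)+
        moreover have "finite (A N)" "- int (Suc N) \<notin> insert (int N) (A N)" "int N \<notin> A N" by (auto simp: A_def)
        ultimately show ?case unfolding A using Suc.IH sh[of "- int (Suc N)"] sh[of "int N"] by (simp add: add_ac)
      qed (simp add: A_def)
      have intg: "integrable lborel g" unfolding g_def
        by (rule Bochner_Integration.integrable_bound[OF int]) 
           (auto simp: norm_mult intro!: borel_measurable_continuous_onI continuous_intros cont)
      have set_eq: "(LBINT x. indicator {- real N..real N} x *\<^sub>R g x) = integral {- real N..real N} g" for N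
      proof -
        have "set_integrable lborel {- real N..real N} g"
          unfolding set_integrable_def by (intro integrable_mult_indicator intg) auto
        from set_borel_integral_eq_integral(2)[OF this] show ?thesis by (simp add: set_lebesgue_integral_def)
      qed
      have "(\<lambda>N. LBINT x. indicator {- real N..real N} x *\<^sub>R g x) \<longlonglongrightarrow> (LBINT x. g x)"
      proof (rule integral_dominated_convergence[where w = "\<lambda>x. norm (g x)"])
        show "AE x in lborel. (\<lambda>N. indicator {- real N..real N} x *\<^sub>R g x) \<longlonglongrightarrow> g x"
        proof (intro AE_I2 tendsto_eventually)
          fix x :: real
          show "\<forall>\<^sub>F N in sequentially. indicator {- real N..real N} x *\<^sub>R g x = g x"
            using eventually_ge_at_top[of "nat \<lceil>\<bar>x\<bar>\<rceil>"]
            by eventually_elim (auto simp: indicator_def nat_ceiling_le_eq)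
        qed
      qed (use intg in \<open>auto simp: indicator_def\<close>)
      moreover have "(LBINT x. g x) = c (- k)" by (simp add: c g_def)
      ultimately have "(\<lambda>N. integral {- real N..real N} g) \<longlonglongrightarrow> c (- k)" by (simp add: set_eq)
      thus ?thesis using lim1 LIMSEQ_unique unfolding sum_eq by blast
    qed
    moreover have "(\<Sum>\<^sub>\<infinity>n::int. g (x + of_int n)) = F x * cis (2 * pi * of_int k * x)" for x
      unfolding F_def infsum_cmult_left'[symmetric] by (intro infsum_cong) (simp add: g_shift)
    ultimately show ?thesis using J(1) by simp
  qed
  have "F 0 - G 0 = 0"
  proof (rule fourier_coeffs_zero_imp_zero[of "\<lambda>x. F x - G x"])
    show "continuous_on {0..1} (\<lambda>x. F x - G x)" by (intro continuous_intros contF contG)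
    have "F 1 = F 0"
      unfolding F_def
      by (rule infsum_reindex_bij_witness[of _ "\<lambda>n. n - 1" "\<lambda>n. n + 1"]) (auto simp: add_ac)
    moreover have "G 1 = G 0"
      unfolding G_def by (intro infsum_cong) (use cis_multiple_2pi in \<open>simp add: mult.assoc\<close>)
    ultimately show "F 1 - G 1 = F 0 - G 0" by simp
    show "((\<lambda>u. (F u - G u) * cis (2 * pi * of_int k * u)) has_integral 0) {0..1}" for k
      using has_integral_diff[OF intF[of k] intG[of k]] by (simp add: left_diff_distrib)
  qed
  thus ?thesis by (simp add: F_def G_def)
qed


section \<open>Gaussian sums in one variable\<close>

lemma summable_on_int_exp_neg_sq:
  fixes c u :: real
  assumes "c > 0" shows "(\<lambda>n::int. exp (- c * (of_int n + u)\<^sup>2)) summable_on UNIV"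
proof -
  have geo: "(\<lambda>n::nat. exp (- (c / 2) * real n)) summable_on UNIV"
  proof (rule norm_summable_imp_summable_on)
    have "summable (\<lambda>n. exp (- (c / 2)) ^ n)" using assms by (intro summable_geometric) auto
    thus "summable (\<lambda>n. norm (exp (- (c / 2) * real n)))"
      by (simp add: exp_of_nat_mult[symmetric] mult_ac)
  qed
  let ?g = "\<lambda>n::int. exp (- (c / 2) * \<bar>of_int n\<bar>)"
  have "?g summable_on range int" using geo by (subst summable_on_reindex) (auto simp: o_def)
  moreover have "?g summable_on range (\<lambda>n. - int n)" using geo
    by (subst summable_on_reindex) (auto simp: o_def inj_on_def)
  moreover have "range int \<union> range (\<lambda>n. - int n) = UNIV"
  proof -
    have "n \<in> range int \<union> range (\<lambda>n. - int n)" for n by (cases n rule: int_cases2) auto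
    thus ?thesis by blast
  qed
  ultimately have "?g summable_on UNIV" using summable_on_union by metis
  hence "(\<lambda>n. exp (c * u\<^sup>2) * ?g n) summable_on UNIV" by (rule summable_on_cmult_right)
  thus ?thesis
  proof (rule summable_on_comparison_test)
    fix n :: int
    have "\<bar>real_of_int n\<bar> \<le> (real_of_int n)\<^sup>2" for n :: int
    proof -
      have "\<bar>n\<bar> * 1 \<le> \<bar>n\<bar> * \<bar>n\<bar>" if "n \<noteq> 0" using that by (intro mult_left_mono) linarith+
      hence "\<bar>n\<bar> \<le> n\<^sup>2" by (cases "n = 0") (simp_all add: power2_eq_square)
      hence "real_of_int \<bar>n\<bar> \<le> real_of_int (n\<^sup>2)" by (simp only: of_int_le_iff)
      thus ?thesis by simp
    qed
    \<comment> \<open>Nonnegativity of (n + 2u)^2 gives (n + u)^2 >= n^2/2 - u^2, and n^2 >= |n| for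
      integers; this leaves a geometric series in |n|.\<close>
    from this[of n] have "\<bar>real_of_int n\<bar> / 2 - u\<^sup>2 \<le> (of_int n + u)\<^sup>2"
      using zero_le_power2[of "of_int n + 2 * u"] by (simp add: power2_eq_square algebra_simps)
    hence "c * (\<bar>real_of_int n\<bar> / 2 - u\<^sup>2) \<le> c * (of_int n + u)\<^sup>2" using assms by (intro mult_left_mono) auto
    thus "exp (- c * (of_int n + u)\<^sup>2) \<le> exp (c * u\<^sup>2) * ?g n"
      by (simp add: exp_add[symmetric] algebra_simps)
  qed auto
qed

lemma integrable_gaussian:
  assumes "a > 0" shows "integrable lborel (\<lambda>x::real. exp (- pi * a * (x + u)\<^sup>2))"
proof -
  define \<sigma> where "\<sigma> = 1 / sqrt (2 * pi * a)"
  have \<sigma>: "\<sigma> > 0" "\<sigma>\<^sup>2 = 1 / (2 * pi * a)" using assms by (simp_all add: \<sigma>_def power_divide)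
  have "integrable lborel (\<lambda>x. sqrt (2 * pi * \<sigma>\<^sup>2) * normal_density (- u) \<sigma> x)"
    using \<sigma> by (intro integrable_mult_right integrable_normal_density)
  moreover have "sqrt (2 * pi * \<sigma>\<^sup>2) * normal_density (- u) \<sigma> x = exp (- pi * a * (x + u)\<^sup>2)" for x
    using \<sigma> assms by (simp add: normal_density_def field_simps)
  ultimately show ?thesis by simp
qed

text \<open>The substitution x = -u + y/s with s^2 = 2 pi a turns pi a (x + u)^2 into y^2/2, and
  what remains is the characteristic function of the standard normal distribution.\<close>

lemma fourier_transform_gaussian:
  assumes "a > 0"
  shows "(LBINT x. of_real (exp (- pi * a * (x + u)\<^sup>2)) * cis (2 * pi * w * x))
    = of_real (1 / sqrt a * exp (- pi * w\<^sup>2 / a)) * cis (- (2 * pi * w * u))"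
proof -
  define s where "s = sqrt (2 * pi * a)"
  have s: "s > 0" "s\<^sup>2 = 2 * pi * a" using assms by (simp_all add: s_def)
  define g where "g x = of_real (exp (- pi * a * (x + u)\<^sup>2)) * cis (2 * pi * w * x)" for x
  define t where "t = 2 * pi * w / s"
  have "char std_normal_distribution t = (LBINT y. std_normal_density y *\<^sub>R iexp (t * y))"
    unfolding char_def by (subst integral_density) auto
  hence ch: "(LBINT y. std_normal_density y *\<^sub>R iexp (t * y)) = of_real (exp (- t\<^sup>2 / 2))"
    by (simp add: char_std_normal_distribution)
  have gs: "g (- u + 1 / s * y) = (of_real (sqrt (2 * pi)) * cis (- (2 * pi * w * u))) * (std_normal_density y *\<^sub>R iexp (t * y))" for y
  proof -
    have "pi * a * (- u + 1 / s * y + u)\<^sup>2 = y\<^sup>2 / 2"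
      using s assms by (simp add: power_divide)
    moreover have "cis (2 * pi * w * (- u + 1 / s * y)) = cis (- (2 * pi * w * u)) * cis (t * y)"
      by (simp add: cis_mult t_def field_simps)
    ultimately show ?thesis
      by (simp add: g_def std_normal_density_def cis_conv_exp scaleR_conv_of_real)
  qed
  have "(LBINT x. g x) = \<bar>1 / s\<bar> *\<^sub>R (LBINT y. g (- u + 1 / s * y))"
    using s by (intro lborel_integral_real_affine) auto
  also have "(LBINT y. g (- u + 1 / s * y)) = (of_real (sqrt (2 * pi)) * cis (- (2 * pi * w * u))) * of_real (exp (- t\<^sup>2 / 2))"
    unfolding gs ch[symmetric] by (rule integral_mult_right_zero)
  also have "- t\<^sup>2 / 2 = - pi * w\<^sup>2 / a" using s assms by (simp add: t_def power_divide power_mult_distrib) (simp add: field_simps power2_eq_square)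
  also have "\<bar>1 / s\<bar> = 1 / (sqrt (2 * pi) * sqrt a)" using s by (simp add: s_def real_sqrt_mult)
  finally show ?thesis using assms by (simp add: g_def scaleR_conv_of_real)
qed

text \<open>Translation u and phase v trade places. When one variable of a quadratic form is summed,
  u depends linearly on the other variables, so the factor with u on the right becomes a character
  in them.\<close>

lemma poisson_summation_gaussian:
  fixes a u v :: real
  assumes "a > 0"
  shows "(\<Sum>\<^sub>\<infinity>n::int. of_real (exp (- pi * a * (of_int n + u)\<^sup>2)) * cis (2 * pi * v * of_int n))
    = (\<Sum>\<^sub>\<infinity>k::int. of_real (1 / sqrt a * exp (- pi * (of_int k - v)\<^sup>2 / a)) * cis (2 * pi * u * (of_int k - v)))"
proof (rule poisson_summation_at_zero[where \<phi> = "\<lambda>x. of_real (exp (- pi * a * (x + u)\<^sup>2)) * cis (2 * pi * v * x)"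
      and M = "\<lambda>n. exp (pi * a * (1 + \<bar>u\<bar>)\<^sup>2) * exp (- (pi * a / 2) * (of_int n + 0)\<^sup>2)"])
  show "continuous_on UNIV (\<lambda>x. of_real (exp (- pi * a * (x + u)\<^sup>2)) * cis (2 * pi * v * x))"
    by (intro continuous_intros)
  show "integrable lborel (\<lambda>x. of_real (exp (- pi * a * (x + u)\<^sup>2)) * cis (2 * pi * v * x))"
    by (rule Bochner_Integration.integrable_bound[OF integrable_gaussian[OF assms, of u]])
       (auto simp: norm_mult intro!: borel_measurable_continuous_onI continuous_intros)
  show "(\<lambda>n::int. exp (pi * a * (1 + \<bar>u\<bar>)\<^sup>2) * exp (- (pi * a / 2) * (of_int n + 0)\<^sup>2)) summable_on UNIV"
    using assms by (intro summable_on_cmult_right summable_on_int_exp_neg_sq) auto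
  show "norm (of_real (exp (- pi * a * (x + of_int n + u)\<^sup>2)) * cis (2 * pi * v * (x + of_int n)))
      \<le> exp (pi * a * (1 + \<bar>u\<bar>)\<^sup>2) * exp (- (pi * a / 2) * (of_int n + 0)\<^sup>2)" if "x \<in> {0..1}" for n x
  proof -
    have "\<bar>x + u\<bar>\<^sup>2 \<le> (1 + \<bar>u\<bar>)\<^sup>2" using that by (intro power_mono) auto
    hence "(x + u)\<^sup>2 \<le> (1 + \<bar>u\<bar>)\<^sup>2" by simp
    moreover have "(of_int n)\<^sup>2 / 2 - (x + u)\<^sup>2 \<le> (x + of_int n + u)\<^sup>2"
      using zero_le_power2[of "of_int n + 2 * (x + u)"] by (simp add: power2_eq_square algebra_simps)
    ultimately have "(of_int n)\<^sup>2 / 2 - (1 + \<bar>u\<bar>)\<^sup>2 \<le> (x + of_int n + u)\<^sup>2" by linarith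
    hence "pi * a * ((of_int n)\<^sup>2 / 2 - (1 + \<bar>u\<bar>)\<^sup>2) \<le> pi * a * (x + of_int n + u)\<^sup>2"
      using assms by (intro mult_left_mono) auto
    thus ?thesis by (simp add: norm_mult exp_add[symmetric] right_diff_distrib)
  qed
  show "of_real (1 / sqrt a * exp (- pi * (of_int k - v)\<^sup>2 / a)) * cis (2 * pi * u * (of_int k - v)) =
      (LBINT x. of_real (exp (- pi * a * (x + u)\<^sup>2)) * cis (2 * pi * v * x) * cis (- (2 * pi * of_int k * x)))" for k
  proof -
    have "(LBINT x. of_real (exp (- pi * a * (x + u)\<^sup>2)) * cis (2 * pi * v * x) * cis (- (2 * pi * of_int k * x)))
      = (LBINT x. of_real (exp (- pi * a * (x + u)\<^sup>2)) * cis (2 * pi * (v - of_int k) * x))"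
      by (simp add: mult.assoc cis_mult) (simp add: algebra_simps)
    also have "\<dots> = of_real (1 / sqrt a * exp (- pi * (v - of_int k)\<^sup>2 / a)) * cis (- (2 * pi * (v - of_int k) * u))"
      by (rule fourier_transform_gaussian[OF assms])
    finally show ?thesis by (simp add: power2_commute[of v] algebra_simps)
  qed
  have "(\<lambda>k::int. 1 / sqrt a * exp (- (pi / a) * (of_int k + - v)\<^sup>2)) summable_on UNIV"
    using assms by (intro summable_on_cmult_right summable_on_int_exp_neg_sq) auto
  moreover have "norm (of_real (1 / sqrt a * exp (- pi * (of_int k - v)\<^sup>2 / a)) * cis (2 * pi * u * (of_int k - v)))
      = 1 / sqrt a * exp (- (pi / a) * (of_int k + - v)\<^sup>2)" for k :: int
    using assms by (simp add: norm_mult norm_divide)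
  ultimately show "(\<lambda>k::int. norm (of_real (1 / sqrt a * exp (- pi * (of_int k - v)\<^sup>2 / a)) * cis (2 * pi * u * (of_int k - v)))) summable_on UNIV"
    by simp
qed


section \<open>Poisson summation for positive definite quadratic forms\<close>

text \<open>Vectors are total functions that vanish off \<open>I\<close>, so that the index set can
  grow inside one type during an induction on its elements.\<close>

definition int_vecs :: "'i set \<Rightarrow> ('i \<Rightarrow> int) set" where
  "int_vecs I = {y. \<forall>i. i \<notin> I \<longrightarrow> y i = 0}"

definition quad_form :: "'i set \<Rightarrow> ('i \<Rightarrow> 'i \<Rightarrow> real) \<Rightarrow> ('i \<Rightarrow> real) \<Rightarrow> real" where
  "quad_form I P y = (\<Sum>i\<in>I. \<Sum>j\<in>I. P i j * y i * y j)"

lemma bij_betw_int_vecs_insert: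
  assumes "i \<notin> I"
  shows "bij_betw (\<lambda>(n, y). y(i := n)) (UNIV \<times> int_vecs I) (int_vecs (insert i I))"
  by (rule bij_betwI[where g = "\<lambda>y. (y i, y(i := 0))"])
     (use assms in \<open>auto simp: int_vecs_def fun_eq_iff\<close>)

lemma int_vecs_empty: "int_vecs {} = {\<lambda>_. 0}"
  by (auto simp: int_vecs_def)

lemma summable_on_Times_mult:
  fixes f :: "'a \<Rightarrow> real" and g :: "'b \<Rightarrow> real"
  assumes f: "f summable_on A" and g: "g summable_on B"
    and nonneg: "\<And>x. x \<in> A \<Longrightarrow> f x \<ge> 0" "\<And>y. y \<in> B \<Longrightarrow> g y \<ge> 0"
  shows "(\<lambda>(x, y). f x * g y) summable_on A \<times> B"
proof (rule summable_on_SigmaI[where g = "\<lambda>x. f x * infsum g B"])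
  show "((\<lambda>y. case (x, y) of (x, y) \<Rightarrow> f x * g y) has_sum f x * infsum g B) B" for x
    using has_sum_cmult_right[OF has_sum_infsum[OF g], of "f x"] by simp
  show "(\<lambda>x. f x * infsum g B) summable_on A" by (rule summable_on_cmult_left[OF f])
qed (use nonneg in auto)

lemma summable_on_int_vecs_gaussian:
  fixes u :: "'i \<Rightarrow> real"
  assumes "finite I" "c > 0"
  shows "(\<lambda>y. exp (- c * (\<Sum>i\<in>I. (of_int (y i) + u i)\<^sup>2))) summable_on int_vecs I"
  using assms(1)
proof induction
  case empty
  show ?case by (simp add: int_vecs_empty)
next
  case (insert i I)
  have "(\<lambda>(n, y). exp (- c * (of_int n + u i)\<^sup>2) * exp (- c * (\<Sum>j\<in>I. (of_int (y j) + u j)\<^sup>2)))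
      summable_on UNIV \<times> int_vecs I"
    by (intro summable_on_Times_mult summable_on_int_exp_neg_sq insert.IH assms(2)) auto
  moreover have "exp (- c * (of_int n + u i)\<^sup>2) * exp (- c * (\<Sum>j\<in>I. (of_int (y j) + u j)\<^sup>2)) =
      exp (- c * (\<Sum>j\<in>insert i I. (of_int ((y(i := n)) j) + u j)\<^sup>2))" for n :: int and y :: "'i \<Rightarrow> int"
  proof -
    have "(\<Sum>j\<in>I. (of_int ((y(i := n)) j) + u j)\<^sup>2) = (\<Sum>j\<in>I. (of_int (y j) + u j)\<^sup>2)"
      using insert.hyps by (intro sum.cong) auto
    thus ?thesis using insert.hyps by (simp add: exp_add[symmetric] algebra_simps)
  qed
  ultimately have "(\<lambda>z. exp (- c * (\<Sum>j\<in>insert i I. (of_int ((case z of (n, y) \<Rightarrow> y(i := n)) j) + u j)\<^sup>2)))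
      summable_on UNIV \<times> int_vecs I" by (simp add: case_prod_unfold)
  thus ?case
    using summable_on_reindex_bij_betw[OF bij_betw_int_vecs_insert[OF insert.hyps(2)],
      of "\<lambda>y. exp (- c * (\<Sum>j\<in>insert i I. (of_int (y j) + u j)\<^sup>2))"] by simp
qed

lemma summable_on_theta:
  assumes I: "finite I" and \<delta>: "\<delta> > 0" and coercive: "\<And>y. quad_form I P y \<ge> \<delta> * (\<Sum>i\<in>I. (y i)\<^sup>2)" and "t > 0"
  shows "(\<lambda>y. exp (- pi * t * quad_form I P (\<lambda>i. of_int (y i)))) summable_on int_vecs I"
proof -
  have "(\<lambda>y. exp (- (pi * t * \<delta>) * (\<Sum>i\<in>I. (of_int (y i) + 0)\<^sup>2))) summable_on int_vecs I"
    using assms by (intro summable_on_int_vecs_gaussian) auto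
  thus ?thesis
  proof (rule summable_on_comparison_test)
    fix y :: "'a \<Rightarrow> int"
    have "pi * t * (\<delta> * (\<Sum>i\<in>I. (of_int (y i))\<^sup>2)) \<le> pi * t * quad_form I P (\<lambda>i. of_int (y i))"
      using assms by (intro mult_left_mono coercive) auto
    thus "exp (- pi * t * quad_form I P (\<lambda>i. of_int (y i))) \<le> exp (- (pi * t * \<delta>) * (\<Sum>i\<in>I. (of_int (y i) + 0)\<^sup>2))"
      by (simp add: mult.assoc)
  qed auto
qed

text \<open>Completing the square in coordinate \<open>i\<close>. The matrix of the remaining form
  is the Schur complement of the entry \<open>P i i\<close>.\<close>

lemma quad_form_insert:
  assumes "finite I" "i \<notin> I" and sym: "\<And>j. j \<in> I \<Longrightarrow> P j i = P i j" and a: "P i i \<noteq> 0"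
  shows "quad_form (insert i I) P y = P i i * (y i + (\<Sum>j\<in>I. P i j * y j) / P i i)\<^sup>2
     + quad_form I (\<lambda>j l. P j l - P i j * P i l / P i i) y"
proof -
  define \<beta> where "\<beta> = (\<Sum>j\<in>I. P i j * y j)"
  have 1: "(\<Sum>j\<in>I. P i j * y i * y j) = y i * \<beta>"
    unfolding \<beta>_def sum_distrib_left by (intro sum.cong) auto
  have 2: "(\<Sum>j\<in>I. P j i * y j * y i) = y i * \<beta>"
    unfolding \<beta>_def sum_distrib_left by (intro sum.cong) (auto simp: sym)
  have "\<beta> * \<beta> = (\<Sum>j\<in>I. \<Sum>l\<in>I. (P i j * y j) * (P i l * y l))"
    unfolding \<beta>_def by (rule sum_product)
  hence 3: "\<beta>\<^sup>2 / P i i = (\<Sum>j\<in>I. \<Sum>l\<in>I. P i j * P i l / P i i * y j * y l)"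
    by (simp add: power2_eq_square sum_divide_distrib mult_ac)
  have 4: "quad_form I (\<lambda>j l. P j l - P i j * P i l / P i i) y = quad_form I P y - \<beta>\<^sup>2 / P i i"
    unfolding 3 quad_form_def sum_subtractf[symmetric] by (simp add: left_diff_distrib)
  have "quad_form (insert i I) P y = P i i * y i * y i + y i * \<beta> + (y i * \<beta> + quad_form I P y)"
    using assms(1,2) 1 2 by (simp add: quad_form_def sum.distrib)
  thus ?thesis unfolding 4 \<beta>_def[symmetric] using a by (simp add: power2_eq_square field_simps)
qed

text \<open>The third clause says that \<open>Qs\<close> is the form of the inverse matrix of \<open>P\<close>, without mentioning
  the inverse; \<open>C\<close> is the inverse square root of the determinant.\<close>
definition poisson_dual :: "'i set \<Rightarrow> ('i \<Rightarrow> 'i \<Rightarrow> real) \<Rightarrow> real \<Rightarrow> (('i \<Rightarrow> real) \<Rightarrow> real) \<Rightarrow> bool" where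
  "poisson_dual I P C Qs \<longleftrightarrow> C > 0 \<and> (\<forall>w w'. (\<forall>i\<in>I. w i = w' i) \<longrightarrow> Qs w = Qs w') \<and>
    (\<forall>y. Qs (\<lambda>i. \<Sum>j\<in>I. P i j * y j) = quad_form I P y) \<and>
    (\<forall>t>0. \<forall>v. (\<lambda>k. C * (1 / sqrt t) ^ card I * exp (- pi * Qs (\<lambda>i. of_int (k i) - v i) / t)) summable_on int_vecs I \<and>
      (\<Sum>\<^sub>\<infinity>y\<in>int_vecs I. of_real (exp (- pi * t * quad_form I P (\<lambda>i. of_int (y i)))) * cis (2 * pi * (\<Sum>i\<in>I. v i * of_int (y i))))
      = of_real (\<Sum>\<^sub>\<infinity>k\<in>int_vecs I. C * (1 / sqrt t) ^ card I * exp (- pi * Qs (\<lambda>i. of_int (k i) - v i) / t)))"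

lemma poisson_dualD:
  assumes "poisson_dual I P C Qs"
  shows "C > 0" and "\<forall>i\<in>I. w i = w' i \<Longrightarrow> Qs w = Qs w'"
    and "Qs (\<lambda>i. \<Sum>j\<in>I. P i j * y j) = quad_form I P y"
    and "t > 0 \<Longrightarrow> (\<lambda>k. C * (1 / sqrt t) ^ card I * exp (- pi * Qs (\<lambda>i. of_int (k i) - v i) / t)) summable_on int_vecs I"
    and "t > 0 \<Longrightarrow> (\<Sum>\<^sub>\<infinity>y\<in>int_vecs I. of_real (exp (- pi * t * quad_form I P (\<lambda>i. of_int (y i)))) * cis (2 * pi * (\<Sum>i\<in>I. v i * of_int (y i))))
      = of_real (\<Sum>\<^sub>\<infinity>k\<in>int_vecs I. C * (1 / sqrt t) ^ card I * exp (- pi * Qs (\<lambda>i. of_int (k i) - v i) / t))"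
proof -
  note dual = assms[unfolded poisson_dual_def]
  note main = dual[THEN conjunct2, THEN conjunct2, THEN conjunct2, THEN spec, THEN mp, THEN spec]
  show "C > 0" by (rule dual[THEN conjunct1])
  show "\<forall>i\<in>I. w i = w' i \<Longrightarrow> Qs w = Qs w'" by (rule dual[THEN conjunct2, THEN conjunct1, THEN spec, THEN spec, THEN mp])
  show "Qs (\<lambda>i. \<Sum>j\<in>I. P i j * y j) = quad_form I P y" by (rule dual[THEN conjunct2, THEN conjunct2, THEN conjunct1, THEN spec])
  show "t > 0 \<Longrightarrow> (\<lambda>k. C * (1 / sqrt t) ^ card I * exp (- pi * Qs (\<lambda>i. of_int (k i) - v i) / t)) summable_on int_vecs I"
    by (rule main[THEN conjunct1])
  show "t > 0 \<Longrightarrow> (\<Sum>\<^sub>\<infinity>y\<in>int_vecs I. of_real (exp (- pi * t * quad_form I P (\<lambda>i. of_int (y i)))) * cis (2 * pi * (\<Sum>i\<in>I. v i * of_int (y i))))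
      = of_real (\<Sum>\<^sub>\<infinity>k\<in>int_vecs I. C * (1 / sqrt t) ^ card I * exp (- pi * Qs (\<lambda>i. of_int (k i) - v i) / t))"
    by (rule main[THEN conjunct2])
qed

text \<open>One variable is summed at a time, by completing the square (\<open>quad_form_insert\<close>). Each step turns
  a shift in the remaining variables into a phase, hence the phase \<open>v\<close> in the statement.\<close>
theorem poisson_summation_quad_form:
  fixes P :: "'i \<Rightarrow> 'i \<Rightarrow> real"
  assumes "finite I" and "\<forall>i\<in>I. \<forall>j\<in>I. P i j = P j i" and "\<delta> > 0"
    and "\<And>y. quad_form I P y \<ge> \<delta> * (\<Sum>i\<in>I. (y i)\<^sup>2)"
  shows "\<exists>C Qs. poisson_dual I P C Qs"
  using assms
proof (induction I arbitrary: P rule: finite_induct)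
  case empty
  show ?case by (intro exI[of _ 1] exI[of _ "\<lambda>_. 0"]) (auto simp: poisson_dual_def int_vecs_empty quad_form_def)
next
  case (insert i I)
  note sym = insert.prems(1)[rule_format] and \<delta> = insert.prems(2) and coercive = insert.prems(3)
  define a where "a = P i i"
  define S where "S = (\<lambda>j l. P j l - P i j * P i l / a)"
  have "a > 0"
  proof -
    have diag: "quad_form J P (\<lambda>j. if j = i then 1 else 0) = P i i" if "finite J" "i \<in> J" for J
    proof -
      have "quad_form J P (\<lambda>j. if j = i then 1 else 0) = (\<Sum>k\<in>J. if k = i then (\<Sum>l\<in>J. if l = i then P k l else 0) else 0)"
        unfolding quad_form_def by (intro sum.cong) (auto intro!: sum.neutral sum.cong)
      thus ?thesis using that by simp
    qed
    have "quad_form (insert i I) P (\<lambda>j. if j = i then 1 else 0) = a"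
      unfolding a_def using insert.hyps by (intro diag) auto
    moreover have "(\<Sum>j\<in>insert i I. (if j = i then 1 else 0 :: real)\<^sup>2) = 1"
      using insert.hyps by (auto intro!: sum.neutral)
    ultimately show ?thesis using coercive[of "\<lambda>j. if j = i then 1 else 0"] \<delta> by simp
  qed
  have qf: "quad_form (insert i I) P y = a * (y i + (\<Sum>j\<in>I. P i j * y j) / a)\<^sup>2 + quad_form I S y" for y
    unfolding S_def a_def by (rule quad_form_insert) (use insert.hyps sym \<open>a > 0\<close> in \<open>auto simp: a_def\<close>)
  have coerciveS: "quad_form I S y \<ge> \<delta> * (\<Sum>j\<in>I. (y j)\<^sup>2)" for y
  proof -
    \<comment> \<open>This value of coordinate \<open>i\<close> makes the square vanish, so the
      Schur complement takes values of the original form and inherits the same \<delta>.\<close>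
    define y' where "y' = y(i := - (\<Sum>j\<in>I. P i j * y j) / a)"
    have y': "j \<in> I \<Longrightarrow> y' j = y j" for j using insert.hyps by (auto simp: y'_def)
    have "quad_form (insert i I) P y' = quad_form I S y'"
      unfolding qf using y' \<open>a > 0\<close> by (simp add: y'_def)
    also have "\<dots> = quad_form I S y" using y' by (auto simp: quad_form_def intro!: sum.cong)
    finally have "\<delta> * (\<Sum>j\<in>insert i I. (y' j)\<^sup>2) \<le> quad_form I S y" using coercive[of y'] by simp
    moreover have "(\<Sum>j\<in>I. (y j)\<^sup>2) \<le> (\<Sum>j\<in>insert i I. (y' j)\<^sup>2)" using insert.hyps y' by simp
    hence "\<delta> * (\<Sum>j\<in>I. (y j)\<^sup>2) \<le> \<delta> * (\<Sum>j\<in>insert i I. (y' j)\<^sup>2)" using \<delta> by (intro mult_left_mono) auto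
    ultimately show ?thesis by linarith
  qed
  have "\<forall>j\<in>I. \<forall>l\<in>I. S j l = S l j" unfolding S_def using sym by (simp add: mult.commute)
  from insert.IH[of S, OF this \<delta> coerciveS] obtain C' Q' where dual: "poisson_dual I S C' Q'" by blast
  note C' = poisson_dualD(1)[OF dual] and Q'cong = poisson_dualD(2)[OF dual] and Q'S = poisson_dualD(3)[OF dual]
    and sumQ' = poisson_dualD(4)[OF dual] and poisson = poisson_dualD(5)[OF dual]
  \<comment> \<open>Block inversion with pivot a: the inverse form is the square on the pivot
    divided by a, plus the inverse form of the Schur complement after \<open>w i\<close> has been
    eliminated from the other coordinates. The constant below collects a factor 1/sqrt a per
    pivot.\<close>
  define Qs where "Qs w = (w i)\<^sup>2 / a + Q' (\<lambda>j. w j - P i j * w i / a)" for w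
  define C where "C = C' / sqrt a"
  show ?case
    unfolding poisson_dual_def
  proof (intro exI[of _ C] exI[of _ Qs] conjI allI impI)
    show "C > 0" using C' \<open>a > 0\<close> by (simp add: C_def)
    show "Qs w = Qs w'" if "\<forall>j\<in>insert i I. w j = w' j" for w w'
    proof -
      have "Q' (\<lambda>j. w j - P i j * w i / a) = Q' (\<lambda>j. w' j - P i j * w' i / a)"
        by (rule Q'cong) (use that in auto)
      thus ?thesis using that by (simp add: Qs_def)
    qed
    show "Qs (\<lambda>k. \<Sum>j\<in>insert i I. P k j * y j) = quad_form (insert i I) P y" for y
    proof -
      define \<beta> where "\<beta> = (\<Sum>j\<in>I. P i j * y j)"
      have wi: "(\<Sum>j\<in>insert i I. P i j * y j) = a * y i + \<beta>" using insert.hyps by (simp add: a_def \<beta>_def)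
      have "Q' (\<lambda>k. (\<Sum>j\<in>insert i I. P k j * y j) - P i k * (a * y i + \<beta>) / a) = Q' (\<lambda>k. \<Sum>j\<in>I. S k j * y j)"
      proof (rule Q'cong, intro ballI)
        fix k assume k: "k \<in> I"
        have "(\<Sum>j\<in>I. S k j * y j) = (\<Sum>j\<in>I. P k j * y j) - P i k * \<beta> / a"
        proof -
          have "(\<Sum>j\<in>I. S k j * y j) = (\<Sum>j\<in>I. P k j * y j - P i k * (P i j * y j) / a)"
            by (intro sum.cong) (auto simp: S_def left_diff_distrib)
          thus ?thesis by (simp add: sum_subtractf \<beta>_def sum_distrib_left sum_divide_distrib)
        qed
        moreover have "P k i = P i k" using sym k by auto
        ultimately show "(\<Sum>j\<in>insert i I. P k j * y j) - P i k * (a * y i + \<beta>) / a = (\<Sum>j\<in>I. S k j * y j)"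
          using insert.hyps \<open>a > 0\<close> by (simp add: field_simps)
      qed
      hence "Qs (\<lambda>k. \<Sum>j\<in>insert i I. P k j * y j) = (a * y i + \<beta>)\<^sup>2 / a + quad_form I S y"
        unfolding Qs_def wi Q'S by simp
      also have "(a * y i + \<beta>)\<^sup>2 / a = a * (y i + \<beta> / a)\<^sup>2"
        using \<open>a > 0\<close> by (simp add: power2_eq_square field_simps)
      finally show ?thesis unfolding qf \<beta>_def .
    qed
    fix t :: real and v :: "'i \<Rightarrow> real" assume t: "t > 0"
    define B where "B = int_vecs I"
    define \<beta> where "\<beta> y = (\<Sum>j\<in>I. P i j * of_int (y j))" for y :: "'i \<Rightarrow> int"
    \<comment> \<open>\<open>f\<close>, \<open>g\<close> and \<open>h\<close> are the summands
      before any transformation, after transforming the variable n, and after transforming all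
      variables.\<close>
    define f where "f = (\<lambda>(n::int, y). of_real (exp (- pi * (t * a) * (of_int n + \<beta> y / a)\<^sup>2)) * cis (2 * pi * v i * of_int n) *
       (of_real (exp (- pi * t * quad_form I S (\<lambda>j. of_int (y j)))) * cis (2 * pi * (\<Sum>j\<in>I. v j * of_int (y j)))))"
    define g where "g = (\<lambda>(k::int, y). of_real (1 / sqrt (t * a) * exp (- pi * (of_int k - v i)\<^sup>2 / (t * a))) * cis (2 * pi * (\<beta> y / a) * (of_int k - v i)) *
       (of_real (exp (- pi * t * quad_form I S (\<lambda>j. of_int (y j)))) * cis (2 * pi * (\<Sum>j\<in>I. v j * of_int (y j)))))"
    define h where "h = (\<lambda>(n::int, k). C * (1 / sqrt t) ^ card (insert i I) * exp (- pi * Qs (\<lambda>j. of_int ((k(i := n)) j) - v j) / t))"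
    define Hr where "Hr n = (\<Sum>\<^sub>\<infinity>k\<in>B. h (n, k))" for n
    have split: "quad_form (insert i I) P (\<lambda>j. of_int ((y(i := n)) j)) = a * (of_int n + \<beta> y / a)\<^sup>2 + quad_form I S (\<lambda>j. of_int (y j))" for n y
    proof -
      have "quad_form I S (\<lambda>j. of_int ((y(i := n)) j)) = quad_form I S (\<lambda>j. of_int (y j))"
        using insert.hyps by (auto simp: quad_form_def intro!: sum.cong)
      moreover have "(\<Sum>j\<in>I. P i j * of_int ((y(i := n)) j)) = \<beta> y"
        using insert.hyps by (auto simp: \<beta>_def intro!: sum.cong)
      ultimately show ?thesis unfolding qf by simp
    qed
    have f_eq: "f (n, y) = of_real (exp (- pi * t * quad_form (insert i I) P (\<lambda>j. of_int ((y(i := n)) j)))) * cis (2 * pi * (\<Sum>j\<in>insert i I. v j * of_int ((y(i := n)) j)))" for n y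
    proof -
      have "(\<Sum>j\<in>I. v j * of_int ((y(i := n)) j)) = (\<Sum>j\<in>I. v j * of_int (y j))"
        using insert.hyps by (auto intro!: sum.cong)
      hence "(\<Sum>j\<in>insert i I. v j * of_int ((y(i := n)) j)) = v i * of_int n + (\<Sum>j\<in>I. v j * of_int (y j))"
        using insert.hyps by simp
      hence "cis (2 * pi * (\<Sum>j\<in>insert i I. v j * of_int ((y(i := n)) j))) = cis (2 * pi * v i * of_int n) * cis (2 * pi * (\<Sum>j\<in>I. v j * of_int (y j)))"
        by (simp add: cis_mult algebra_simps)
      moreover have "exp (- pi * t * quad_form (insert i I) P (\<lambda>j. of_int ((y(i := n)) j))) =
         exp (- pi * (t * a) * (of_int n + \<beta> y / a)\<^sup>2) * exp (- pi * t * quad_form I S (\<lambda>j. of_int (y j)))"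
        unfolding split exp_add[symmetric] by (rule arg_cong[where f = exp]) (simp add: algebra_simps)
      ultimately show ?thesis by (simp add: f_def)
    qed
    note bij = bij_betw_int_vecs_insert[OF insert.hyps(2), folded B_def]
    have f_sum: "f summable_on UNIV \<times> B"
    proof -
      have "(\<lambda>y. exp (- pi * t * quad_form (insert i I) P (\<lambda>j. of_int (y j)))) summable_on int_vecs (insert i I)"
        using insert.hyps by (intro summable_on_theta[OF _ \<delta> coercive t]) auto
      hence "(\<lambda>z. norm (f z)) summable_on UNIV \<times> B"
        unfolding summable_on_reindex_bij_betw[OF bij, symmetric]
        by (rule summable_on_cong[THEN iffD1, rotated]) (auto simp: f_eq norm_mult)
      thus ?thesis by (rule abs_summable_summable)
    qed
    have gaussB: "(\<lambda>y. exp (- pi * t * quad_form I S (\<lambda>j. of_int (y j)))) summable_on B"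
      unfolding B_def using insert.hyps by (intro summable_on_theta[OF _ \<delta> coerciveS t]) auto
    have g_sum: "g summable_on UNIV \<times> B"
    proof -
      have "(\<lambda>k::int. 1 / sqrt (t * a) * exp (- (pi / (t * a)) * (of_int k + - v i)\<^sup>2)) summable_on UNIV"
        using t \<open>a > 0\<close> by (intro summable_on_cmult_right summable_on_int_exp_neg_sq) auto
      from summable_on_Times_mult[OF this gaussB] 
      have "(\<lambda>z. norm (g z)) summable_on UNIV \<times> B"
        using t \<open>a > 0\<close> by (simp add: g_def case_prod_unfold norm_mult norm_divide)
      thus ?thesis by (rule abs_summable_summable)
    qed
    define S1 where "S1 = infsum f (UNIV \<times> B)"
    have f1: "(f has_sum S1) (UNIV \<times> B)" using f_sum by (simp add: S1_def)
    have inner_eq: "(\<Sum>\<^sub>\<infinity>n. f (n, y)) = (\<Sum>\<^sub>\<infinity>k. g (k, y))" for y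
    proof -
      have "t * a > 0" using t \<open>a > 0\<close> by simp
      from poisson_summation_gaussian[OF this, of "\<beta> y / a" "v i"] show ?thesis
        unfolding f_def g_def prod.case infsum_cmult_left' by (rule arg_cong)
    qed
    have swap: "((\<lambda>y. \<Sum>\<^sub>\<infinity>n. F (n, y)) has_sum T) B" if "(F has_sum T) (UNIV \<times> B)" for F :: "int \<times> ('i \<Rightarrow> int) \<Rightarrow> complex" and T
    proof -
      have F: "((\<lambda>(y, n). F (n, y)) has_sum T) (B \<times> UNIV)"
        using that by (subst (asm) has_sum_swap) (simp add: case_prod_unfold)
      show ?thesis
      proof (rule has_sum_SigmaD[OF F])
        fix y assume "y \<in> B"
        thus "((\<lambda>n. case (y, n) of (y, n) \<Rightarrow> F (n, y)) has_sum (\<Sum>\<^sub>\<infinity>n. F (n, y))) UNIV"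
          using summable_on_SigmaD1[OF has_sum_imp_summable[OF F], of y] by simp
      qed
    qed
    have "infsum g (UNIV \<times> B) = S1"
    proof -
      have "((\<lambda>y. \<Sum>\<^sub>\<infinity>n. g (n, y)) has_sum infsum g (UNIV \<times> B)) B"
        by (rule swap) (use g_sum in simp)
      moreover have "((\<lambda>y. \<Sum>\<^sub>\<infinity>n. g (n, y)) has_sum S1) B"
        using swap[OF f1] by (simp add: inner_eq)
      ultimately show ?thesis by (rule has_sum_unique)
    qed
    hence g1: "(g has_sum S1) (UNIV \<times> B)" using g_sum has_sum_infsum by blast
    \<comment> \<open>The character in y produced by the translation \<open>\<beta> y / a\<close> is
      merged with the phase \<open>v\<close>; the induction hypothesis is thus applied with a phase
      that depends on n.\<close>
    define v' where "v' n j = v j + P i j * (of_int n - v i) / a" for n :: int and j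
    have g_eq: "g (n, y) = of_real (1 / sqrt (t * a) * exp (- pi * (of_int n - v i)\<^sup>2 / (t * a))) *
        (of_real (exp (- pi * t * quad_form I S (\<lambda>j. of_int (y j)))) * cis (2 * pi * (\<Sum>j\<in>I. v' n j * of_int (y j))))" for n y
    proof -
      have "(\<Sum>j\<in>I. v' n j * of_int (y j)) = (\<Sum>j\<in>I. (P i j * of_int (y j)) / a * (of_int n - v i) + v j * of_int (y j))"
        by (intro sum.cong) (auto simp: v'_def distrib_right)
      also have "\<dots> = (\<beta> y / a) * (of_int n - v i) + (\<Sum>j\<in>I. v j * of_int (y j))"
        by (simp add: \<beta>_def sum.distrib sum_divide_distrib sum_distrib_right)
      finally have "2 * pi * (\<Sum>j\<in>I. v' n j * of_int (y j)) = 2 * pi * (\<beta> y / a) * (of_int n - v i) + 2 * pi * (\<Sum>j\<in>I. v j * of_int (y j))"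
        by (simp only: distrib_left mult.assoc)
      hence "cis (2 * pi * (\<Sum>j\<in>I. v' n j * of_int (y j))) = cis (2 * pi * (\<beta> y / a) * (of_int n - v i)) * cis (2 * pi * (\<Sum>j\<in>I. v j * of_int (y j)))"
        by (simp only: cis_mult)
      thus ?thesis by (simp add: g_def)
    qed
    have h_eq: "h (n, k) = 1 / sqrt (t * a) * exp (- pi * (of_int n - v i)\<^sup>2 / (t * a)) *
        (C' * (1 / sqrt t) ^ card I * exp (- pi * Q' (\<lambda>j. of_int (k j) - v' n j) / t))" for n k
    proof -
      have "Q' (\<lambda>j. of_int ((k(i := n)) j) - v j - P i j * (of_int ((k(i := n)) i) - v i) / a) = Q' (\<lambda>j. of_int (k j) - v' n j)"
        by (rule Q'cong) (use insert.hyps in \<open>auto simp: v'_def\<close>)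
      hence "Qs (\<lambda>j. of_int ((k(i := n)) j) - v j) = (of_int n - v i)\<^sup>2 / a + Q' (\<lambda>j. of_int (k j) - v' n j)"
        by (simp add: Qs_def)
      hence "exp (- pi * Qs (\<lambda>j. of_int ((k(i := n)) j) - v j) / t) = exp (- pi * (of_int n - v i)\<^sup>2 / (t * a)) * exp (- pi * Q' (\<lambda>j. of_int (k j) - v' n j) / t)"
        using t \<open>a > 0\<close> by (simp add: exp_add[symmetric] field_simps)
      thus ?thesis using insert.hyps t \<open>a > 0\<close> by (simp add: h_def C_def real_sqrt_mult mult_ac)
    qed
    have h_summ: "(\<lambda>k. h (n, k)) summable_on B" for n
      unfolding h_eq B_def by (intro summable_on_cmult_right sumQ' t)
    have gH: "((\<lambda>y. g (n, y)) has_sum of_real (Hr n)) B" for n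
    proof -
      have "(\<lambda>y. g (n, y)) summable_on B"
        using summable_on_SigmaD1[of "\<lambda>n y. g (n, y)" UNIV "\<lambda>_. B" n] g_sum by simp
      moreover have "(\<Sum>\<^sub>\<infinity>y\<in>B. g (n, y)) = of_real (Hr n)"
        unfolding g_eq Hr_def h_eq infsum_cmult_right' B_def poisson[OF t] of_real_mult ..
      ultimately show ?thesis by (metis has_sum_infsum)
    qed
    have H: "((\<lambda>n. of_real (Hr n)) has_sum S1) UNIV"
      by (rule has_sum_SigmaD[OF g1]) (use gH in auto)
    \<comment> \<open>The iterated sum of \<open>h\<close> converges because it equals that of
      \<open>g\<close>; nonnegativity upgrades this to summability over the product.\<close>
    have h_nonneg: "h z \<ge> 0" for z unfolding h_def using C' t \<open>a > 0\<close> by (auto simp: C_def split: prod.split)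
    have h_sum: "h summable_on UNIV \<times> B"
    proof (rule summable_on_SigmaI[where g = Hr])
      show "((\<lambda>k. h (n, k)) has_sum Hr n) B" for n unfolding Hr_def using h_summ by simp
      show "Hr summable_on UNIV" using has_sum_Re[OF H] by (auto simp: summable_on_def)
    qed (use h_nonneg in auto)
    have h1: "((\<lambda>z. of_real (h z)) has_sum S1) (UNIV \<times> B)"
      by (rule has_sum_SigmaI[OF _ H]) (use h_summ h_sum in \<open>auto simp: Hr_def intro!: has_sum_of_real summable_on_of_real\<close>)
    define h' where "h' k = C * (1 / sqrt t) ^ card (insert i I) * exp (- pi * Qs (\<lambda>j. of_int (k j) - v j) / t)" for k :: "'i \<Rightarrow> int"
    have hh': "h z = h' (case z of (n, k) \<Rightarrow> k(i := n))" for z by (simp add: h_def h'_def split: prod.split)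
    show "h' summable_on int_vecs (insert i I)"
      unfolding summable_on_reindex_bij_betw[OF bij, of h', symmetric] hh'[symmetric] using h_sum by (simp add: eta_contract_eq)
    define f' where "f' y = of_real (exp (- pi * t * quad_form (insert i I) P (\<lambda>j. of_int (y j)))) * cis (2 * pi * (\<Sum>j\<in>insert i I. v j * of_int (y j)))" for y :: "'i \<Rightarrow> int"
    have ff': "f z = f' (case z of (n, k) \<Rightarrow> k(i := n))" for z by (simp add: f_eq f'_def split: prod.split)
    have "infsum f' (int_vecs (insert i I)) = infsum f (UNIV \<times> B)"
      unfolding infsum_reindex_bij_betw[OF bij, of f', symmetric] ff'[symmetric] ..
    also have "\<dots> = S1" by (simp add: S1_def)
    also have "\<dots> = of_real (infsum h (UNIV \<times> B))"
      using has_sum_unique[OF h1 has_sum_of_real[OF has_sum_infsum[OF h_sum]]] .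
    also have "infsum h (UNIV \<times> B) = infsum h' (int_vecs (insert i I))"
      unfolding infsum_reindex_bij_betw[OF bij, of h', symmetric] hh'[symmetric] ..
    finally show "infsum f' (int_vecs (insert i I)) = of_real (infsum h' (int_vecs (insert i I)))" .
  qed
qed


section \<open>Theta transformation for unimodular Gram matrices\<close>

definition int_form :: "'i set \<Rightarrow> ('i \<Rightarrow> 'i \<Rightarrow> int) \<Rightarrow> ('i \<Rightarrow> int) \<Rightarrow> ('i \<Rightarrow> int) \<Rightarrow> int" where
  "int_form I G x y = (\<Sum>i\<in>I. \<Sum>j\<in>I. G i j * x i * y j)"

text \<open>Unimodularity appears as solvability of G y = k over the integers: this identifies the
  dual lattice with the lattice, and it can be verified by exhibiting an inverse. Positivity is
  demanded on integer vectors; the real lower bound is derived in \<open>coercive\<close>.\<close>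

locale unimodular_gram =
  fixes I :: "'i set" and G :: "'i \<Rightarrow> 'i \<Rightarrow> int"
  assumes fin: "finite I"
    and sym: "i \<in> I \<Longrightarrow> j \<in> I \<Longrightarrow> G i j = G j i"
    and pos: "y \<in> int_vecs I \<Longrightarrow> y \<noteq> (\<lambda>_. 0) \<Longrightarrow> int_form I G y y > 0"
    and surj: "k \<in> int_vecs I \<Longrightarrow> \<exists>y\<in>int_vecs I. \<forall>i\<in>I. (\<Sum>j\<in>I. G i j * y j) = k i"
begin

abbreviation Q :: "('i \<Rightarrow> real) \<Rightarrow> real" where
  "Q \<equiv> quad_form I (\<lambda>i j. of_int (G i j))"

definition Bl :: "('i \<Rightarrow> real) \<Rightarrow> ('i \<Rightarrow> real) \<Rightarrow> real" where
  "Bl x y = (\<Sum>i\<in>I. \<Sum>j\<in>I. of_int (G i j) * x i * y j)"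

lemma Q_of_int: "Q (\<lambda>i. of_int (y i)) = of_int (int_form I G y y)"
  by (simp add: quad_form_def int_form_def)

lemma Bl_of_int: "Bl (\<lambda>i. of_int (x i)) (\<lambda>i. of_int (y i)) = of_int (int_form I G x y)"
  by (simp add: Bl_def int_form_def)

lemma Bl_commute: "Bl x y = Bl y x"
  unfolding Bl_def by (subst sum.swap) (auto intro!: sum.cong simp: sym)

lemma Bl_self: "Bl x x = Q x" by (simp add: Bl_def quad_form_def)

lemma Bl_eq: "Bl x y = (\<Sum>i\<in>I. (\<Sum>j\<in>I. of_int (G i j) * x j) * y i)"
  unfolding Bl_commute[of x y] unfolding Bl_def sum_distrib_right
  by (intro sum.cong) (auto simp: mult_ac)

lemma Q_add_scaled: "Q (\<lambda>i. y i + s * x i) = Q y + 2 * s * Bl x y + s\<^sup>2 * Q x"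
proof -
  have "Q (\<lambda>i. y i + s * x i) = Bl y y + s * Bl x y + s * Bl y x + s\<^sup>2 * Bl x x"
    unfolding Bl_def quad_form_def sum_distrib_left sum.distrib[symmetric]
    by (intro sum.cong) (auto simp: algebra_simps power2_eq_square)
  thus ?thesis by (simp add: Bl_commute[of y x] Bl_self)
qed

text \<open>A real point is the limit of its roundings down to multiples of 1/N, where homogeneity
  reduces the claim to integer vectors. Only the weak inequality survives the limit.\<close>

lemma Q_nonneg: "Q y \<ge> 0"
proof -
  have nonneg_int: "Q (\<lambda>i. of_int (z i)) \<ge> 0" for z :: "'i \<Rightarrow> int"
  proof -
    define z' where "z' i = (if i \<in> I then z i else 0)" for i
    have "int_form I G z' z' = int_form I G z z" by (simp add: int_form_def z'_def)
    moreover have "int_form I G z' z' \<ge> 0"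
    proof (cases "z' = (\<lambda>_. 0)")
      case True
      thus ?thesis by (simp add: int_form_def)
    next
      case False
      thus ?thesis using pos[of z'] by (simp add: int_vecs_def z'_def)
    qed
    ultimately show ?thesis by (simp add: Q_of_int)
  qed
  have lim: "(\<lambda>N. of_int \<lfloor>real N * x\<rfloor> / real N) \<longlonglongrightarrow> x" for x :: real
  proof (rule tendsto_sandwich[of "\<lambda>N. x - 1 / real N" _ _ "\<lambda>N. x"])
    show "\<forall>\<^sub>F N in sequentially. x - 1 / real N \<le> of_int \<lfloor>real N * x\<rfloor> / real N"
      using eventually_gt_at_top[of 0]
    proof eventually_elim
      case (elim N)
      have "(real N * x - 1) / real N \<le> of_int \<lfloor>real N * x\<rfloor> / real N"
        by (rule divide_right_mono) linarith+
      thus ?case using elim by (simp add: diff_divide_distrib)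
    qed
    show "\<forall>\<^sub>F N in sequentially. of_int \<lfloor>real N * x\<rfloor> / real N \<le> x"
      using eventually_gt_at_top[of 0] by eventually_elim (simp add: field_simps)
    show "(\<lambda>N. x - 1 / real N) \<longlonglongrightarrow> x"
      using tendsto_diff[OF tendsto_const lim_1_over_n, of x] by simp
  qed auto
  have "(\<lambda>N. Q (\<lambda>i. of_int \<lfloor>real N * y i\<rfloor> / real N)) \<longlonglongrightarrow> Q y"
    unfolding quad_form_def by (intro tendsto_intros lim)
  moreover have "Q (\<lambda>i. of_int \<lfloor>real N * y i\<rfloor> / real N) \<ge> 0" for N
  proof -
    have "Q (\<lambda>i. of_int \<lfloor>real N * y i\<rfloor> / real N) = Q (\<lambda>i. of_int \<lfloor>real N * y i\<rfloor>) / (real N)\<^sup>2"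
      unfolding quad_form_def sum_divide_distrib by (intro sum.cong) (auto simp: power2_eq_square)
    thus ?thesis using nonneg_int by simp
  qed
  ultimately show ?thesis by (intro LIMSEQ_le_const) auto
qed

text \<open>Each coordinate is a value \<open>y l = Bl (x l) y\<close> with \<open>x l\<close> in the dual basis, so
  Cauchy-Schwarz bounds it by the form.\<close>
lemma coercive: "\<exists>\<delta>>0. \<forall>y. Q y \<ge> \<delta> * (\<Sum>i\<in>I. (y i)\<^sup>2)"
proof -
  have "\<exists>x. x \<in> int_vecs I \<and> (\<forall>i\<in>I. (\<Sum>j\<in>I. G i j * x j) = (if i = l then 1 else 0))" if "l \<in> I" for l
    using surj[of "\<lambda>i. if i = l then 1 else 0"] that by (auto simp: int_vecs_def)
  then obtain x where x: "\<And>l. l \<in> I \<Longrightarrow> x l \<in> int_vecs I"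
      "\<And>l i. l \<in> I \<Longrightarrow> i \<in> I \<Longrightarrow> (\<Sum>j\<in>I. G i j * x l j) = (if i = l then 1 else 0)" by metis
  define q where "q l = Q (\<lambda>i. of_int (x l i))" for l
  have Bx: "Bl (\<lambda>i. of_int (x l i)) y = y l" if l: "l \<in> I" for l y
  proof -
    have "(\<Sum>j\<in>I. real_of_int (G i j) * of_int (x l j)) = (if i = l then 1 else 0)" if "i \<in> I" for i
      using arg_cong[OF x(2)[OF l that], of real_of_int] by simp
    hence "Bl (\<lambda>i. of_int (x l i)) y = (\<Sum>i\<in>I. if i = l then y i else 0)"
      unfolding Bl_eq by (intro sum.cong) auto
    thus ?thesis using fin l by simp
  qed
  have CS: "(y l)\<^sup>2 \<le> q l * Q y" if l: "l \<in> I" for l y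
  proof -
    have "x l \<noteq> (\<lambda>_. 0)" using x(2)[OF l l] by auto
    hence ql: "q l > 0" using pos[OF x(1)[OF l]] by (simp add: q_def Q_of_int)
    \<comment> \<open>The factor - y l / q l minimizes the form on the line through y in the
      direction of \<open>x l\<close>.\<close>
    have "0 \<le> Q (\<lambda>i. y i + (- y l / q l) * of_int (x l i))" by (rule Q_nonneg)
    also have "\<dots> = Q y + 2 * (- y l / q l) * y l + (- y l / q l)\<^sup>2 * q l"
      unfolding Q_add_scaled Bx[OF l] q_def ..
    also have "\<dots> = Q y - (y l)\<^sup>2 / q l" using ql by (simp add: power2_eq_square field_simps)
    finally show ?thesis using ql by (simp add: field_simps)
  qed
  \<comment> \<open>The summand 1 keeps this positive for an empty index set.\<close>
  define q' where "q' = 1 + (\<Sum>l\<in>I. q l)"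
  have q': "q' > 0" unfolding q'_def q_def by (intro add_pos_nonneg sum_nonneg Q_nonneg) auto
  have "(\<Sum>l\<in>I. (y l)\<^sup>2) \<le> q' * Q y" for y
  proof -
    have "(\<Sum>l\<in>I. (y l)\<^sup>2) \<le> (\<Sum>l\<in>I. q l * Q y)" by (intro sum_mono CS)
    also have "\<dots> \<le> q' * Q y" using Q_nonneg[of y] by (simp add: q'_def sum_distrib_right[symmetric] distrib_right)
    finally show ?thesis .
  qed
  thus ?thesis using q' by (intro exI[of _ "1 / q'"]) (auto simp: field_simps)
qed

lemma summable_on_theta_int:
  assumes "t > 0"
  shows "(\<lambda>y. exp (- pi * t * of_int (int_form I G y y))) summable_on int_vecs I"
proof -
  obtain \<delta> where \<delta>: "\<delta> > 0" "\<And>y. Q y \<ge> \<delta> * (\<Sum>i\<in>I. (y i)\<^sup>2)" using coercive by blast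
  show ?thesis using summable_on_theta[OF fin \<delta> assms] by (simp add: Q_of_int)
qed

text \<open>Multiplication by the Gram matrix, \<open>\<gamma>\<close>, permutes the integer
  vectors, and \<open>Qs\<close> composed with it is the form itself. With the phase z G x the dual
  side of Poisson summation becomes a sum over the same lattice.\<close>

lemma theta_transformation:
  assumes "t > 0" and x: "x \<in> int_vecs I"
  shows "(\<Sum>\<^sub>\<infinity>y\<in>int_vecs I. of_real (exp (- pi * t * of_int (int_form I G y y))) * cis (2 * pi * z * of_int (int_form I G x y)))
    = of_real (\<Sum>\<^sub>\<infinity>y\<in>int_vecs I. (1 / sqrt t) ^ card I *
        exp (- pi * (of_int (int_form I G y y) - 2 * z * of_int (int_form I G x y) + z\<^sup>2 * of_int (int_form I G x x)) / t))"
proof -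
  obtain \<delta> where \<delta>: "\<delta> > 0" "\<And>y. Q y \<ge> \<delta> * (\<Sum>i\<in>I. (y i)\<^sup>2)" using coercive by blast
  have symR: "\<forall>i\<in>I. \<forall>j\<in>I. real_of_int (G i j) = of_int (G j i)" using sym by auto
  obtain C Qs where dual: "poisson_dual I (\<lambda>i j. of_int (G i j)) C Qs"
    using poisson_summation_quad_form[OF fin symR \<delta>] by blast
  note cong = poisson_dualD(2)[OF dual] and Qs = poisson_dualD(3)[OF dual] and P = poisson_dualD(5)[OF dual]
  define \<gamma> where "\<gamma> y i = (if i \<in> I then \<Sum>j\<in>I. G i j * y j else 0)" for y :: "'i \<Rightarrow> int" and i
  have \<gamma>_bij: "bij_betw \<gamma> (int_vecs I) (int_vecs I)"
    unfolding bij_betw_def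
  proof
    show "inj_on \<gamma> (int_vecs I)"
    proof (rule inj_onI)
      fix y y' assume y: "y \<in> int_vecs I" "y' \<in> int_vecs I" and eq: "\<gamma> y = \<gamma> y'"
      define d where "d i = y i - y' i" for i
      have "(\<Sum>j\<in>I. G i j * d j) = 0" if "i \<in> I" for i
        using fun_cong[OF eq, of i] that by (simp add: \<gamma>_def d_def right_diff_distrib sum_subtractf)
      hence "int_form I G d d = (\<Sum>i\<in>I. d i * 0)"
        unfolding int_form_def by (intro sum.cong refl) (simp add: sum_distrib_left[symmetric] mult.assoc mult.left_commute)
      moreover have "d \<in> int_vecs I" using y by (simp add: int_vecs_def d_def)
      ultimately have "d = (\<lambda>_. 0)" using pos[of d] by force
      thus "y = y'" by (auto simp: d_def fun_eq_iff)
    qed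
    show "\<gamma> ` int_vecs I = int_vecs I"
    proof
      show "\<gamma> ` int_vecs I \<subseteq> int_vecs I" by (auto simp: int_vecs_def \<gamma>_def)
      show "int_vecs I \<subseteq> \<gamma> ` int_vecs I"
      proof
        fix k assume k: "k \<in> int_vecs I"
        then obtain y where y: "y \<in> int_vecs I" "\<forall>i\<in>I. (\<Sum>j\<in>I. G i j * y j) = k i" using surj by blast
        have "\<gamma> y = k" using y k by (auto simp: \<gamma>_def int_vecs_def)
        thus "k \<in> \<gamma> ` int_vecs I" using y by blast
      qed
    qed
  qed
  have Qs_shift: "Qs (\<lambda>i. of_int (\<gamma> y i) - z * of_int (\<gamma> x i)) = of_int (int_form I G y y) - 2 * z * of_int (int_form I G x y) + z\<^sup>2 * of_int (int_form I G x x)" for x y z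
  proof -
    have "Qs (\<lambda>i. of_int (\<gamma> y i) - z * of_int (\<gamma> x i)) = Qs (\<lambda>i. \<Sum>j\<in>I. of_int (G i j) * (of_int (y j) + (- z) * of_int (x j)))"
      by (rule cong) (simp add: \<gamma>_def sum_distrib_left sum.distrib[symmetric] sum_subtractf[symmetric] algebra_simps)
    also have "\<dots> = Q (\<lambda>i. of_int (y i) + (- z) * of_int (x i))" by (rule Qs)
    finally show ?thesis unfolding Q_add_scaled by (simp add: Q_of_int Bl_of_int)
  qed
  \<comment> \<open>At t = 1 and z = 0 both sides are the same positive theta value up to the factor
    C, so no determinant has to be computed.\<close>
  have "C = 1"
  proof -
    define T where "T = (\<Sum>\<^sub>\<infinity>y\<in>int_vecs I. exp (- pi * of_int (int_form I G y y)))"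
    have summ: "(\<lambda>y. exp (- pi * of_int (int_form I G y y))) summable_on int_vecs I"
      using summable_on_theta_int[of 1] by simp
    have "of_real T = (\<Sum>\<^sub>\<infinity>y\<in>int_vecs I. of_real (exp (- pi * of_int (int_form I G y y))) :: complex)"
      unfolding T_def by (rule infsumI[symmetric], intro has_sum_of_real has_sum_infsum summ)
    also have "\<dots> = of_real (\<Sum>\<^sub>\<infinity>k\<in>int_vecs I. C * exp (- pi * Qs (\<lambda>i. of_int (k i) - 0 * of_int (\<gamma> (\<lambda>_. 0) i))))"
      using P[of 1 "\<lambda>_. 0"] by (simp add: Q_of_int)
    also have "(\<Sum>\<^sub>\<infinity>k\<in>int_vecs I. C * exp (- pi * Qs (\<lambda>i. of_int (k i) - 0 * of_int (\<gamma> (\<lambda>_. 0) i))))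
       = (\<Sum>\<^sub>\<infinity>y\<in>int_vecs I. C * exp (- pi * Qs (\<lambda>i. of_int (\<gamma> y i) - 0 * of_int (\<gamma> (\<lambda>_. 0) i))))"
      by (rule infsum_reindex_bij_betw[OF \<gamma>_bij, symmetric])
    also have "\<dots> = C * T" unfolding Qs_shift T_def infsum_cmult_right'[symmetric] by simp
    finally have "T = C * T" using of_real_eq_iff by blast
    moreover have "T > 0"
    proof -
      have "exp (- pi * of_int (int_form I G (\<lambda>_. 0) (\<lambda>_. 0))) \<le> T"
        unfolding T_def using finite_sum_le_infsum[OF summ, of "{\<lambda>_. 0}"] by (simp add: int_vecs_def)
      thus ?thesis by (smt (verit) exp_gt_zero)
    qed
    ultimately show ?thesis by simp
  qed
  have lin: "z * of_int (int_form I G x y) = (\<Sum>i\<in>I. (z * of_int (\<gamma> x i)) * of_int (y i))" for y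
    unfolding Bl_of_int[symmetric] Bl_eq sum_distrib_left by (intro sum.cong) (auto simp: \<gamma>_def)
  have "(\<Sum>\<^sub>\<infinity>y\<in>int_vecs I. of_real (exp (- pi * t * of_int (int_form I G y y))) * cis (2 * pi * z * of_int (int_form I G x y)))
    = of_real (\<Sum>\<^sub>\<infinity>k\<in>int_vecs I. (1 / sqrt t) ^ card I * exp (- pi * Qs (\<lambda>i. of_int (k i) - z * of_int (\<gamma> x i)) / t))"
    using P[OF \<open>t > 0\<close>, of "\<lambda>i. z * of_int (\<gamma> x i)"] \<open>C = 1\<close> lin by (simp add: Q_of_int mult.assoc)
  also have "(\<Sum>\<^sub>\<infinity>k\<in>int_vecs I. (1 / sqrt t) ^ card I * exp (- pi * Qs (\<lambda>i. of_int (k i) - z * of_int (\<gamma> x i)) / t))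
    = (\<Sum>\<^sub>\<infinity>y\<in>int_vecs I. (1 / sqrt t) ^ card I * exp (- pi * Qs (\<lambda>i. of_int (\<gamma> y i) - z * of_int (\<gamma> x i)) / t))"
    by (rule infsum_reindex_bij_betw[OF \<gamma>_bij, symmetric])
  finally show ?thesis unfolding Qs_shift .
qed

end


subsection \<open>A modular form vanishing to high order is zero\<close>

text \<open>Write \<open>f = q^M h\<close>. On the disc belonging to \<open>Im \<tau> \<ge> 4/5\<close> the maximum of \<open>\<bar>h\<bar>\<close> is attained at some
  \<open>\<tau>\<close> with \<open>Im \<tau> = 4/5\<close> and \<open>\<bar>Re \<tau>\<bar> \<le> 1/2\<close>. Then \<open>\<bar>\<tau>\<bar> < 1\<close>, so \<open>-1/\<tau>\<close> lies higher, and comparing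
  \<open>f\<close> at both points gives \<open>k \<ge> 16 \<pi> M / 5 > 10 M\<close> unless \<open>h = 0\<close>.\<close>
lemma qseries_eq_zero_of_vanishing:
  fixes c :: "nat \<Rightarrow> complex"
  assumes conv: "\<And>z. norm z < 1 \<Longrightarrow> summable (\<lambda>n. c n * z ^ n)"
    and fe: "\<And>t::real. t > 0 \<Longrightarrow> (\<Sum>n. c n * of_real (exp (- 2 * pi / t)) ^ n)
               = (\<i> * of_real t) ^ k * (\<Sum>n. c n * of_real (exp (- 2 * pi * t)) ^ n)"
    and ord: "\<And>n. n < M \<Longrightarrow> c n = 0" and kM: "k < 10 * M"
  shows "c n = 0"
proof -
  define f where "f z = (\<Sum>n. c n * z ^ n)" for z
  define h where "h z = (\<Sum>n. c (n + M) * z ^ n)" for z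
  have convh: "summable (\<lambda>n. c (n + M) * z ^ n)" if "norm z < 1" for z
  proof (cases "z = 0")
    case False
    have "summable (\<lambda>n. c (n + M) * z ^ (n + M))"
      using summable_ignore_initial_segment[OF conv[OF that], of M] by simp
    hence "summable (\<lambda>n. c (n + M) * z ^ (n + M) * inverse (z ^ M))"
      by (rule summable_mult2)
    moreover have "c (n + M) * z ^ (n + M) * inverse (z ^ M) = c (n + M) * z ^ n" for n
      using False by (simp add: power_add)
    ultimately show ?thesis by simp
  qed auto
  have f_h: "f z = z ^ M * h z" if "norm z < 1" for z
  proof -
    have "f z = (\<Sum>n. c (n + M) * z ^ (n + M)) + (\<Sum>i<M. c i * z ^ i)"
      unfolding f_def by (rule suminf_split_initial_segment[OF conv[OF that]])
    also have "(\<Sum>i<M. c i * z ^ i) = 0" using ord by simp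
    also have "(\<Sum>n. c (n + M) * z ^ (n + M)) = (\<Sum>n. z ^ M * (c (n + M) * z ^ n))"
      by (simp add: power_add mult_ac)
    also have "\<dots> = z ^ M * h z" unfolding h_def
      by (rule suminf_mult[OF convh[OF that]])
    finally show ?thesis by simp
  qed
  have holh: "h holomorphic_on ball 0 1"
    by (rule power_series_holomorphic[where a = "\<lambda>n. c (n + M)"])
       (use convh summable_sums in \<open>auto simp: h_def\<close>)
  have holf: "f holomorphic_on ball 0 1"
    by (rule power_series_holomorphic[where a = c])
       (use conv summable_sums in \<open>auto simp: f_def\<close>)
  define e where "e \<tau> = exp (2 * of_real pi * \<i> * \<tau>)" for \<tau> :: complex
  have norm_e: "norm (e \<tau>) = exp (- 2 * pi * Im \<tau>)" for \<tau>
    by (simp add: e_def norm_exp_eq_Re)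
  define H where "H = {\<tau>. Im \<tau> > 0}"
  have e_H: "norm (e \<tau>) < 1" if "\<tau> \<in> H" for \<tau>
    using that by (simp add: norm_e H_def)
  have inv_H: "- 1 / \<tau> \<in> H" if "\<tau> \<in> H" for \<tau>
    using that unfolding H_def by (auto simp: Im_divide power2_eq_square intro!: divide_pos_pos add_nonneg_pos)
  have "connected H" "open H" unfolding H_def
    by (auto simp: convex_halfspace_Im_gt open_halfspace_Im_gt intro: convex_connected)
  \<comment> \<open>Inversion is assumed on the positive imaginary axis; the identity theorem,
    applied to this difference, extends it to the upper half-plane.\<close>
  define G where "G \<tau> = f (e (- 1 / \<tau>)) - \<tau> ^ k * f (e \<tau>)" for \<tau>
  have hole: "e holomorphic_on A" for A unfolding e_def by (intro holomorphic_intros)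
  have holG: "G holomorphic_on H"
  proof -
    have 1: "(f \<circ> e) holomorphic_on H"
      by (rule holomorphic_on_compose_gen[OF hole holf]) (use e_H in auto)
    have "(\<lambda>\<tau>. - 1 / \<tau>) holomorphic_on H"
      by (intro holomorphic_intros) (auto simp: H_def)
    hence 2: "((f \<circ> e) \<circ> (\<lambda>\<tau>. - 1 / \<tau>)) holomorphic_on H"
      by (rule holomorphic_on_compose_gen[OF _ 1]) (use inv_H in auto)
    show ?thesis using 1 2 unfolding G_def o_def by (intro holomorphic_intros) auto
  qed
  define U where "U = {\<i> * of_real t | t::real. t > 0}"
  have G0: "G \<tau> = 0" if "\<tau> \<in> U" for \<tau>
  proof -
    from that obtain t :: real where t: "\<tau> = \<i> * of_real t" "t > 0" by (auto simp: U_def)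
    have "e \<tau> = of_real (exp (- 2 * pi * t))" unfolding e_def t exp_of_real[symmetric]
      by (rule arg_cong[where f = exp]) (simp add: algebra_simps)
    moreover have "e (- 1 / \<tau>) = of_real (exp (- 2 * pi / t))" unfolding e_def t exp_of_real[symmetric]
      by (rule arg_cong[where f = exp]) (simp add: field_simps)
    ultimately show ?thesis unfolding G_def f_def using fe[OF t(2)] t by simp
  qed
  have islimpt: "\<i> islimpt U" unfolding islimpt_approachable
  proof (intro allI impI)
    fix d :: real assume "d > 0"
    have "\<i> * of_real (1 + d / 2) \<in> U" unfolding U_def using \<open>d > 0\<close> by (intro CollectI exI[of _ "1 + d/2"]) auto
    moreover have "dist (\<i> * of_real (1 + d / 2)) \<i> < d"
    proof -
      have "\<i> * of_real (1 + d / 2) - \<i> = \<i> * of_real (d / 2)" by (simp add: algebra_simps)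
      hence "norm (\<i> * of_real (1 + d / 2) - \<i>) = d / 2" using \<open>d > 0\<close> by (simp only: norm_mult) simp
      thus ?thesis using \<open>d > 0\<close> unfolding dist_norm by linarith
    qed
    moreover have "\<i> * of_real (1 + d / 2) \<noteq> \<i>" using \<open>d > 0\<close> by (auto simp: complex_eq_iff)
    ultimately show "\<exists>x'\<in>U. x' \<noteq> \<i> \<and> dist x' \<i> < d" by blast
  qed
  have Gz: "G \<tau> = 0" if "\<tau> \<in> H" for \<tau>
    by (rule analytic_continuation[OF holG \<open>open H\<close> \<open>connected H\<close> _ _ islimpt G0 that])
       (auto simp: U_def H_def)
  \<comment> \<open>The height 4/5 lies below sqrt 3 / 2, so that 1/4 + 16/25 < 1 places the points
    of this line with real part at most 1/2 in absolute value inside the unit circle.\<close>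
  define \<rho> where "\<rho> = exp (- 2 * pi * (4/5))"
  have \<rho>: "0 < \<rho>" "\<rho> < 1" by (simp_all add: \<rho>_def)
  have conth: "continuous_on (cball 0 \<rho>) h"
    by (rule continuous_on_subset[OF holomorphic_on_imp_continuous_on[OF holh]]) (use \<rho> in auto)
  have "\<exists>q1\<in>sphere 0 \<rho>. \<forall>q\<in>sphere 0 \<rho>. norm (h q) \<le> norm (h q1)"
    by (rule continuous_attains_sup)
       (use \<rho> in \<open>auto intro!: continuous_on_norm continuous_on_subset[OF conth]\<close>)
  then obtain q1 where q1: "norm q1 = \<rho>" and q1max: "\<And>q. norm q = \<rho> \<Longrightarrow> norm (h q) \<le> norm (h q1)"
    by (auto simp: dist_norm)
  define \<mu> where "\<mu> = norm (h q1)"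
  have h_le: "norm (h q) \<le> \<mu>" if "norm q \<le> \<rho>" for q
  proof (rule maximum_modulus_frontier[of h "cball 0 \<rho>"])
    show "h holomorphic_on interior (cball 0 \<rho>)"
      by (rule holomorphic_on_subset[OF holh]) (use \<rho> in auto)
  qed (use conth q1max that \<rho> in \<open>auto simp: \<mu>_def dist_norm\<close>)
  \<comment> \<open>\<open>Arg\<close> takes values in (-pi, pi], so this preimage of
    \<open>q1\<close> has real part at most 1/2 in absolute value.\<close>
  define \<tau> where "\<tau> = Complex (Arg q1 / (2 * pi)) (4/5)"
  have \<tau>H: "\<tau> \<in> H" by (simp add: \<tau>_def H_def)
  have e_\<tau>: "e \<tau> = q1"
  proof -
    have "2 * of_real pi * \<i> * \<tau> = of_real (- 2 * pi * (4/5)) + \<i> * of_real (Arg q1)"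
      by (simp add: \<tau>_def complex_eq_iff)
    hence "e \<tau> = of_real \<rho> * exp (\<i> * of_real (Arg q1))"
      unfolding e_def \<rho>_def exp_of_real[symmetric] by (simp only: exp_add)
    also have "\<dots> = q1"
      using Arg_eq[of q1] q1 \<rho> by auto
    finally show ?thesis .
  qed
  define s where "s = (norm \<tau>)\<^sup>2"
  have "\<bar>Arg q1\<bar> \<le> pi" using Arg_bounded[of q1] by auto
  hence "\<bar>Arg q1 / (2 * pi)\<bar> \<le> 1 / 2" by (simp add: abs_divide)
  hence "\<bar>Arg q1 / (2 * pi)\<bar>\<^sup>2 \<le> (1/2)\<^sup>2" by (rule power_mono) simp
  hence "(Arg q1 / (2 * pi))\<^sup>2 \<le> 1/4" unfolding power2_abs by (simp only: power_divide) simp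
  moreover have "s = (Arg q1 / (2 * pi))\<^sup>2 + 16 / 25"
    unfolding s_def \<tau>_def cmod_power2 complex.sel by (simp only: power_divide) simp
  ultimately have s: "s < 1" "s > 0" using zero_le_power2[of "Arg q1 / (2 * pi)"] by linarith+
  have Im': "Im (- 1 / \<tau>) = (4/5) / s"
    unfolding Im_divide s_def cmod_power2 by (simp add: \<tau>_def)
  have ne': "norm (e (- 1 / \<tau>)) = exp (- 2 * pi * ((4/5) / s))" using Im' norm_e by simp
  have "\<mu> = 0"
  proof (rule ccontr)
    assume "\<mu> \<noteq> 0"
    hence \<mu>: "\<mu> > 0" by (simp add: \<mu>_def)
    have "norm (e (- 1 / \<tau>)) \<le> \<rho>" unfolding ne' \<rho>_def using s by (simp add: field_simps)
    hence hle: "norm (h (e (- 1 / \<tau>))) \<le> \<mu>" by (rule h_le)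
    have "f (e (- 1 / \<tau>)) = \<tau> ^ k * f (e \<tau>)" using Gz[OF \<tau>H] by (simp add: G_def)
    hence "norm (e (- 1 / \<tau>)) ^ M * norm (h (e (- 1 / \<tau>))) = norm \<tau> ^ k * (\<rho> ^ M * \<mu>)"
      using f_h[OF e_H[OF \<tau>H]] f_h[OF e_H[OF inv_H[OF \<tau>H]]]
      by (metis \<mu>_def e_\<tau> norm_mult norm_power q1)
    moreover have "norm (e (- 1 / \<tau>)) ^ M * norm (h (e (- 1 / \<tau>))) \<le> norm (e (- 1 / \<tau>)) ^ M * \<mu>"
      using hle by (intro mult_left_mono) auto
    ultimately have "norm \<tau> ^ k * \<rho> ^ M \<le> norm (e (- 1 / \<tau>)) ^ M" using \<mu> by simp
    hence le0: "norm \<tau> ^ k * \<rho> ^ M \<le> exp (- 2 * pi * ((4/5) / s)) ^ M" unfolding ne' .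
    have \<tau>0: "norm \<tau> > 0" using s by (simp add: s_def)
    have "ln (norm \<tau> ^ k * \<rho> ^ M) \<le> ln (exp (- 2 * pi * ((4/5) / s)) ^ M)"
      using le0 \<rho> \<tau>0 by (subst ln_le_cancel_iff) auto
    also have "ln (exp (- 2 * pi * ((4/5) / s)) ^ M) = M * (- 2 * pi * ((4/5) / s))"
      by (simp add: ln_realpow)
    also have "ln (norm \<tau> ^ k * \<rho> ^ M) = k * ln (norm \<tau>) + M * (- 2 * pi * (4/5))"
      using \<rho> \<tau>0 by (simp add: ln_mult ln_realpow) (simp add: \<rho>_def)
    finally have le: "k * ln (norm \<tau>) + M * (- 2 * pi * (4/5)) \<le> M * (- 2 * pi * ((4/5) / s))" .
    have ln_s: "ln s = 2 * ln (norm \<tau>)" using s by (simp add: s_def ln_realpow)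
    \<comment> \<open>As s < 1, the number 1 - 1/s is negative; cancelling it reverses the estimate
      into a lower bound for k that no longer involves s.\<close>
    have "1 - 1 / s \<le> ln s" using ln_le_minus_one[of "1 / s"] s by (simp add: ln_div)
    hence "k / 2 * (1 - 1 / s) \<le> k / 2 * ln s" by (intro mult_left_mono) auto
    also have "\<dots> \<le> M * (8 / 5 * pi) * (1 - 1 / s)" using le ln_s by (simp add: algebra_simps)
    finally have "k / 2 \<ge> M * (8 / 5 * pi)"
      using s by (simp add: mult_le_cancel_right)
    \<comment> \<open>16/5 * 3.13 = 10.016, so this precision just reaches the constant 10.\<close>
    moreover have "pi > 3.13" using pi_approx by simp
    moreover have "real M > 0" using kM by (cases M) auto
    ultimately have "real M * 3.13 < real M * pi" "M * (8 / 5 * pi) \<le> k / 2"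
      by (auto intro: mult_strict_left_mono)
    hence "real k \<ge> real M * 10" by simp
    thus False using kM by linarith
  qed
  have h0: "h q = 0" if "q \<in> ball 0 \<rho>" for q using h_le[of q] that \<open>\<mu> = 0\<close> by (auto simp: dist_norm)
  have cM: "c (n + M) = 0" for n
  proof (cases "n = 0")
    case True
    have "h 0 = c M" unfolding h_def using powser_sums_zero[of "\<lambda>n. c (n + M)"] sums_unique by force
    thus ?thesis using h0[of 0] \<rho> True by simp
  next
    case False
    show ?thesis
    proof (rule ccontr)
      \<comment> \<open>A nonzero coefficient would make 0 an isolated zero of h, whereas h vanishes
        on a whole disc.\<close>
      assume nz: "c (n + M) \<noteq> 0"
      have sm: "(\<lambda>n. c (n + M) * (x - 0) ^ n) sums h x" if "norm (x - 0) < 1" for x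
        using that convh[of x] unfolding h_def by (auto intro: summable_sums)
      have "h 0 = 0" using h0[of 0] \<rho> by simp
      then obtain r where r: "r > 0" "\<And>z. z \<in> cball 0 r - {0} \<Longrightarrow> h z \<noteq> 0"
        using powser_0_nonzero[OF zero_less_one sm _ nz] False by blast
      define z where "z = (of_real (min r (\<rho> / 2)) :: complex)"
      have "norm z = min r (\<rho> / 2)" using r \<rho> by (simp add: z_def)
      thus False using r(2)[of z] h0[of z] r(1) \<rho> by (auto simp: dist_norm min_def split: if_splits)
    qed
  qed
  show ?thesis using ord[of n] cM[of "n - M"] by (cases "n < M") auto
qed


subsection \<open>Theta functions with a lattice parameter\<close>

lemma has_sum_finite_sum:
  fixes f :: "'x \<Rightarrow> 'y \<Rightarrow> 'c::topological_comm_monoid_add"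
  assumes "finite X" "\<And>x. x \<in> X \<Longrightarrow> (f x has_sum S x) B"
  shows "((\<lambda>y. \<Sum>x\<in>X. f x y) has_sum (\<Sum>x\<in>X. S x)) B"
  using assms by induction (auto intro!: has_sum_add)

lemma exp_has_sum:
  fixes x :: "'c::{banach,real_normed_field}"
  shows "((\<lambda>j. x ^ j /\<^sub>R fact j) has_sum exp x) UNIV"
  by (rule norm_summable_imp_has_sum[OF summable_norm_exp exp_converges])

text \<open>If the series is not summable, both sums take the default value 0.\<close>

lemma infsum_of_real_complex:
  fixes f :: "'b \<Rightarrow> real"
  shows "(\<Sum>\<^sub>\<infinity>y\<in>B. complex_of_real (f y)) = of_real (\<Sum>\<^sub>\<infinity>y\<in>B. f y)"
proof (cases "f summable_on B")
  case True
  thus ?thesis by (intro infsumI has_sum_of_real) simp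
next
  case False
  moreover from this have "\<not> (\<lambda>y. complex_of_real (f y)) summable_on B"
    using summable_on_Re[of "\<lambda>y. complex_of_real (f y)" B] by auto
  ultimately show ?thesis by (simp add: infsum_not_exists)
qed

text \<open>Common interface for the lattice of a Gram matrix and for the reference lattice. Rank 24
  enters only as the exponent 12 of 1/t, and unimodularity only in that the same lattice stands on
  both sides of \<open>theta_transform\<close>.\<close>

locale leech_type_lattice =
  fixes A :: "'a::ab_group_add set" and \<beta> :: "'a \<Rightarrow> 'a \<Rightarrow> int"
  assumes add_closed: "x \<in> A \<Longrightarrow> y \<in> A \<Longrightarrow> x + y \<in> A"
    and minus_closed: "x \<in> A \<Longrightarrow> - x \<in> A"
    and zero_closed: "0 \<in> A"
    and \<beta>_add: "x \<in> A \<Longrightarrow> y \<in> A \<Longrightarrow> z \<in> A \<Longrightarrow> \<beta> (x + y) z = \<beta> x z + \<beta> y z"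
    and \<beta>_sym: "x \<in> A \<Longrightarrow> y \<in> A \<Longrightarrow> \<beta> x y = \<beta> y x"
    and \<beta>_even: "x \<in> A \<Longrightarrow> even (\<beta> x x)"
    and \<beta>_pos: "x \<in> A \<Longrightarrow> x \<noteq> 0 \<Longrightarrow> \<beta> x x > 0"
    and \<beta>_not_2: "x \<in> A \<Longrightarrow> \<beta> x x \<noteq> 2"
    and summable_theta: "t > 0 \<Longrightarrow> (\<lambda>y. exp (- pi * t * of_int (\<beta> y y))) summable_on A"
    and theta_transform: "t > 0 \<Longrightarrow> x \<in> A \<Longrightarrow>
      (\<Sum>\<^sub>\<infinity>y\<in>A. complex_of_real (exp (- pi * t * of_int (\<beta> y y))) * cis (2 * pi * s * of_int (\<beta> x y)))
      = of_real (\<Sum>\<^sub>\<infinity>y\<in>A. (1 / t) ^ 12 *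
          exp (- pi * (of_int (\<beta> y y) - 2 * s * of_int (\<beta> x y) + s\<^sup>2 * of_int (\<beta> x x)) / t))"
begin

lemma \<beta>_zero_left: "z \<in> A \<Longrightarrow> \<beta> 0 z = 0"
  using \<beta>_add[of 0 0 z] zero_closed by simp

lemma \<beta>_minus: "x \<in> A \<Longrightarrow> z \<in> A \<Longrightarrow> \<beta> (- x) z = - \<beta> x z"
  using \<beta>_add[of x "- x" z] minus_closed \<beta>_zero_left by simp

lemma \<beta>_nonneg: "x \<in> A \<Longrightarrow> \<beta> x x \<ge> 0"
  using \<beta>_pos[of x] \<beta>_zero_left[of 0] zero_closed by (cases "x = 0") force+

lemma \<beta>_add_self: "x \<in> A \<Longrightarrow> y \<in> A \<Longrightarrow> \<beta> (x + y) (x + y) = \<beta> x x + 2 * \<beta> x y + \<beta> y y"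
  using \<beta>_add[of x y "x + y"] \<beta>_add[of x y x] \<beta>_add[of x y y] add_closed[of x y]
    \<beta>_sym[of x "x + y"] \<beta>_sym[of y "x + y"] \<beta>_sym[of x y] by simp

lemma \<beta>_minus_self: "x \<in> A \<Longrightarrow> \<beta> (- x) (- x) = \<beta> x x"
  using \<beta>_minus[of x "- x"] \<beta>_minus[of x x] \<beta>_sym[of x "- x"] minus_closed by simp

text \<open>Both x + y and -x + y have nonnegative norm. The bound controls the linear exponent in
  the theta functions and the range of inner products between two shells.\<close>

lemma abs_\<beta>_le:
  assumes "x \<in> A" "y \<in> A" shows "2 * \<bar>\<beta> x y\<bar> \<le> \<beta> x x + \<beta> y y"
proof -
  have "- x + y \<in> A" "x + y \<in> A" using assms by (auto intro: add_closed minus_closed simp del: uminus_add_conv_diff)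
  from this[THEN \<beta>_nonneg] show ?thesis
    using \<beta>_add_self[of x y] \<beta>_add_self[of "- x" y] \<beta>_minus[of x y] \<beta>_minus_self[of x] minus_closed[of x] assms
    by (simp add: abs_if)
qed

text \<open>The index is half the norm, that is, the exponent of q.\<close>

definition shell :: "nat \<Rightarrow> 'a set" where
  "shell m = {x \<in> A. \<beta> x x = 2 * int m}"

lemma shell_subset: "x \<in> shell m \<Longrightarrow> x \<in> A" by (simp add: shell_def)

text \<open>The terms of the convergent theta series are constant and positive on a shell.\<close>

lemma finite_shell: "finite (shell m)"
proof (rule ccontr)
  assume "infinite (shell m)"
  have "(\<lambda>y. exp (- pi * 1 * of_int (\<beta> y y))) summable_on shell m"
    by (rule summable_on_subset[OF summable_theta]) (auto simp: shell_def)
  hence "(\<lambda>y. exp (- pi * 1 * (2 * real m))) summable_on shell m"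
    by (rule summable_on_cong[THEN iffD1, rotated]) (simp add: shell_def)
  thus False using infsum_diverge_constant[OF \<open>infinite (shell m)\<close>, of "exp (- pi * 1 * (2 * real m))"] by simp
qed

lemma shell_0: "shell 0 = {0}"
  using \<beta>_zero_left[OF zero_closed] zero_closed \<beta>_pos by (force simp: shell_def)

lemma shell_1: "shell 1 = {}"
  using \<beta>_not_2 by (auto simp: shell_def)

lemma has_sum_shells:
  fixes f :: "'a \<Rightarrow> 'c::{topological_comm_monoid_add,t3_space}"
  assumes "(f has_sum S) A"
  shows "((\<lambda>n. \<Sum>y\<in>shell n. f y) has_sum S) (UNIV :: nat set)"
proof -
  have "bij_betw snd (Sigma UNIV shell) A"
  proof (rule bij_betwI[where g = "\<lambda>y. (nat (\<beta> y y div 2), y)"])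
    show "(\<lambda>y. (nat (\<beta> y y div 2), y)) \<in> A \<rightarrow> Sigma UNIV shell"
      using \<beta>_nonneg \<beta>_even by (auto simp: shell_def)
  qed (auto simp: shell_def)
  from has_sum_reindex_bij_betw[OF this, of f S] assms
  have "((\<lambda>z. f (snd z)) has_sum S) (Sigma UNIV shell)" by simp
  thus ?thesis
    by (rule has_sum_SigmaD[where f = "\<lambda>z. f (snd z)"]) (auto intro!: has_sum_finiteI finite_shell)
qed

text \<open>This is the coefficient of q^n in \<open>theta_moment m j\<close>, which in turn is j!
  times the coefficient of w^j in \<open>theta_fun m\<close>.\<close>

definition moment :: "nat \<Rightarrow> nat \<Rightarrow> nat \<Rightarrow> real" where
  "moment m n j = (\<Sum>x\<in>shell m. \<Sum>y\<in>shell n. of_int (\<beta> x y) ^ j)"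

definition theta_moment :: "nat \<Rightarrow> nat \<Rightarrow> real \<Rightarrow> real" where
  "theta_moment m j t = (\<Sum>x\<in>shell m. \<Sum>\<^sub>\<infinity>y\<in>A. exp (- pi * t * of_int (\<beta> y y)) * of_int (\<beta> x y) ^ j)"

text \<open>The value at \<tau> = i t of the m-th Fourier-Jacobi coefficient of the degree 2 theta
  series, with w standing for 2 pi i z. A complex w is taken because inversion exchanges imaginary
  and real w.\<close>

definition theta_fun :: "nat \<Rightarrow> real \<Rightarrow> complex \<Rightarrow> complex" where
  "theta_fun m t w = (\<Sum>x\<in>shell m. \<Sum>\<^sub>\<infinity>y\<in>A. of_real (exp (- pi * t * of_int (\<beta> y y))) * exp (w * of_int (\<beta> x y)))"

text \<open>By \<open>abs_\<beta>_le\<close> the linear exponent is at most norm w times half of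
  \<open>\<beta> x x + \<beta> y y\<close>, and norm w <= pi * t keeps the part with y within half
  of the Gaussian exponent. Taylor coefficients at w = 0 require no larger disc.\<close>

lemma theta_family_summable:
  fixes w :: complex
  assumes t: "t > 0" and x: "x \<in> A" and w: "norm w \<le> pi * t"
  shows "(\<lambda>(y, j::nat). of_real (exp (- pi * t * of_int (\<beta> y y))) * ((w * of_int (\<beta> x y)) ^ j /\<^sub>R fact j)) summable_on A \<times> UNIV"
proof -
  have "(\<lambda>(y, j::nat). exp (- pi * t * of_int (\<beta> y y)) * ((norm w * \<bar>of_int (\<beta> x y)\<bar>) ^ j /\<^sub>R fact j)) summable_on A \<times> UNIV"
  proof (rule summable_on_SigmaI[where g = "\<lambda>y. exp (- pi * t * of_int (\<beta> y y)) * exp (norm w * \<bar>of_int (\<beta> x y)\<bar>)"])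
    fix y
    have "((\<lambda>j. (norm w * \<bar>of_int (\<beta> x y)\<bar>) ^ j /\<^sub>R fact j) has_sum exp (norm w * \<bar>of_int (\<beta> x y)\<bar>)) UNIV"
      by (rule exp_has_sum)
    thus "((\<lambda>j. case (y, j) of (y, j) \<Rightarrow> exp (- pi * t * of_int (\<beta> y y)) * ((norm w * \<bar>of_int (\<beta> x y)\<bar>) ^ j /\<^sub>R fact j)) has_sum
       exp (- pi * t * of_int (\<beta> y y)) * exp (norm w * \<bar>of_int (\<beta> x y)\<bar>)) UNIV"
      using has_sum_cmult_right by force
  next
    have "(\<lambda>y. exp (norm w * of_int (\<beta> x x) / 2) * exp (- pi * (t / 2) * of_int (\<beta> y y))) summable_on A"
      using t by (intro summable_on_cmult_right summable_theta) auto
    thus "(\<lambda>y. exp (- pi * t * of_int (\<beta> y y)) * exp (norm w * \<bar>of_int (\<beta> x y)\<bar>)) summable_on A"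
    proof (rule summable_on_comparison_test)
      fix y assume y: "y \<in> A"
      have "2 * \<bar>real_of_int (\<beta> x y)\<bar> \<le> of_int (\<beta> x x) + of_int (\<beta> y y)"
      proof -
        have "real_of_int (2 * \<bar>\<beta> x y\<bar>) \<le> real_of_int (\<beta> x x + \<beta> y y)"
          using abs_\<beta>_le[OF x y] by (simp only: of_int_le_iff)
        thus ?thesis by simp
      qed
      hence "norm w * (2 * \<bar>real_of_int (\<beta> x y)\<bar>) \<le> norm w * (of_int (\<beta> x x) + of_int (\<beta> y y))"
        by (intro mult_left_mono) auto
      moreover have "norm w * of_int (\<beta> y y) \<le> pi * t * of_int (\<beta> y y)"
        using w \<beta>_nonneg[OF y] by (intro mult_right_mono) auto
      ultimately have "- pi * t * of_int (\<beta> y y) + norm w * \<bar>of_int (\<beta> x y)\<bar> \<le> norm w * of_int (\<beta> x x) / 2 + - pi * (t / 2) * of_int (\<beta> y y)"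
        by (simp add: field_simps)
      thus "exp (- pi * t * of_int (\<beta> y y)) * exp (norm w * \<bar>of_int (\<beta> x y)\<bar>) \<le> exp (norm w * of_int (\<beta> x x) / 2) * exp (- pi * (t / 2) * of_int (\<beta> y y))"
        unfolding exp_add[symmetric] by simp
    qed auto
  qed auto
  hence "(\<lambda>z. norm ((\<lambda>(y, j::nat). of_real (exp (- pi * t * of_int (\<beta> y y))) * ((w * of_int (\<beta> x y)) ^ j /\<^sub>R fact j)) z)) summable_on A \<times> UNIV"
    by (simp add: case_prod_unfold norm_mult norm_power power_mult_distrib mult_ac)
  thus ?thesis by (rule abs_summable_summable)
qed

lemma summable_theta_moment:
  assumes t: "t > 0" and x: "x \<in> A"
  shows "(\<lambda>y. exp (- pi * t * of_int (\<beta> y y)) * of_int (\<beta> x y) ^ j) summable_on A"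
proof -
  \<comment> \<open>Fixing j in the double family at a nonzero w leaves the wanted terms times the
    constant w^j / j!.\<close>
  define w where "w = complex_of_real (pi * t)"
  have "norm w \<le> pi * t" using t by (simp add: w_def norm_mult)
  from theta_family_summable[OF t x this]
  have "(\<lambda>(j::nat, y). of_real (exp (- pi * t * of_int (\<beta> y y))) * ((w * of_int (\<beta> x y)) ^ j /\<^sub>R fact j)) summable_on UNIV \<times> A"
    by (subst summable_on_swap) (simp add: case_prod_unfold)
  hence "(\<lambda>y. of_real (exp (- pi * t * of_int (\<beta> y y))) * ((w * of_int (\<beta> x y)) ^ j /\<^sub>R fact j)) summable_on A"
    by (rule summable_on_SigmaD1) simp
  hence "(\<lambda>y. (fact j / w ^ j) * (of_real (exp (- pi * t * of_int (\<beta> y y))) * ((w * of_int (\<beta> x y)) ^ j /\<^sub>R fact j))) summable_on A"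
    by (rule summable_on_cmult_right)
  moreover have "(fact j / w ^ j) * (of_real (exp (- pi * t * of_int (\<beta> y y))) * ((w * of_int (\<beta> x y)) ^ j /\<^sub>R fact j))
     = of_real (exp (- pi * t * of_int (\<beta> y y)) * of_int (\<beta> x y) ^ j)" for y
    using t by (simp add: w_def scaleR_conv_of_real power_mult_distrib divide_simps)
  ultimately have "(\<lambda>y. complex_of_real (exp (- pi * t * of_int (\<beta> y y)) * of_int (\<beta> x y) ^ j)) summable_on A" by simp
  from summable_on_Re[OF this] show ?thesis by simp
qed

lemma has_sum_theta_moment:
  assumes t: "t > 0"
  shows "((\<lambda>n. moment m n j * exp (- 2 * pi * t) ^ n) has_sum theta_moment m j t) UNIV"
proof -
  have "((\<lambda>n. \<Sum>x\<in>shell m. \<Sum>y\<in>shell n. exp (- pi * t * of_int (\<beta> y y)) * of_int (\<beta> x y) ^ j) has_sum theta_moment m j t) (UNIV :: nat set)"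
    unfolding theta_moment_def
    by (intro has_sum_finite_sum finite_shell has_sum_shells has_sum_infsum summable_theta_moment[OF t] shell_subset)
  moreover have "(\<Sum>x\<in>shell m. \<Sum>y\<in>shell n. exp (- pi * t * of_int (\<beta> y y)) * of_int (\<beta> x y) ^ j) = moment m n j * exp (- 2 * pi * t) ^ n" for n
  proof -
    have "exp (- pi * t * of_int (\<beta> y y)) = exp (- 2 * pi * t) ^ n" if "y \<in> shell n" for y
      using that by (simp add: shell_def exp_of_nat_mult[symmetric] mult_ac)
    thus ?thesis unfolding moment_def sum_distrib_right by (intro sum.cong refl) (simp add: mult.commute)
  qed
  ultimately show ?thesis by simp
qed

lemma theta_fun_has_sum:
  assumes t: "t > 0" and w: "norm w \<le> pi * t"
  shows "((\<lambda>j. of_real (theta_moment m j t / fact j) * w ^ j) has_sum theta_fun m t w) UNIV"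
proof -
  have "((\<lambda>j. of_real ((\<Sum>\<^sub>\<infinity>y\<in>A. exp (- pi * t * of_int (\<beta> y y)) * of_int (\<beta> x y) ^ j) / fact j) * w ^ j) has_sum
      (\<Sum>\<^sub>\<infinity>y\<in>A. of_real (exp (- pi * t * of_int (\<beta> y y))) * exp (w * of_int (\<beta> x y)))) UNIV" if x: "x \<in> A" for x
  proof -
    define F where "F = (\<lambda>(y, j::nat). of_real (exp (- pi * t * of_int (\<beta> y y))) * ((w * of_int (\<beta> x y)) ^ j /\<^sub>R fact j))"
    obtain S where S: "(F has_sum S) (A \<times> UNIV)"
      using theta_family_summable[OF t x w] unfolding F_def[symmetric] summable_on_def by blast
    have "((\<lambda>y. of_real (exp (- pi * t * of_int (\<beta> y y))) * exp (w * of_int (\<beta> x y))) has_sum S) A"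
    proof (rule has_sum_SigmaD[OF S])
      fix y
      have "((\<lambda>j. (w * of_int (\<beta> x y)) ^ j /\<^sub>R fact j) has_sum exp (w * of_int (\<beta> x y))) UNIV"
        by (rule exp_has_sum)
      thus "((\<lambda>j. F (y, j)) has_sum of_real (exp (- pi * t * of_int (\<beta> y y))) * exp (w * of_int (\<beta> x y))) UNIV"
        unfolding F_def prod.case by (rule has_sum_cmult_right)
    qed
    hence S_eq: "S = (\<Sum>\<^sub>\<infinity>y\<in>A. of_real (exp (- pi * t * of_int (\<beta> y y))) * exp (w * of_int (\<beta> x y)))"
      by (rule infsumI[symmetric])
    have S': "((\<lambda>(j, y). F (y, j)) has_sum S) (UNIV \<times> A)"
      using S by (subst (asm) has_sum_swap)
    show ?thesis unfolding S_eq[symmetric]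
    proof (rule has_sum_SigmaD[OF S'])
      fix j :: nat
      have "((\<lambda>y. (w ^ j / fact j) * of_real (exp (- pi * t * of_int (\<beta> y y)) * of_int (\<beta> x y) ^ j)) has_sum
         (w ^ j / fact j) * of_real (\<Sum>\<^sub>\<infinity>y\<in>A. exp (- pi * t * of_int (\<beta> y y)) * of_int (\<beta> x y) ^ j)) A"
        by (intro has_sum_cmult_right has_sum_of_real has_sum_infsum summable_theta_moment t x)
      thus "((\<lambda>y. case (j, y) of (j, y) \<Rightarrow> F (y, j)) has_sum
         of_real ((\<Sum>\<^sub>\<infinity>y\<in>A. exp (- pi * t * of_int (\<beta> y y)) * of_int (\<beta> x y) ^ j) / fact j) * w ^ j) A"
        by (simp add: F_def scaleR_conv_of_real power_mult_distrib field_simps)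
    qed
  qed
  hence "((\<lambda>j. \<Sum>x\<in>shell m. of_real ((\<Sum>\<^sub>\<infinity>y\<in>A. exp (- pi * t * of_int (\<beta> y y)) * of_int (\<beta> x y) ^ j) / fact j) * w ^ j) has_sum theta_fun m t w) UNIV"
    unfolding theta_fun_def by (intro has_sum_finite_sum finite_shell) (auto simp: shell_def)
  thus ?thesis by (simp add: theta_moment_def sum_divide_distrib sum_distrib_right)
qed

text \<open>The exponential with m z^2 is the automorphy factor of index m; it comes from \<beta> x
  x = 2m in the shifted norm. The imaginary argument on the left becomes a real one on the
  right.\<close>

lemma theta_fun_transform:
  assumes t: "t > 0"
  shows "theta_fun m t (2 * pi * \<i> * of_real z) = of_real ((1 / t) ^ 12 * exp (- 2 * pi * m * z\<^sup>2 / t)) * theta_fun m (1 / t) (of_real (2 * pi * z / t))"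
  unfolding theta_fun_def sum_distrib_left
proof (intro sum.cong refl)
  fix x assume x: "x \<in> shell m"
  have "(\<Sum>\<^sub>\<infinity>y\<in>A. of_real (exp (- pi * t * of_int (\<beta> y y))) * exp (2 * pi * \<i> * of_real z * of_int (\<beta> x y)))
     = (\<Sum>\<^sub>\<infinity>y\<in>A. of_real (exp (- pi * t * of_int (\<beta> y y))) * cis (2 * pi * z * of_int (\<beta> x y)))"
    by (intro infsum_cong) (simp add: cis_conv_exp mult_ac)
  also have "\<dots> = of_real (\<Sum>\<^sub>\<infinity>y\<in>A. (1 / t) ^ 12 *
          exp (- pi * (of_int (\<beta> y y) - 2 * z * of_int (\<beta> x y) + z\<^sup>2 * of_int (\<beta> x x)) / t))"
    by (rule theta_transform[OF t shell_subset[OF x]])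
  also have "(\<Sum>\<^sub>\<infinity>y\<in>A. (1 / t) ^ 12 *
          exp (- pi * (of_int (\<beta> y y) - 2 * z * of_int (\<beta> x y) + z\<^sup>2 * of_int (\<beta> x x)) / t))
      = (\<Sum>\<^sub>\<infinity>y\<in>A. ((1 / t) ^ 12 * exp (- 2 * pi * m * z\<^sup>2 / t)) * (exp (- pi * (1 / t) * of_int (\<beta> y y)) * exp (2 * pi * z / t * of_int (\<beta> x y))))"
  proof (intro infsum_cong)
    fix y
    have "\<beta> x x = 2 * int m" using x by (simp add: shell_def)
    hence "- pi * (of_int (\<beta> y y) - 2 * z * of_int (\<beta> x y) + z\<^sup>2 * of_int (\<beta> x x)) / t
      = - 2 * pi * m * z\<^sup>2 / t + (- pi * (1 / t) * of_int (\<beta> y y) + 2 * pi * z / t * of_int (\<beta> x y))"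
      using t by (simp add: field_simps)
    thus "(1 / t) ^ 12 * exp (- pi * (of_int (\<beta> y y) - 2 * z * of_int (\<beta> x y) + z\<^sup>2 * of_int (\<beta> x x)) / t)
      = ((1 / t) ^ 12 * exp (- 2 * pi * m * z\<^sup>2 / t)) * (exp (- pi * (1 / t) * of_int (\<beta> y y)) * exp (2 * pi * z / t * of_int (\<beta> x y)))"
      by (simp only: exp_add mult.assoc)
  qed
  also have "\<dots> = ((1 / t) ^ 12 * exp (- 2 * pi * m * z\<^sup>2 / t)) * (\<Sum>\<^sub>\<infinity>y\<in>A. exp (- pi * (1 / t) * of_int (\<beta> y y)) * exp (2 * pi * z / t * of_int (\<beta> x y)))"
    by (rule infsum_cmult_right')
  also have "complex_of_real \<dots> = of_real ((1 / t) ^ 12 * exp (- 2 * pi * m * z\<^sup>2 / t)) * (\<Sum>\<^sub>\<infinity>y\<in>A. of_real (exp (- pi * (1 / t) * of_int (\<beta> y y))) * exp (of_real (2 * pi * z / t) * of_int (\<beta> x y)))"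
  proof -
    have "exp (of_real (2 * pi * z / t) * of_int (\<beta> x y)) = complex_of_real (exp (2 * pi * z / t * of_int (\<beta> x y)))" for y
      by (simp only: exp_of_real[symmetric] of_real_mult of_real_of_int_eq)
    thus ?thesis by (simp only: of_real_mult[symmetric] infsum_of_real_complex)
  qed
  finally show "(\<Sum>\<^sub>\<infinity>y\<in>A. of_real (exp (- pi * t * of_int (\<beta> y y))) * exp (2 * pi * \<i> * of_real z * of_int (\<beta> x y)))
    = of_real ((1 / t) ^ 12 * exp (- 2 * pi * m * z\<^sup>2 / t)) * (\<Sum>\<^sub>\<infinity>y\<in>A. of_real (exp (- pi * (1 / t) * of_int (\<beta> y y))) * exp (of_real (2 * pi * z / t) * of_int (\<beta> x y)))" .
qed

end


section \<open>Pair counts and their symmetries\<close>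

context leech_type_lattice
begin

definition pair_count :: "nat \<Rightarrow> int \<Rightarrow> nat \<Rightarrow> nat" where
  "pair_count m r n = card {(x, y). x \<in> shell m \<and> y \<in> shell n \<and> \<beta> x y = r}"

lemma finite_pairs: "finite {(x, y). x \<in> shell m \<and> y \<in> shell n \<and> \<beta> x y = r}"
  by (rule finite_subset[of _ "shell m \<times> shell n"]) (auto intro: finite_shell)

lemma pair_count_commute: "pair_count m r n = pair_count n r m"
  unfolding pair_count_def
  by (rule bij_betw_same_card[where f = prod.swap], rule bij_betwI[where g = prod.swap])
     (auto simp: shell_def \<beta>_sym)

lemma \<beta>_add_right: "x \<in> A \<Longrightarrow> y \<in> A \<Longrightarrow> z \<in> A \<Longrightarrow> \<beta> z (x + y) = \<beta> z x + \<beta> z y"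
  using \<beta>_add[of x y z] add_closed[of x y] \<beta>_sym[of z] by simp

lemma \<beta>_minus_right: "x \<in> A \<Longrightarrow> z \<in> A \<Longrightarrow> \<beta> z (- x) = - \<beta> z x"
  using \<beta>_minus[of x z] minus_closed[of x] \<beta>_sym[of z] by simp

lemma diff_closed: "x \<in> A \<Longrightarrow> y \<in> A \<Longrightarrow> y - x \<in> A"
  using add_closed[of y "- x"] minus_closed[of x] by simp

lemma \<beta>_diff_right: "x \<in> A \<Longrightarrow> y \<in> A \<Longrightarrow> z \<in> A \<Longrightarrow> \<beta> z (y - x) = \<beta> z y - \<beta> z x"
  using \<beta>_add_right[of y "- x" z] \<beta>_minus_right[of x z] minus_closed[of x] by simp

lemma \<beta>_diff_self: "x \<in> A \<Longrightarrow> y \<in> A \<Longrightarrow> \<beta> (y - x) (y - x) = \<beta> x x - 2 * \<beta> x y + \<beta> y y"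
  using \<beta>_add_self[of "- x" y] \<beta>_minus_self[of x] \<beta>_minus[of x y] minus_closed[of x] by simp

lemma shell_uminus: "x \<in> shell m \<Longrightarrow> - x \<in> shell m"
  by (simp add: shell_def minus_closed \<beta>_minus_self)

lemma pair_count_uminus: "pair_count m (- r) n = pair_count m r n"
  unfolding pair_count_def
proof (rule bij_betw_same_card[where f = "\<lambda>(x, y). (- x, y)"], rule bij_betwI[where g = "\<lambda>(x, y). (- x, y)"])
  have "(\<lambda>(x, y). (- x, y)) \<in> {(x, y). x \<in> shell m \<and> y \<in> shell n \<and> \<beta> x y = r} \<rightarrow>
      {(x, y). x \<in> shell m \<and> y \<in> shell n \<and> \<beta> x y = - r}" for r
    by (auto simp: shell_uminus \<beta>_minus shell_subset)
  from this[of r] this[of "- r"]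
  show "(\<lambda>(x, y). (- x, y)) \<in> {(x, y). x \<in> shell m \<and> y \<in> shell n \<and> \<beta> x y = - r} \<rightarrow>
      {(x, y). x \<in> shell m \<and> y \<in> shell n \<and> \<beta> x y = r}"
    and "(\<lambda>(x, y). (- x, y)) \<in> {(x, y). x \<in> shell m \<and> y \<in> shell n \<and> \<beta> x y = r} \<rightarrow>
      {(x, y). x \<in> shell m \<and> y \<in> shell n \<and> \<beta> x y = - r}" by simp_all
qed auto

text \<open>The pair (x, y - x) has inner product r - 2m, and y - x has norm 2(n - r + m). For r > m
  the last index drops, which drives the inner induction of \<open>pair_count_eq\<close>.\<close>

lemma pair_count_shift:
  assumes "int n' = int n - r + int m"
  shows "pair_count m r n = pair_count m (r - 2 * int m) n'"
  unfolding pair_count_def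
proof (rule bij_betw_same_card[where f = "\<lambda>(x, y). (x, y - x)"], rule bij_betwI[where g = "\<lambda>(x, y). (x, x + y)"])
  show "(\<lambda>(x, y). (x, y - x)) \<in> {(x, y). x \<in> shell m \<and> y \<in> shell n \<and> \<beta> x y = r} \<rightarrow>
      {(x, y). x \<in> shell m \<and> y \<in> shell n' \<and> \<beta> x y = r - 2 * int m}"
    using assms by (auto simp: shell_def diff_closed \<beta>_diff_self) (simp add: \<beta>_diff_right)
  show "(\<lambda>(x, y). (x, x + y)) \<in> {(x, y). x \<in> shell m \<and> y \<in> shell n' \<and> \<beta> x y = r - 2 * int m} \<rightarrow>
      {(x, y). x \<in> shell m \<and> y \<in> shell n \<and> \<beta> x y = r}"
    using assms by (auto simp: shell_def add_closed \<beta>_add_self) (simp add: \<beta>_add_right)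
qed auto

text \<open>Otherwise y - x would have the negative norm 2(n - r + m). This is the case in which the
  shifted index is not a natural number.\<close>

lemma pair_count_eq_0:
  assumes "int n - r + int m < 0"
  shows "pair_count m r n = 0"
proof -
  have False if "x \<in> shell m" "y \<in> shell n" "\<beta> x y = r" for x y
    using \<beta>_nonneg[OF diff_closed[of x y]] \<beta>_diff_self[of x y] that assms by (simp add: shell_def)
  hence "{(x, y). x \<in> shell m \<and> y \<in> shell n \<and> \<beta> x y = r} = {}" by auto
  thus ?thesis by (simp only: pair_count_def card.empty)
qed

lemma moment_eq_sum_pair_count:
  "moment m n j = (\<Sum>r\<in>{- int (m + n)..int (m + n)}. real (pair_count m r n) * of_int r ^ j)"
proof -
  let ?R = "{- int (m + n)..int (m + n)}"
  let ?S = "\<lambda>r. {(x, y). x \<in> shell m \<and> y \<in> shell n \<and> \<beta> x y = r}"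
  have "moment m n j = (\<Sum>z\<in>shell m \<times> shell n. of_int (\<beta> (fst z) (snd z)) ^ j)"
    unfolding moment_def by (simp add: sum.cartesian_product case_prod_unfold)
  also have "shell m \<times> shell n = (\<Union>r\<in>?R. ?S r)"
    using abs_\<beta>_le by (fastforce simp: shell_def)
  also have "(\<Sum>z\<in>(\<Union>r\<in>?R. ?S r). of_int (\<beta> (fst z) (snd z)) ^ j) = (\<Sum>r\<in>?R. \<Sum>z\<in>?S r. real_of_int (\<beta> (fst z) (snd z)) ^ j)"
    by (rule sum.UNION_disjoint) (auto simp: finite_pairs)
  also have "\<dots> = (\<Sum>r\<in>?R. \<Sum>z\<in>?S r. of_int r ^ j)"
    by (intro sum.cong) auto
  also have "\<dots> = (\<Sum>r\<in>?R. real (pair_count m r n) * of_int r ^ j)"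
    by (simp add: pair_count_def)
  finally show ?thesis .
qed

lemma pair_count_shell_0: "pair_count 0 r n = (if r = 0 then card (shell n) else 0)"
proof (cases "r = 0")
  case True
  have "{(x, y). x \<in> shell 0 \<and> y \<in> shell n \<and> \<beta> x y = 0} = {0} \<times> shell n"
    using \<beta>_zero_left by (auto simp: shell_0 shell_subset)
  thus ?thesis using True by (simp add: pair_count_def card_cartesian_product)
next
  case False
  have "{(x, y). x \<in> shell 0 \<and> y \<in> shell n \<and> \<beta> x y = r} = {}"
    using \<beta>_zero_left False by (auto simp: shell_0 shell_subset)
  thus ?thesis by (simp only: pair_count_def card.empty False if_False)
qed

lemma moment_shell_0: "moment 0 n 0 = card (shell n)"
  by (simp add: moment_def shell_0)

end

lemma has_sum_diff:
  fixes f g :: "'i \<Rightarrow> 'c::topological_ab_group_add"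
  assumes "(f has_sum a) A" "(g has_sum b) A"
  shows "((\<lambda>x. f x - g x) has_sum (a - b)) A"
  using has_sum_add[OF assms(1), of "\<lambda>x. - g x" "- b"] assms(2) by (simp add: has_sum_uminus)

text \<open>Lagrange form of the Vandermonde argument: a polynomial of degree below card R that
  vanishes on \<open>R\<close> except at s isolates e s, and its sum against e is a combination of
  the given moments.\<close>

lemma sum_power_zero_imp_zero:
  fixes e :: "int \<Rightarrow> real"
  assumes "finite R" and "\<And>j. j < card R \<Longrightarrow> (\<Sum>r\<in>R. e r * of_int r ^ j) = 0" and "s \<in> R"
  shows "e s = 0"
proof -
  define p where "p = (\<Prod>r\<in>R - {s}. [:- of_int r, 1:] :: real poly)"
  have deg: "degree p \<le> card R - 1"
  proof -
    have "degree p \<le> (\<Sum>r\<in>R - {s}. degree [:- of_int r, 1 :: real:])"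
      unfolding p_def using assms by (intro order.trans[OF degree_prod_sum_le]) auto
    thus ?thesis using assms by simp
  qed
  have "card R > 0" using assms by (auto simp: card_gt_0_iff)
  have "(\<Sum>r\<in>R. e r * poly p (of_int r)) = (\<Sum>r\<in>R. \<Sum>j\<le>degree p. coeff p j * (e r * of_int r ^ j))"
    by (simp add: poly_altdef sum_distrib_left mult_ac)
  also have "\<dots> = (\<Sum>j\<le>degree p. coeff p j * (\<Sum>r\<in>R. e r * of_int r ^ j))"
    by (subst sum.swap) (simp add: sum_distrib_left)
  also have "\<dots> = 0" using deg \<open>card R > 0\<close> by (intro sum.neutral ballI) (use assms(2) in simp)
  also have "(\<Sum>r\<in>R. e r * poly p (of_int r)) = (\<Sum>r\<in>{s}. e r * poly p (of_int r))"
    using assms by (intro sum.mono_neutral_right) (auto simp: p_def poly_prod)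
  finally have "e s * poly p (of_int s) = 0" by simp
  moreover have "poly p (of_int s) \<noteq> 0" using assms by (auto simp: p_def poly_prod)
  ultimately show ?thesis by simp
qed

subsection \<open>The pair counts do not depend on the lattice\<close>

locale two_leech_type_lattices =
  L1: leech_type_lattice A1 \<beta>1 + L2: leech_type_lattice A2 \<beta>2
  for A1 :: "'a::ab_group_add set" and \<beta>1 and A2 :: "'b::ab_group_add set" and \<beta>2
begin

text \<open>If the lower moments agree, the leading Taylor coefficient in \<open>z\<close> of the difference of
  the two theta functions inherits a modular transformation law.\<close>
lemma theta_moment_diff_transform:
  assumes low: "\<And>i t. i < j \<Longrightarrow> t > 0 \<Longrightarrow> L1.theta_moment m i t = L2.theta_moment m i t" and t: "t > 0"
  shows "of_real (L1.theta_moment m j (1 / t) - L2.theta_moment m j (1 / t))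
    = (\<i> * of_real t) ^ (12 + j) * of_real (L1.theta_moment m j t - L2.theta_moment m j t)"
proof -
  define d where "d i t = L1.theta_moment m i t - L2.theta_moment m i t" for i t
  define p where "p t w = L1.theta_fun m t w - L2.theta_fun m t w" for t w
  \<comment> \<open>Coefficients below j cancel by \<open>low\<close>, so the quotient by w^j is
    again a power series, whose value at 0 is the leading coefficient.\<close>
  have lim: "((\<lambda>w. p t w / w ^ j) \<longlongrightarrow> of_real (d j t / fact j)) (at 0)" if t: "t > 0" for t
  proof -
    have "(\<lambda>i. of_real (d (i + j) t / fact (i + j)) * w ^ i) sums (p t w / w ^ j)" if w: "w \<noteq> 0" "norm w < pi * t" for w
    proof -
      have "((\<lambda>i. of_real (d i t / fact i) * w ^ i) has_sum p t w) UNIV"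
        using has_sum_diff[OF L1.theta_fun_has_sum[OF t less_imp_le[OF w(2)], of m] L2.theta_fun_has_sum[OF t less_imp_le[OF w(2)], of m]]
        by (simp add: p_def d_def diff_divide_distrib left_diff_distrib)
      hence "(\<lambda>i. of_real (d i t / fact i) * w ^ i) sums p t w" by (rule has_sum_imp_sums)
      hence "(\<lambda>i. of_real (d (i + j) t / fact (i + j)) * w ^ (i + j)) sums p t w"
        by (subst sums_iff_shift) (use low t in \<open>simp add: d_def\<close>)
      hence "(\<lambda>i. of_real (d (i + j) t / fact (i + j)) * w ^ (i + j) / w ^ j) sums (p t w / w ^ j)"
        by (rule sums_divide)
      thus ?thesis using w by (simp add: power_add)
    qed
    from powser_limit_0_strong[OF _ this, of "pi * t"] t show ?thesis by simp
  qed
  have trans: "p t (2 * pi * \<i> * of_real z) = of_real ((1 / t) ^ 12 * exp (- 2 * pi * m * z\<^sup>2 / t)) * p (1 / t) (of_real (2 * pi * z / t))" for z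
    unfolding p_def L1.theta_fun_transform[OF t] L2.theta_fun_transform[OF t] by (simp add: right_diff_distrib)
  have z1: "filterlim (\<lambda>z::real. 2 * pi * \<i> * of_real z) (at 0) (at 0)"
    unfolding filterlim_at by (auto intro!: tendsto_eq_intros simp: eventually_at_filter)
  have z2: "filterlim (\<lambda>z::real. complex_of_real (2 * pi * z / t)) (at 0) (at 0)"
    unfolding filterlim_at using t by (auto intro!: tendsto_eq_intros simp: eventually_at_filter)
  have l1: "((\<lambda>z::real. p t (2 * pi * \<i> * of_real z) / (2 * pi * \<i> * of_real z) ^ j) \<longlongrightarrow> of_real (d j t / fact j)) (at 0)"
    by (rule filterlim_compose[OF lim[OF t] z1])
  have l2: "((\<lambda>z::real. p (1 / t) (of_real (2 * pi * z / t)) / of_real (2 * pi * z / t) ^ j) \<longlongrightarrow> of_real (d j (1 / t) / fact j)) (at 0)"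
    by (rule filterlim_compose[OF lim z2]) (use t in simp)
  have A: "((\<lambda>z::real. of_real ((1 / t) ^ 12 * exp (- 2 * pi * m * z\<^sup>2 / t)) * (p (1 / t) (of_real (2 * pi * z / t)) / of_real (2 * pi * z / t) ^ j)) \<longlongrightarrow> of_real ((1 / t) ^ 12 * 1) * of_real (d j (1 / t) / fact j)) (at 0)"
    by (intro tendsto_mult l2 tendsto_of_real) (use t in \<open>auto intro!: tendsto_eq_intros\<close>)
  \<comment> \<open>The two arguments differ by the factor i t, since 2 pi i z = (i t)(2 pi z / t);
    its j-th power is the part of the weight beyond 12.\<close>
  have B: "of_real ((1 / t) ^ 12 * exp (- 2 * pi * m * z\<^sup>2 / t)) * (p (1 / t) (of_real (2 * pi * z / t)) / of_real (2 * pi * z / t) ^ j)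
      = (\<i> * of_real t) ^ j * (p t (2 * pi * \<i> * of_real z) / (2 * pi * \<i> * of_real z) ^ j)" if "z \<noteq> 0" for z
  proof -
    have "(2 * pi * \<i> * of_real z) ^ j = (\<i> * of_real t) ^ j * of_real (2 * pi * z / t) ^ j"
      unfolding power_mult_distrib[symmetric] using t by (simp add: mult_ac)
    thus ?thesis unfolding trans using t that by simp
  qed
  have "((\<lambda>z::real. (\<i> * of_real t) ^ j * (p t (2 * pi * \<i> * of_real z) / (2 * pi * \<i> * of_real z) ^ j)) \<longlongrightarrow> of_real ((1 / t) ^ 12 * 1) * of_real (d j (1 / t) / fact j)) (at 0)"
    by (rule Lim_transform_eventually[OF A], unfold eventually_at_filter, rule always_eventually, intro allI impI, rule B)
  moreover have "((\<lambda>z::real. (\<i> * of_real t) ^ j * (p t (2 * pi * \<i> * of_real z) / (2 * pi * \<i> * of_real z) ^ j)) \<longlongrightarrow> (\<i> * of_real t) ^ j * of_real (d j t / fact j)) (at 0)"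
    by (intro tendsto_mult l1 tendsto_const)
  ultimately have "of_real ((1 / t) ^ 12 * 1) * of_real (d j (1 / t) / fact j) = (\<i> * of_real t) ^ j * (of_real (d j t / fact j) :: complex)"
    by (intro tendsto_unique[of "at (0::real)"]) auto
  hence "of_real (d j (1 / t)) = of_real t ^ 12 * (\<i> * of_real t) ^ j * of_real (d j t)"
    using t by (simp add: field_simps)
  \<comment> \<open>As i^12 = 1, the real factor t^12 merges into the weight 12 + j.\<close>
  moreover have "(\<i> * of_real t) ^ 12 = of_real t ^ 12"
  proof -
    have "\<i> ^ 12 = (\<i> ^ 2) ^ 6" by (simp only: power_mult[symmetric]) simp
    thus ?thesis by (simp add: power_mult_distrib)
  qed
  ultimately show ?thesis by (simp add: d_def power_add)
qed

text \<open>Strong induction on j: agreement of all lower moments makes the j-th difference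
  transform with weight 12 + j, and its coefficients below \<open>M\<close> vanish by assumption, so
  the weight bound applies.\<close>

lemma moments_eq:
  assumes low: "\<And>n i. n < M \<Longrightarrow> L1.moment m n i = L2.moment m n i" and "12 + j < 10 * M"
  shows "L1.moment m n j = L2.moment m n j"
  using assms(2)
proof (induction j arbitrary: n rule: less_induct)
  case (less j)
  define c where "c n = complex_of_real (L1.moment m n j - L2.moment m n j)" for n
  have theta_eq: "L1.theta_moment m i t = L2.theta_moment m i t" if "i < j" "t > 0" for i t
  proof -
    have "L1.moment m n i = L2.moment m n i" for n using less that by auto
    thus ?thesis using L1.has_sum_theta_moment[OF that(2), of m i] L2.has_sum_theta_moment[OF that(2), of m i]
      by (simp add: has_sum_unique)
  qed
  have hs: "((\<lambda>n. (L1.moment m n j - L2.moment m n j) * exp (- 2 * pi * t) ^ n) has_sum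
      (L1.theta_moment m j t - L2.theta_moment m j t)) UNIV" if "t > 0" for t
    using has_sum_diff[OF L1.has_sum_theta_moment[OF that, of m j] L2.has_sum_theta_moment[OF that, of m j]]
    by (simp add: left_diff_distrib)
  have val: "(\<Sum>n. c n * of_real (exp (- 2 * pi * t)) ^ n) = of_real (L1.theta_moment m j t - L2.theta_moment m j t)" if "t > 0" for t
  proof -
    have "((\<lambda>n. complex_of_real ((L1.moment m n j - L2.moment m n j) * exp (- 2 * pi * t) ^ n)) has_sum
      of_real (L1.theta_moment m j t - L2.theta_moment m j t)) UNIV" by (rule has_sum_of_real[OF hs[OF that]])
    from sums_unique[OF has_sum_imp_sums[OF this]] show ?thesis by (simp add: c_def)
  qed
  have "c n = 0"
  proof (rule qseries_eq_zero_of_vanishing[where M = M and k = "12 + j"])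
    fix z :: complex assume z: "norm z < 1"
    \<comment> \<open>The lower bound 1/2 keeps r positive even for z = 0, so that r = exp(-2 pi t)
      for some t > 0; absolute convergence at r dominates the series at z.\<close>
    define r where "r = max (norm z) (1 / 2)"
    have r: "0 < r" "r < 1" "norm z \<le> r" using z by (auto simp: r_def)
    define t where "t = - ln r / (2 * pi)"
    have t: "t > 0" "exp (- 2 * pi * t) = r" using r by (simp_all add: t_def field_simps)
    have "(\<lambda>n. (L1.moment m n j - L2.moment m n j) * r ^ n) summable_on UNIV"
      using has_sum_imp_summable[OF hs[OF t(1)]] t(2) by simp
    hence "(\<lambda>n. norm ((L1.moment m n j - L2.moment m n j) * r ^ n)) summable_on UNIV"
      by (simp only: summable_on_iff_abs_summable_on_real[symmetric])
    hence s: "summable (\<lambda>n. norm ((L1.moment m n j - L2.moment m n j) * r ^ n))"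
      by (rule summable_on_imp_summable)
    show "summable (\<lambda>n. c n * z ^ n)"
    proof (rule summable_comparison_test'[OF s])
      fix n :: nat
      show "norm (c n * z ^ n) \<le> norm ((L1.moment m n j - L2.moment m n j) * r ^ n)"
        unfolding c_def norm_mult norm_of_real norm_power real_norm_def abs_mult power_abs
        using r by (intro mult_left_mono power_mono) auto
    qed
  next
    fix t :: real assume t: "t > 0"
    have "(\<Sum>n. c n * of_real (exp (- 2 * pi / t)) ^ n) = of_real (L1.theta_moment m j (1 / t) - L2.theta_moment m j (1 / t))"
      using val[of "1 / t"] t by simp
    also have "\<dots> = (\<i> * of_real t) ^ (12 + j) * of_real (L1.theta_moment m j t - L2.theta_moment m j t)"
      by (rule theta_moment_diff_transform[OF theta_eq t])
    finally show "(\<Sum>n. c n * of_real (exp (- 2 * pi / t)) ^ n) = (\<i> * of_real t) ^ (12 + j) * (\<Sum>n. c n * of_real (exp (- 2 * pi * t)) ^ n)"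
      unfolding val[OF t] .
  qed (use low less.prems in \<open>auto simp: c_def\<close>)
  thus ?case by (simp add: c_def)
qed

theorem pair_count_eq: "L1.pair_count m r n = L2.pair_count m r n"
proof (induction m arbitrary: r n rule: less_induct)
  case (less m)
  consider "m = 0" | "m = 1" | "m \<ge> 2" by linarith
  thus ?case
  proof cases
    case 1
    \<comment> \<open>These are the coefficients of the ordinary theta series, and 12 < 10 * 2. The
      first two agree, that of q^1 being 0 because there are no vectors of norm 2.\<close>
    have "L1.moment 0 n 0 = L2.moment 0 n 0" for n
    proof (rule moments_eq[where M = 2])
      fix k i :: nat assume "k < 2"
      hence "k = 0 \<or> k = 1" by linarith
      thus "L1.moment 0 k i = L2.moment 0 k i"
      proof
        assume "k = 0"
        thus ?thesis using L1.\<beta>_zero_left[OF L1.zero_closed] L2.\<beta>_zero_left[OF L2.zero_closed]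
          by (simp add: L1.moment_def L2.moment_def L1.shell_0 L2.shell_0)
      next
        assume "k = 1"
        thus ?thesis using L1.shell_1 L2.shell_1 by (simp add: L1.moment_def L2.moment_def)
      qed
    qed simp
    thus ?thesis using 1 by (simp add: L1.pair_count_shell_0 L2.pair_count_shell_0 L1.moment_shell_0 L2.moment_shell_0)
  next
    case 2
    thus ?thesis using L1.shell_1 L2.shell_1 by (simp add: L1.pair_count_def L2.pair_count_def)
  next
    case 3
    have low: "L1.moment m n i = L2.moment m n i" if "n < m" for n i
      unfolding L1.moment_eq_sum_pair_count L2.moment_eq_sum_pair_count
      using less.IH[OF that] L1.pair_count_commute L2.pair_count_commute by simp
    \<comment> \<open>The inequality 12 + 2m < 10m is where m >= 2 enters.\<close>
    have mom: "L1.moment m n j = L2.moment m n j" if "j \<le> 2 * m" for n j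
      by (rule moments_eq[OF low]) (use 3 that in auto)
    show ?thesis
    proof (induction n arbitrary: r rule: less_induct)
      case (less n)
      have big: "L1.pair_count m r n = L2.pair_count m r n" if "r > int m" for r
      proof (cases "int n - r + int m < 0")
        case True
        thus ?thesis by (simp add: L1.pair_count_eq_0 L2.pair_count_eq_0)
      next
        case False
        define n' where "n' = nat (int n - r + int m)"
        have n': "int n' = int n - r + int m" "n' < n" using False that by (auto simp: n'_def)
        show ?thesis unfolding L1.pair_count_shift[OF n'(1)] L2.pair_count_shift[OF n'(1)] by (rule less.IH[OF n'(2)])
      qed
      have out: "L1.pair_count m r n = L2.pair_count m r n" if "\<bar>r\<bar> > int m" for r
        using big[of r] big[of "- r"] that L1.pair_count_uminus L2.pair_count_uminus by (cases "r \<ge> 0") auto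
      define e where "e r = real (L1.pair_count m r n) - real (L2.pair_count m r n)" for r
      \<comment> \<open>This set has 2m + 1 elements, exactly as many as there are moments j = 0,
        ..., 2m.\<close>
      define R where "R = {- int m..int m}"
      have zero: "(\<Sum>r\<in>R. e r * of_int r ^ j) = 0" if "j \<le> 2 * m" for j
      proof -
        have "(\<Sum>r\<in>{- int (m + n)..int (m + n)}. e r * of_int r ^ j) = 0"
          using mom[OF that, of n] unfolding L1.moment_eq_sum_pair_count L2.moment_eq_sum_pair_count
          by (simp add: e_def left_diff_distrib sum_subtractf)
        also have "(\<Sum>r\<in>{- int (m + n)..int (m + n)}. e r * of_int r ^ j) = (\<Sum>r\<in>R. e r * of_int r ^ j)"
          by (rule sum.mono_neutral_right) (use out in \<open>auto simp: R_def e_def\<close>)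
        finally show ?thesis .
      qed
      show ?case
      proof (cases "\<bar>r\<bar> > int m")
        case False
        have "e r = 0"
        proof (rule sum_power_zero_imp_zero[of R])
          show "(\<Sum>r\<in>R. e r * of_int r ^ j) = 0" if "j < card R" for j
            using that by (intro zero) (simp add: R_def)
        qed (use False in \<open>auto simp: R_def\<close>)
        thus ?thesis by (simp add: e_def)
      qed (rule out)
    qed
  qed
qed

end


subsection \<open>A Leech lattice with an automorphism of order 13\<close>

definition dot13 :: "(nat \<Rightarrow> int) \<Rightarrow> (nat \<Rightarrow> int) \<Rightarrow> int" where
  "dot13 x y = (\<Sum>i<13. x i * y i)"

definition vecs13 :: "(nat \<Rightarrow> int) set" where
  "vecs13 = {x. (\<forall>i\<ge>13. x i = 0) \<and> (\<Sum>i<13. x i) = 0}"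

text \<open>In Z[x]/(x^13 - 1) this is the ideal generated by (1 - x)^2: the conditions say w(1) = 0
  and 13 divides w'(1). It has index 13 in the root lattice A_12 and contains none of its
  roots.\<close>

definition lattW :: "(nat \<Rightarrow> int) set" where
  "lattW = {w \<in> vecs13. 13 dvd (\<Sum>i<13. int i * w i)}"

text \<open>The two conditions defining \<open>lattW\<close>, on the sum and on the weighted sum,
  make it orthogonal modulo 13 to all affine functions of i.\<close>

definition lattP :: "(nat \<Rightarrow> int) set" where
  "lattP = {a \<in> vecs13. \<exists>k c. \<forall>i<13. [a i = k * int i + c] (mod 13)}"

text \<open>The pair \<open>(a, w)\<close> stands for the vector \<open>(a / 13, 5 a / 13 + w)\<close> of two copies of the hyperplane
  of sum 0 in dimension 13; \<open>lattP\<close> is 13 times the dual of \<open>lattW\<close>, and unimodularity comes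
  from \<open>1\<^sup>2 + 5\<^sup>2 = 2 * 13\<close>.\<close>
definition leech13 :: "((nat \<Rightarrow> int) \<times> (nat \<Rightarrow> int)) set" where
  "leech13 = lattP \<times> lattW"

text \<open>For pairs (a, w) and (b, v) this is (a.b + (5a + 13w).(5b + 13v)) / 169, the inner
  product of the vectors they stand for; on \<open>leech13\<close> the division by 13 is
  exact.\<close>

definition form13 :: "(nat \<Rightarrow> int) \<times> (nat \<Rightarrow> int) \<Rightarrow> (nat \<Rightarrow> int) \<times> (nat \<Rightarrow> int) \<Rightarrow> int" where
  "form13 x y = (2 * dot13 (fst x) (fst y) + 5 * (dot13 (fst x) (snd y) + dot13 (snd x) (fst y))) div 13
     + dot13 (snd x) (snd y)"

lemma dot13_add: "dot13 (x + y) z = dot13 x z + dot13 y z" "dot13 z (x + y) = dot13 z x + dot13 z y"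
  by (simp_all add: dot13_def sum.distrib distrib_left distrib_right)

lemma dot13_commute: "dot13 x y = dot13 y x"
  by (simp add: dot13_def mult.commute)

lemma lessThan_13: "{..<13::nat} = {0,1,2,3,4,5,6,7,8,9,10,11,12}"
  by (auto simp: less_Suc_eq numeral_eq_Suc)

lemma sum_13:
  fixes f :: "nat \<Rightarrow> 'a::comm_monoid_add"
  shows "(\<Sum>i<13. f i) = f 0 + f 1 + f 2 + f 3 + f 4 + f 5 + f 6 + f 7 + f 8 + f 9 + f 10 + f 11 + f 12"
  by (simp add: lessThan_13 add_ac)

lemma lattP_sumD: "a \<in> lattP \<Longrightarrow> (\<Sum>i<13. a i) = 0" and lattW_sumD: "w \<in> lattW \<Longrightarrow> (\<Sum>i<13. w i) = 0"
  by (simp_all add: lattP_def lattW_def vecs13_def)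

lemma lattP_closed: "x \<in> lattP \<Longrightarrow> y \<in> lattP \<Longrightarrow> x + y \<in> lattP" "x \<in> lattP \<Longrightarrow> - x \<in> lattP" "0 \<in> lattP"
proof -
  assume x: "x \<in> lattP"
  then obtain k c where kc: "\<And>i. i < 13 \<Longrightarrow> [x i = k * int i + c] (mod 13)" by (auto simp: lattP_def)
  {
    assume y: "y \<in> lattP"
    then obtain k' c' where kc': "\<And>i. i < 13 \<Longrightarrow> [y i = k' * int i + c'] (mod 13)" by (auto simp: lattP_def)
    have "[x i + y i = (k + k') * int i + (c + c')] (mod 13)" if "i < 13" for i
      using cong_add[OF kc[OF that] kc'[OF that]] by (simp add: algebra_simps)
    thus "x + y \<in> lattP" using x y unfolding lattP_def vecs13_def by (auto simp: sum.distrib)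
  }
  have "[- x i = (- k) * int i + (- c)] (mod 13)" if "i < 13" for i
    using kc[OF that] cong_minus_minus_iff[of "x i" "k * int i + c"] by simp
  hence "\<exists>k c. \<forall>i<13. [- x i = k * int i + c] (mod 13)" by blast
  thus "- x \<in> lattP" using x unfolding lattP_def vecs13_def by (auto simp: sum_negf)
next
  show "0 \<in> lattP" unfolding lattP_def vecs13_def
    by (auto intro!: exI[of _ 0])
qed

lemma lattW_closed: "x \<in> lattW \<Longrightarrow> y \<in> lattW \<Longrightarrow> x + y \<in> lattW" "x \<in> lattW \<Longrightarrow> - x \<in> lattW" "0 \<in> lattW"
  by (auto simp: lattW_def vecs13_def sum.distrib distrib_left sum_negf)

lemma lattP_obtain:
  assumes "a \<in> lattP"
  obtains k c u where "\<And>i. i < 13 \<Longrightarrow> a i = k * int i + c + 13 * u i"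
proof -
  obtain k c where "\<forall>i<13. [a i = k * int i + c] (mod 13)" using assms by (auto simp: lattP_def)
  hence "\<forall>i<13. \<exists>u. a i = k * int i + c + 13 * u"
    by (metis cong_iff_lin cong_sym)
  thus ?thesis using that by metis
qed

lemma dvd_dot13_PP:
  assumes "a \<in> lattP" "b \<in> lattP" shows "13 dvd dot13 a b"
proof -
  obtain k c u where a: "\<And>i. i < 13 \<Longrightarrow> a i = k * int i + c + 13 * u i" using lattP_obtain[OF assms(1)] by blast
  obtain k' c' u' where b: "\<And>i. i < 13 \<Longrightarrow> b i = k' * int i + c' + 13 * u' i" using lattP_obtain[OF assms(2)] by blast
  have "dot13 a b = (\<Sum>i<13. (k * int i + c) * (k' * int i + c')) + 13 * (\<Sum>i<13. (k * int i + c) * u' i + u i * (k' * int i + c') + 13 * u i * u' i)"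
    unfolding dot13_def sum_distrib_left sum.distrib[symmetric] by (intro sum.cong) (auto simp: a b algebra_simps)
  \<comment> \<open>0 + ... + 12 = 13 * 6 and 0^2 + ... + 12^2 = 13 * 50.\<close>
  moreover have "(\<Sum>i<13. (k * int i + c) * (k' * int i + c')) = 13 * (50 * k * k' + 6 * (k * c' + k' * c) + c * c')"
    unfolding sum_13 by (simp add: algebra_simps)
  ultimately show ?thesis by simp
qed

lemma dvd_dot13_PW:
  assumes "a \<in> lattP" "w \<in> lattW" shows "13 dvd dot13 a w"
proof -
  obtain k c u where a: "\<And>i. i < 13 \<Longrightarrow> a i = k * int i + c + 13 * u i" using lattP_obtain[OF assms(1)] by blast
  have "dot13 a w = k * (\<Sum>i<13. int i * w i) + c * (\<Sum>i<13. w i) + 13 * (\<Sum>i<13. u i * w i)"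
    unfolding dot13_def sum_distrib_left sum.distrib[symmetric] by (intro sum.cong) (auto simp: a algebra_simps)
  thus ?thesis using assms(2) lattW_sumD[OF assms(2)] by (auto simp: lattW_def)
qed

lemma form13_times_13:
  assumes "x \<in> leech13" "y \<in> leech13"
  shows "13 * form13 x y = 2 * dot13 (fst x) (fst y) + 5 * (dot13 (fst x) (snd y) + dot13 (snd x) (fst y)) + 13 * dot13 (snd x) (snd y)"
proof -
  have "13 dvd 2 * dot13 (fst x) (fst y) + 5 * (dot13 (fst x) (snd y) + dot13 (snd x) (fst y))"
    using assms dvd_dot13_PP dvd_dot13_PW by (intro dvd_add dvd_mult) (auto simp: leech13_def dot13_commute[of "snd x"])
  thus ?thesis by (simp add: form13_def distrib_left)
qed

text \<open>Twice 2a.a + 10a.w + 13w.w splits into the squares of 2a + 5w and of w, which makes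
  definiteness visible.\<close>

lemma form13_self:
  assumes "x \<in> leech13"
  shows "26 * form13 x x = (\<Sum>i<13. (2 * fst x i + 5 * snd x i)\<^sup>2) + (\<Sum>i<13. (snd x i)\<^sup>2)"
proof -
  have "26 * form13 x x = 2 * (13 * form13 x x)" by simp
  also have "\<dots> = (\<Sum>i<13. (2 * fst x i + 5 * snd x i)\<^sup>2) + (\<Sum>i<13. (snd x i)\<^sup>2)"
    unfolding form13_times_13[OF assms assms] dot13_def sum_distrib_left sum.distrib[symmetric]
    by (intro sum.cong) (auto simp: power2_eq_square algebra_simps)
  finally show ?thesis .
qed

text \<open>This is the norm of \<open>(a / 13, 5 a / 13 + w)\<close>, multiplied by 169.\<close>
lemma form13_self':
  assumes "x \<in> leech13"
  shows "169 * form13 x x = (\<Sum>i<13. (fst x i)\<^sup>2) + (\<Sum>i<13. (5 * fst x i + 13 * snd x i)\<^sup>2)"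
proof -
  have "169 * form13 x x = 13 * (13 * form13 x x)" by simp
  also have "\<dots> = (\<Sum>i<13. (fst x i)\<^sup>2) + (\<Sum>i<13. (5 * fst x i + 13 * snd x i)\<^sup>2)"
    unfolding form13_times_13[OF assms assms] dot13_def sum_distrib_left sum.distrib[symmetric]
    by (intro sum.cong) (auto simp: power2_eq_square algebra_simps)
  finally show ?thesis .
qed

lemma vecs13_eq_0: "x \<in> vecs13 \<Longrightarrow> (\<And>i. i < 13 \<Longrightarrow> x i = 0) \<Longrightarrow> x = 0"
  unfolding vecs13_def by (auto simp: fun_eq_iff not_less[symmetric])

lemma form13_pos:
  assumes x: "x \<in> leech13" and "x \<noteq> 0" shows "form13 x x > 0"
proof (rule ccontr)
  assume "\<not> form13 x x > 0"
  hence "(\<Sum>i<13. (2 * fst x i + 5 * snd x i)\<^sup>2) + (\<Sum>i<13. (snd x i)\<^sup>2) \<le> 0"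
    using form13_self[OF x] by linarith
  moreover have "(\<Sum>i<13. (2 * fst x i + 5 * snd x i)\<^sup>2) \<ge> 0" "(\<Sum>i<13. (snd x i)\<^sup>2) \<ge> 0" by (auto intro: sum_nonneg)
  ultimately have z: "(\<Sum>i<13. (2 * fst x i + 5 * snd x i)\<^sup>2) = 0" "(\<Sum>i<13. (snd x i)\<^sup>2) = 0" by linarith+
  have "snd x i = 0" if "i < 13" for i using z(2) that by (subst (asm) sum_nonneg_eq_0_iff) auto
  moreover have "2 * fst x i + 5 * snd x i = 0" if "i < 13" for i using z(1) that by (subst (asm) sum_nonneg_eq_0_iff) auto
  ultimately have "fst x i = 0" "snd x i = 0" if "i < 13" for i using that by force+
  moreover have "fst x \<in> vecs13" "snd x \<in> vecs13" using x by (auto simp: leech13_def lattP_def lattW_def)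
  ultimately have "fst x = 0" "snd x = 0" using vecs13_eq_0 by blast+
  thus False using \<open>x \<noteq> 0\<close> by (simp add: prod_eq_iff)
qed

text \<open>As 13 is odd, only w.w matters modulo 2; the square of each w i has the parity of w i,
  and these add up to 0.\<close>

lemma form13_even:
  assumes x: "x \<in> leech13" shows "even (form13 x x)"
proof -
  have "13 * form13 x x = 2 * dot13 (fst x) (fst x) + 10 * dot13 (fst x) (snd x) + 13 * dot13 (snd x) (snd x)"
    unfolding form13_times_13[OF x x] by (simp add: dot13_commute)
  moreover have "even (dot13 (snd x) (snd x))"
  proof -
    have "dot13 (snd x) (snd x) = (\<Sum>i<13. snd x i * (snd x i - 1)) + (\<Sum>i<13. snd x i)"
      unfolding dot13_def sum.distrib[symmetric] by (intro sum.cong) (auto simp: algebra_simps)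
    moreover have "(\<Sum>i<13. snd x i) = 0" using x by (auto simp: leech13_def intro: lattW_sumD)
    moreover have "even (\<Sum>i<13. snd x i * (snd x i - 1))" by (intro dvd_sum) auto
    ultimately show ?thesis by simp
  qed
  ultimately have "even (13 * form13 x x)" by simp
  thus ?thesis by simp
qed

lemma square_ge_of_cong:
  fixes x r :: int
  assumes "[x = r] (mod 13)" "0 \<le> r" "r < 13"
  shows "x\<^sup>2 \<ge> (min r (13 - r))\<^sup>2"
proof -
  obtain q where q: "x = r + 13 * q" using assms(1) by (metis cong_iff_lin cong_sym)
  have "\<bar>x\<bar> \<ge> min r (13 - r)"
  proof (cases "q \<ge> 0")
    case True thus ?thesis using q assms by simp
  next
    case False thus ?thesis using q assms by simp
  qed
  hence "(min r (13 - r))\<^sup>2 \<le> \<bar>x\<bar>\<^sup>2" using assms by (intro power_mono) auto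
  thus ?thesis by simp
qed

text \<open>The entries run through all residues modulo 13, and the residues of least absolute value
  give 2(1 + 4 + 9 + 16 + 25 + 36) = 182.\<close>

lemma sum_squares_distinct_residues:
  fixes a :: "nat \<Rightarrow> int"
  assumes a: "\<And>i. i < 13 \<Longrightarrow> [a i = k * int i + c] (mod 13)" and k: "\<not> 13 dvd k"
  shows "(\<Sum>i<13. (a i)\<^sup>2) \<ge> 182"
proof -
  define g where "g i = (k * int i + c) mod 13" for i
  have inj: "inj_on g {..<13}"
  proof (rule inj_onI)
    fix i j :: nat assume ij: "i \<in> {..<13}" "j \<in> {..<13}" "g i = g j"
    have "[k * int i + c = k * int j + c] (mod 13)" using ij(3) by (simp add: g_def cong_def)
    hence "13 dvd k * (int i - int j)" by (simp add: cong_iff_dvd_diff right_diff_distrib)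
    moreover have "prime (13::int)" by simp
    ultimately have "13 dvd int i - int j" using k prime_dvd_mult_iff by blast
    thus "i = j" using ij(1,2) zdvd_imp_le[of 13 "int i - int j"] zdvd_imp_le[of 13 "int j - int i"]
      by (cases "i < j"; cases "j < i") (auto simp: dvd_diff_commute)
  qed
  have "g ` {..<13} \<subseteq> {0..12}" by (auto simp: g_def)
  moreover have "card (g ` {..<13}) = card {0..12::int}" using inj by (simp add: card_image)
  ultimately have img: "g ` {..<13} = {0..12}" by (intro card_subset_eq) auto
  have "182 = (\<Sum>r\<in>{0..12::int}. (min r (13 - r))\<^sup>2)"
  proof -
    have "{0..12::int} = {0,1,2,3,4,5,6,7,8,9,10,11,12}" by auto presburger
    thus ?thesis by simp
  qed
  also have "\<dots> = (\<Sum>i<13. (min (g i) (13 - g i))\<^sup>2)"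
    unfolding img[symmetric] by (subst sum.reindex[OF inj]) (simp add: o_def)
  also have "\<dots> \<le> (\<Sum>i<13. (a i)\<^sup>2)"
  proof (intro sum_mono square_ge_of_cong)
    fix i :: nat assume "i \<in> {..<13}"
    thus "[a i = g i] (mod 13)" using a[of i] by (simp add: g_def cong_def)
  qed (auto simp: g_def)
  finally show ?thesis by simp
qed

text \<open>Writing a i = c + 13 u i, the u i add up to -c, and (u i)^2 >= - u i for integers bounds
  the sum of their squares below by c.\<close>

lemma sum_squares_constant_residue:
  fixes a :: "nat \<Rightarrow> int"
  assumes a: "\<And>i. i < 13 \<Longrightarrow> [a i = c] (mod 13)" and s: "(\<Sum>i<13. a i) = 0" and c: "0 \<le> c" "c < 13"
  shows "(\<Sum>i<13. (a i)\<^sup>2) \<ge> 13 * c * (13 - c)"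
proof -
  have "\<forall>i<13. \<exists>u. a i = c + 13 * u" using a by (metis cong_iff_lin cong_sym)
  then obtain u where u: "\<And>i. i < 13 \<Longrightarrow> a i = c + 13 * u i" by metis
  have "0 = (\<Sum>i<13. c + 13 * u i)" using s u by simp
  hence su: "(\<Sum>i<13. u i) = - c" by (simp add: sum.distrib sum_distrib_left[symmetric])
  have "(\<Sum>i<13. (a i)\<^sup>2) = (\<Sum>i<13. c\<^sup>2 + 26 * c * u i + 169 * (u i)\<^sup>2)"
    by (intro sum.cong) (auto simp: u power2_eq_square algebra_simps)
  also have "\<dots> = 13 * c\<^sup>2 - 26 * c\<^sup>2 + 169 * (\<Sum>i<13. (u i)\<^sup>2)"
    by (simp add: sum.distrib sum_distrib_left[symmetric] su power2_eq_square)
  finally have eq: "(\<Sum>i<13. (a i)\<^sup>2) = 13 * c\<^sup>2 - 26 * c\<^sup>2 + 169 * (\<Sum>i<13. (u i)\<^sup>2)" .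
  have "c = (\<Sum>i<13. - u i)" using su by (simp add: sum_negf)
  also have "\<dots> \<le> (\<Sum>i<13. (u i)\<^sup>2)"
  proof (rule sum_mono)
    fix i
    show "- u i \<le> (u i)\<^sup>2"
    proof (cases "u i \<ge> 0")
      case True thus ?thesis by (simp add: order.trans[of _ 0])
    next
      case False
      hence "1 * (- u i) \<le> (- u i) * (- u i)" by (intro mult_right_mono) auto
      thus ?thesis by (simp add: power2_eq_square)
    qed
  qed
  finally show ?thesis using eq by (simp add: power2_eq_square algebra_simps)
qed

text \<open>A vector of norm 2 with sum 0 is \<open>e p - e q\<close>, for which the weighted sum is \<open>p - q\<close>.\<close>
lemma no_root_in_lattW:
  fixes x :: "nat \<Rightarrow> int"
  assumes s: "(\<Sum>i<13. x i) = 0" and d: "13 dvd (\<Sum>i<13. int i * x i)" and n: "(\<Sum>i<13. (x i)\<^sup>2) = 2"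
  shows False
proof -
  have "\<exists>p<13. x p > 0"
  proof (rule ccontr)
    assume "\<not> (\<exists>p<13. x p > 0)"
    hence "\<And>i. i \<in> {..<13} \<Longrightarrow> - x i \<ge> 0" by force
    moreover have "(\<Sum>i<13. - x i) = 0" using s by (simp add: sum_negf)
    ultimately have "\<forall>i\<in>{..<13}. - x i = 0" by (subst (asm) sum_nonneg_eq_0_iff) auto
    thus False using n by simp
  qed
  moreover have "\<exists>q<13. x q < 0"
  proof (rule ccontr)
    assume "\<not> (\<exists>q<13. x q < 0)"
    hence "\<And>i. i \<in> {..<13} \<Longrightarrow> x i \<ge> 0" by force
    hence "\<forall>i\<in>{..<13}. x i = 0" using s by (subst (asm) sum_nonneg_eq_0_iff) auto
    thus False using n by simp
  qed
  ultimately obtain p q where pq: "p < 13" "x p > 0" "q < 13" "x q < 0" by blast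
  hence "p \<noteq> q" by auto
  have split: "(\<Sum>i<13. f i) = f p + f q + (\<Sum>i\<in>{..<13} - {p, q}. f i)" for f :: "nat \<Rightarrow> int"
  proof -
    have "{..<13} = insert p (insert q ({..<13} - {p, q}))" using pq by auto
    hence "(\<Sum>i<13. f i) = (\<Sum>i\<in>insert p (insert q ({..<13} - {p, q})). f i)" by simp
    also have "\<dots> = f p + f q + (\<Sum>i\<in>{..<13} - {p, q}. f i)" using \<open>p \<noteq> q\<close> by (subst sum.insert; simp)+
    finally show ?thesis .
  qed
  have "1 * 1 \<le> x p * x p" using pq by (intro mult_mono) auto
  moreover have "1 * 1 \<le> (- x q) * (- x q)" using pq by (intro mult_mono) auto
  moreover have "(\<Sum>i\<in>{..<13} - {p, q}. (x i)\<^sup>2) \<ge> 0" by (intro sum_nonneg) auto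
  ultimately have z: "x p * x p = 1" "x q * x q = 1" "(\<Sum>i\<in>{..<13} - {p, q}. (x i)\<^sup>2) = 0"
    using n unfolding split[of "\<lambda>i. (x i)\<^sup>2"] by (auto simp: power2_eq_square)
  have x0: "x i = 0" if "i \<in> {..<13} - {p, q}" for i
    using z(3) that by (subst (asm) sum_nonneg_eq_0_iff) auto
  have "x p = 1" "x q = - 1" using z(1,2) pq by (auto simp: zmult_eq_1_iff)
  hence "(\<Sum>i<13. int i * x i) = int p - int q" unfolding split using x0 by simp
  hence "13 dvd int p - int q" using d by simp
  hence "p = q" using pq zdvd_imp_le[of 13 "int p - int q"] zdvd_imp_le[of 13 "int q - int p"]
    by (cases "p < q"; cases "q < p") (auto simp: dvd_diff_commute)
  thus False using \<open>p \<noteq> q\<close> by simp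
qed

text \<open>Norm 2 means that a and b = 5a + 13w have square norms adding up to 2 * 169 = 338. If a
  has nonzero slope modulo 13, each is at least 182. If the slope is 0, so is the constant residue,
  and division by 13 leads to a vector excluded by \<open>no_root_in_lattW\<close>.\<close>

lemma form13_not_2:
  assumes x: "x \<in> leech13" shows "form13 x x \<noteq> 2"
proof
  assume n: "form13 x x = 2"
  define a w where "a = fst x" and "w = snd x"
  have aP: "a \<in> lattP" and wW: "w \<in> lattW" using x by (auto simp: leech13_def a_def w_def)
  note sa = lattP_sumD[OF aP] and sw = lattW_sumD[OF wW]
  define b where "b i = 5 * a i + 13 * w i" for i
  have norm: "(\<Sum>i<13. (a i)\<^sup>2) + (\<Sum>i<13. (b i)\<^sup>2) = 338"
    using form13_self'[OF x] n by (simp add: a_def w_def b_def)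
  have sb: "(\<Sum>i<13. b i) = 0" using sa sw by (simp add: b_def sum.distrib sum_distrib_left[symmetric])
  obtain k c where kc: "\<And>i. i < 13 \<Longrightarrow> [a i = k * int i + c] (mod 13)" using aP by (auto simp: lattP_def)
  have b_cong: "[b i = 5 * a i] (mod 13)" for i by (simp add: b_def cong_iff_dvd_diff)
  show False
  proof (cases "13 dvd k")
    case False
    have "[b i = (5 * k) * int i + 5 * c] (mod 13)" if "i < 13" for i
      using cong_trans[OF b_cong cong_scalar_left[OF kc[OF that], of 5]] by (simp add: algebra_simps)
    moreover have "\<not> 13 dvd 5 * k"
      using False by (subst prime_dvd_mult_iff) (auto simp: zdvd_not_zless)
    ultimately have "(\<Sum>i<13. (b i)\<^sup>2) \<ge> 182" by (rule sum_squares_distinct_residues)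
    moreover have "(\<Sum>i<13. (a i)\<^sup>2) \<ge> 182" using kc False by (rule sum_squares_distinct_residues)
    ultimately show False using norm by linarith
  next
    case True
    define r where "r = c mod 13"
    have r: "0 \<le> r" "r < 13" by (auto simp: r_def)
    have ar: "[a i = r] (mod 13)" if "i < 13" for i
    proof -
      have "[k * int i + c = c] (mod 13)" using True by (simp add: cong_iff_dvd_diff)
      hence "[a i = c] (mod 13)" using kc[OF that] cong_trans by blast
      thus ?thesis by (simp add: r_def cong_def)
    qed
    define r' where "r' = (5 * r) mod 13"
    have r': "0 \<le> r'" "r' < 13" by (auto simp: r'_def)
    have br: "[b i = r'] (mod 13)" if "i < 13" for i
      using cong_trans[OF b_cong cong_scalar_left[OF ar[OF that], of 5]] by (simp add: r'_def cong_def)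
    have "13 * r * (13 - r) + 13 * r' * (13 - r') \<le> 338"
      using sum_squares_constant_residue[OF ar sa r] sum_squares_constant_residue[OF br sb r'] norm by linarith
    \<comment> \<open>Divided by 13, the bound reads r(13 - r) + r'(13 - r') <= 26 with r' = 5r mod
      13; among the 13 residues only r = 0 satisfies it.\<close>
    moreover have "r \<in> {0,1,2,3,4,5,6,7,8,9,10,11,12}" using r by (simp, presburger)
    ultimately have "r = 0" by (auto simp: r'_def)
    hence "\<forall>i<13. \<exists>\<alpha>. a i = 13 * \<alpha>" using ar by (simp add: cong_0_iff dvd_def)
    then obtain \<alpha> where \<alpha>: "\<And>i. i < 13 \<Longrightarrow> a i = 13 * \<alpha> i" by metis
    have s\<alpha>: "(\<Sum>i<13. \<alpha> i) = 0" using sa \<alpha> by (simp add: sum_distrib_left[symmetric])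
    define \<gamma> where "\<gamma> i = 5 * \<alpha> i + w i" for i
    have s\<gamma>: "(\<Sum>i<13. \<gamma> i) = 0" using s\<alpha> sw by (simp add: \<gamma>_def sum.distrib sum_distrib_left[symmetric])
    have "(\<Sum>i<13. (a i)\<^sup>2) = 169 * (\<Sum>i<13. (\<alpha> i)\<^sup>2)"
      unfolding sum_distrib_left by (intro sum.cong) (auto simp: \<alpha> power_mult_distrib)
    moreover have "(\<Sum>i<13. (b i)\<^sup>2) = 169 * (\<Sum>i<13. (\<gamma> i)\<^sup>2)"
      unfolding sum_distrib_left by (intro sum.cong) (auto simp: b_def \<gamma>_def \<alpha> power2_eq_square algebra_simps)
    ultimately have two: "(\<Sum>i<13. (\<alpha> i)\<^sup>2) + (\<Sum>i<13. (\<gamma> i)\<^sup>2) = 2" using norm by linarith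
    have ev: "even (\<Sum>i<13. (y i)\<^sup>2)" if "(\<Sum>i<13. y i) = 0" for y :: "nat \<Rightarrow> int"
    proof -
      have "(\<Sum>i<13. (y i)\<^sup>2) = (\<Sum>i<13. y i * (y i - 1)) + (\<Sum>i<13. y i)"
        unfolding sum.distrib[symmetric] by (intro sum.cong) (auto simp: power2_eq_square algebra_simps)
      moreover have "even (\<Sum>i<13. y i * (y i - 1))" by (intro dvd_sum) auto
      ultimately show ?thesis using that by simp
    qed
    have nn: "(\<Sum>i<13. (\<alpha> i)\<^sup>2) \<ge> 0" "(\<Sum>i<13. (\<gamma> i)\<^sup>2) \<ge> 0" by (auto intro: sum_nonneg)
    \<comment> \<open>Integer vectors of sum 0 have even square norm, so one of \<alpha> and
      \<gamma> is 0 and the other has square norm 2.\<close>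
    have "(\<Sum>i<13. (\<alpha> i)\<^sup>2) = 0 \<or> (\<Sum>i<13. (\<alpha> i)\<^sup>2) = 2"
      using ev[OF s\<alpha>] two nn by presburger
    thus False
    proof
      assume "(\<Sum>i<13. (\<alpha> i)\<^sup>2) = 0"
      moreover from this have "\<alpha> i = 0" if "i < 13" for i using that by (subst (asm) sum_nonneg_eq_0_iff) auto
      hence "\<gamma> i = w i" if "i < 13" for i using that by (simp add: \<gamma>_def)
      ultimately have "(\<Sum>i<13. (w i)\<^sup>2) = 2" using two by simp
      thus False using no_root_in_lattW[of w] sw wW by (auto simp: lattW_def)
    next
      assume a2: "(\<Sum>i<13. (\<alpha> i)\<^sup>2) = 2"
      hence "(\<Sum>i<13. (\<gamma> i)\<^sup>2) = 0" using two by simp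
      hence "\<gamma> i = 0" if "i < 13" for i using that by (subst (asm) sum_nonneg_eq_0_iff) auto
      \<comment> \<open>As 5 is invertible modulo 13, the condition on the weighted sum passes from
        w to \<alpha>.\<close>
      hence wa: "w i = - 5 * \<alpha> i" if "i < 13" for i using that by (force simp: \<gamma>_def)
      have "13 dvd (\<Sum>i<13. int i * w i)" using wW by (simp add: lattW_def)
      also have "(\<Sum>i<13. int i * w i) = (- 5) * (\<Sum>i<13. int i * \<alpha> i)"
        unfolding sum_distrib_left by (intro sum.cong) (auto simp: wa)
      finally have "13 dvd 5 * (\<Sum>i<13. int i * \<alpha> i)" by simp
      moreover have "prime (13 :: int)" by simp
      ultimately have "13 dvd (\<Sum>i<13. int i * \<alpha> i)" by (auto simp: prime_dvd_mult_iff)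
      thus False using no_root_in_lattW[OF s\<alpha> _ a2] by simp
    qed
  qed
qed


section \<open>Coordinates on the reference lattice and its unimodularity\<close>

lemma (in unimodular_gram) theta_transport:
  assumes card: "card I = 24" and bij: "bij_betw \<phi> (int_vecs I) A"
    and form: "\<And>x y. x \<in> int_vecs I \<Longrightarrow> y \<in> int_vecs I \<Longrightarrow> \<beta> (\<phi> x) (\<phi> y) = int_form I G x y"
    and t: "t > 0"
  shows "(\<lambda>y. exp (- pi * t * of_int (\<beta> y y))) summable_on A"
    and "x \<in> A \<Longrightarrow> (\<Sum>\<^sub>\<infinity>y\<in>A. complex_of_real (exp (- pi * t * of_int (\<beta> y y))) * cis (2 * pi * s * of_int (\<beta> x y)))
      = of_real (\<Sum>\<^sub>\<infinity>y\<in>A. (1 / t) ^ 12 *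
          exp (- pi * (of_int (\<beta> y y) - 2 * s * of_int (\<beta> x y) + s\<^sup>2 * of_int (\<beta> x x)) / t))"
proof -
  have "(\<lambda>y. exp (- pi * t * of_int (\<beta> (\<phi> y) (\<phi> y)))) summable_on int_vecs I"
    using summable_on_theta_int[OF t] by (rule summable_on_cong[THEN iffD1, rotated]) (simp add: form)
  thus "(\<lambda>y. exp (- pi * t * of_int (\<beta> y y))) summable_on A"
    using summable_on_reindex_bij_betw[OF bij, of "\<lambda>y. exp (- pi * t * of_int (\<beta> y y))"] by simp
  assume "x \<in> A"
  then obtain x' where x': "x' \<in> int_vecs I" "x = \<phi> x'" using bij by (auto simp: bij_betw_def)
  have pow: "(1 / sqrt t) ^ card I = (1 / t) ^ 12"
  proof -
    have "(1 / sqrt t) ^ 24 = ((1 / sqrt t)\<^sup>2) ^ 12" by (simp only: power_mult[symmetric]) simp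
    thus ?thesis using t by (simp add: card power_divide)
  qed
  have "(\<Sum>\<^sub>\<infinity>y\<in>A. complex_of_real (exp (- pi * t * of_int (\<beta> y y))) * cis (2 * pi * s * of_int (\<beta> x y)))
     = (\<Sum>\<^sub>\<infinity>y\<in>int_vecs I. complex_of_real (exp (- pi * t * of_int (\<beta> (\<phi> y) (\<phi> y)))) * cis (2 * pi * s * of_int (\<beta> x (\<phi> y))))"
    by (rule infsum_reindex_bij_betw[OF bij, symmetric])
  also have "\<dots> = (\<Sum>\<^sub>\<infinity>y\<in>int_vecs I. complex_of_real (exp (- pi * t * of_int (int_form I G y y))) * cis (2 * pi * s * of_int (int_form I G x' y)))"
    by (intro infsum_cong) (simp add: form x')
  also have "\<dots> = of_real (\<Sum>\<^sub>\<infinity>y\<in>int_vecs I. (1 / t) ^ 12 *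
        exp (- pi * (of_int (int_form I G y y) - 2 * s * of_int (int_form I G x' y) + s\<^sup>2 * of_int (int_form I G x' x')) / t))"
    unfolding theta_transformation[OF t x'(1)] pow ..
  also have "(\<Sum>\<^sub>\<infinity>y\<in>int_vecs I. (1 / t) ^ 12 *
        exp (- pi * (of_int (int_form I G y y) - 2 * s * of_int (int_form I G x' y) + s\<^sup>2 * of_int (int_form I G x' x')) / t))
     = (\<Sum>\<^sub>\<infinity>y\<in>int_vecs I. (1 / t) ^ 12 *
          exp (- pi * (of_int (\<beta> (\<phi> y) (\<phi> y)) - 2 * s * of_int (\<beta> x (\<phi> y)) + s\<^sup>2 * of_int (\<beta> x x)) / t))"
    by (intro infsum_cong) (simp add: form x')
  also have "\<dots> = (\<Sum>\<^sub>\<infinity>y\<in>A. (1 / t) ^ 12 *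
          exp (- pi * (of_int (\<beta> y y) - 2 * s * of_int (\<beta> x y) + s\<^sup>2 * of_int (\<beta> x x)) / t))"
    by (rule infsum_reindex_bij_betw[OF bij])
  finally show "(\<Sum>\<^sub>\<infinity>y\<in>A. complex_of_real (exp (- pi * t * of_int (\<beta> y y))) * cis (2 * pi * s * of_int (\<beta> x y)))
      = of_real (\<Sum>\<^sub>\<infinity>y\<in>A. (1 / t) ^ 12 *
          exp (- pi * (of_int (\<beta> y y) - 2 * s * of_int (\<beta> x y) + s\<^sup>2 * of_int (\<beta> x x)) / t))" .
qed

definition unit_vec :: "'i \<Rightarrow> 'i \<Rightarrow> int" where
  "unit_vec i = (\<lambda>j. if j = i then 1 else 0)"

lemma unit_vec_in: "i \<in> I \<Longrightarrow> unit_vec i \<in> int_vecs I"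
  by (auto simp: unit_vec_def int_vecs_def)

lemma additive_int:
  fixes g :: "int \<Rightarrow> int"
  assumes "\<And>m n. g (m + n) = g m + g n"
  shows "g n = n * g 1"
proof -
  have g0: "g 0 = 0" using assms[of 0 0] by simp
  have nat: "g (int n) = int n * g 1" for n
    by (induction n) (use g0 assms in \<open>auto simp: algebra_simps\<close>)
  show ?thesis
  proof (cases n rule: int_cases2)
    case (nonneg k) thus ?thesis using nat by simp
  next
    case (nonpos k) thus ?thesis using nat[of k] assms[of "int k" "- int k"] g0 by simp
  qed
qed

lemma additive_int_vecs:
  fixes F :: "('i \<Rightarrow> int) \<Rightarrow> int"
  assumes "finite I" and "\<And>x y. x \<in> int_vecs I \<Longrightarrow> y \<in> int_vecs I \<Longrightarrow> F (x + y) = F x + F y"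
    and "x \<in> int_vecs I"
  shows "F x = (\<Sum>i\<in>I. x i * F (unit_vec i))"
  using assms
proof (induction I arbitrary: x rule: finite_induct)
  case empty
  have "x = (\<lambda>_. 0)" using empty(2) by (auto simp: int_vecs_def fun_eq_iff)
  moreover have "F (\<lambda>_. 0) = 0" using empty(1)[of "\<lambda>_. 0" "\<lambda>_. 0"] by (simp add: int_vecs_def plus_fun_def)
  ultimately show ?case by simp
next
  case (insert i I)
  define g where "g n = F (\<lambda>j. if j = i then n else 0)" for n
  have g: "g n = n * g 1" for n
  proof (rule additive_int)
    fix m n
    have "(\<lambda>j. if j = i then m + n else 0) = (\<lambda>j. if j = i then m else 0) + (\<lambda>j. if j = i then n else (0::int))"
      by (auto simp: fun_eq_iff)
    thus "g (m + n) = g m + g n" unfolding g_def by (simp only: insert.prems(1) int_vecs_def) (rule insert.prems(1); simp add: int_vecs_def)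
  qed
  have x0: "x(i := 0) \<in> int_vecs I" using insert.prems(2) by (auto simp: int_vecs_def)
  have sub: "int_vecs I \<subseteq> int_vecs (insert i I)" by (auto simp: int_vecs_def)
  have "x = x(i := 0) + (\<lambda>j. if j = i then x i else 0)" by (auto simp: fun_eq_iff)
  hence "F x = F (x(i := 0) + (\<lambda>j. if j = i then x i else 0))" by simp
  also have "\<dots> = F (x(i := 0)) + g (x i)"
    unfolding g_def by (rule insert.prems(1)) (use x0 sub in \<open>auto simp: int_vecs_def\<close>)
  also have "F (x(i := 0)) = (\<Sum>j\<in>I. (x(i := 0)) j * F (unit_vec j))"
    using insert.IH[OF _ x0] insert.prems(1) sub by blast
  also have "\<dots> = (\<Sum>j\<in>I. x j * F (unit_vec j))" using insert.hyps by (intro sum.cong) auto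
  also have "g (x i) = x i * F (unit_vec i)" unfolding g[of "x i"] by (simp add: g_def unit_vec_def)
  finally show ?case using insert.hyps by simp
qed

lemma sum_2_13:
  fixes f :: "nat \<Rightarrow> 'a::comm_monoid_add"
  shows "(\<Sum>i\<in>{2..<13}. f i) = f 2 + f 3 + f 4 + f 5 + f 6 + f 7 + f 8 + f 9 + f 10 + f 11 + f 12"
proof -
  have "{2..<13::nat} = {2,3,4,5,6,7,8,9,10,11,12}" by (auto simp: less_Suc_eq numeral_eq_Suc)
  thus ?thesis by (simp add: add_ac)
qed

text \<open>Free coordinates, indexed by \<open>{0,2,\<dots>,12}\<close>: \<open>u 0\<close> is the slope of \<open>i \<mapsto> a i\<close> modulo 13 and
  \<open>u i\<close> its deviation \<open>(a i - a 0 - i * u 0) / 13\<close> from the line through its first two entries; \<open>v 0\<close> is the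
  weighted sum of \<open>w\<close> divided by 13. The remaining entries are forced by the sum being 0, and
  the two bases are dual up to the factor 13 (\<open>dot13_decode\<close>).\<close>
definition decodeP :: "(nat \<Rightarrow> int) \<Rightarrow> nat \<Rightarrow> int" where
  "decodeP u i = (if i < 13 then (- 6 * u 0 - (\<Sum>j\<in>{2..<13}. u j)) + int i * u 0 + 13 * (if i < 2 then 0 else u i) else 0)"

definition decodeW :: "(nat \<Rightarrow> int) \<Rightarrow> nat \<Rightarrow> int" where
  "decodeW v i = (if i = 0 then (\<Sum>j\<in>{2..<13}. int j * v j) - 13 * v 0 - (\<Sum>j\<in>{2..<13}. v j)
     else if i = 1 then 13 * v 0 - (\<Sum>j\<in>{2..<13}. int j * v j) else if i < 13 then v i else 0)"

definition encodeP :: "(nat \<Rightarrow> int) \<Rightarrow> nat \<Rightarrow> int" where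
  "encodeP a j = (if j = 0 then a 1 - a 0 else (a j - a 0 - int j * (a 1 - a 0)) div 13)"

definition encodeW :: "(nat \<Rightarrow> int) \<Rightarrow> nat \<Rightarrow> int" where
  "encodeW w j = (if j = 0 then (\<Sum>i<13. int i * w i) div 13 else w j)"

definition idx :: "nat set" where "idx = {..<13} - {1}"

lemma sum_idx: "(\<Sum>i\<in>idx. f i) = f 0 + (\<Sum>i\<in>{2..<13}. f i)"
proof -
  have "idx = insert 0 {2..<13}" by (auto simp: idx_def)
  hence "(\<Sum>i\<in>idx. f i) = (\<Sum>i\<in>insert 0 {2..<13}. f i)" by (simp only:)
  thus ?thesis by (simp del: sum.op_ivl_Suc)
qed

lemma decodeW_moment: "(\<Sum>i<13. int i * decodeW v i) = 13 * v 0"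
  unfolding sum_13 by (simp add: decodeW_def sum_2_13)

lemma decodeW_sum: "(\<Sum>i<13. decodeW v i) = 0"
  unfolding sum_13 by (simp add: decodeW_def sum_2_13)

lemma decodeW_in: "decodeW v \<in> lattW"
  using decodeW_moment[of v] decodeW_sum[of v] by (auto simp: lattW_def vecs13_def decodeW_def)

lemma decodeP_sum: "(\<Sum>i<13. decodeP u i) = 0"
  unfolding sum_13 by (simp add: decodeP_def sum_2_13)

lemma decodeP_in: "decodeP u \<in> lattP"
proof -
  have "[decodeP u i = u 0 * int i + (- 6 * u 0 - (\<Sum>j\<in>{2..<13}. u j))] (mod 13)" if "i < 13" for i
    using that by (simp add: decodeP_def cong_iff_dvd_diff)
  hence "\<exists>k c. \<forall>i<13. [decodeP u i = k * int i + c] (mod 13)" by blast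
  moreover have "\<forall>i\<ge>13. decodeP u i = 0" by (simp add: decodeP_def)
  ultimately show ?thesis using decodeP_sum[of u] unfolding lattP_def vecs13_def by simp
qed

text \<open>The affine part of a pairs with w only through the sum 0 and the weighted sum 13 v 0,
  and the deviations 13 u i pair with the free entries w i = v i.\<close>

lemma dot13_decode: "dot13 (decodeP u) (decodeW v) = 13 * (\<Sum>j\<in>idx. u j * v j)"
proof -
  define a0 where "a0 = - 6 * u 0 - (\<Sum>j\<in>{2..<13}. u j)"
  have dP: "decodeP u i = a0 + int i * u 0 + 13 * (if i < 2 then 0 else u i)" if "i < 13" for i
    using that by (simp add: decodeP_def a0_def)
  have "dot13 (decodeP u) (decodeW v) = a0 * (\<Sum>i<13. decodeW v i) + u 0 * (\<Sum>i<13. int i * decodeW v i)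
     + 13 * (\<Sum>i<13. (if i < 2 then 0 else u i) * decodeW v i)"
    unfolding dot13_def sum_distrib_left sum.distrib[symmetric]
    by (intro sum.cong) (auto simp: dP algebra_simps)
  moreover have "(\<Sum>i<13. (if i < 2 then 0 else u i) * decodeW v i) = (\<Sum>j\<in>{2..<13}. u j * v j)"
    unfolding sum_13 sum_2_13 by (simp add: decodeW_def)
  ultimately show ?thesis by (simp add: decodeW_sum decodeW_moment sum_idx algebra_simps)
qed

lemma encodeP_decodeP: "j \<in> idx \<Longrightarrow> encodeP (decodeP u) j = u j"
  by (auto simp: encodeP_def decodeP_def idx_def)

lemma encodeW_decodeW: "j \<in> idx \<Longrightarrow> encodeW (decodeW v) j = v j"
  using decodeW_moment[of v] by (auto simp: encodeW_def idx_def) (auto simp: decodeW_def)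

lemma decodeW_encodeW:
  assumes "w \<in> lattW" shows "decodeW (encodeW w) = w"
proof
  fix i :: nat
  have m: "13 * ((\<Sum>i<13. int i * w i) div 13) = (\<Sum>i<13. int i * w i)" using assms by (simp add: lattW_def)
  have s: "(\<Sum>i<13. w i) = 0" by (rule lattW_sumD[OF assms])
  have "i = 0 \<or> i = 1 \<or> (2 \<le> i \<and> i < 13) \<or> i \<ge> 13" by linarith
  thus "decodeW (encodeW w) i = w i"
  proof (elim disjE)
    assume "i = 0" thus ?thesis using m s unfolding decodeW_def encodeW_def sum_13 sum_2_13 by simp
  next
    assume "i = 1" thus ?thesis using m unfolding decodeW_def encodeW_def sum_13 sum_2_13 by simp
  next
    assume "2 \<le> i \<and> i < 13" thus ?thesis by (auto simp: decodeW_def encodeW_def)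
  next
    assume "i \<ge> 13" thus ?thesis using assms by (auto simp: decodeW_def lattW_def vecs13_def)
  qed
qed

lemma decodeP_encodeP:
  assumes "a \<in> lattP" shows "decodeP (encodeP a) = a"
proof -
  obtain k c u where u: "\<And>i. i < 13 \<Longrightarrow> a i = k * int i + c + 13 * u i" using lattP_obtain[OF assms] by blast
  define d where "d i = u i - u 0 - int i * (u 1 - u 0)" for i
  have "a i - a 0 - int i * (a 1 - a 0) = 13 * d i" if "i < 13" for i
    using that by (simp add: u d_def algebra_simps)
  hence ai: "a i = a 0 + int i * (a 1 - a 0) + 13 * d i" and en: "i \<noteq> 0 \<Longrightarrow> encodeP a i = d i" if "i < 13" for i
    using that by (auto simp: encodeP_def algebra_simps)
  have e0: "encodeP a 0 = a 1 - a 0" by (simp add: encodeP_def)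
  have d01: "d 0 = 0" "d 1 = 0" by (simp_all add: d_def)
  have "0 = (\<Sum>i<13. a i)" using lattP_sumD[OF assms] by simp
  also have "\<dots> = (\<Sum>i<13. a 0 + int i * (a 1 - a 0) + 13 * d i)"
    by (rule sum.cong[OF refl], rule ai) simp
  also have "\<dots> = 13 * a 0 + 78 * (a 1 - a 0) + 13 * (\<Sum>j\<in>{2..<13}. d j)"
    unfolding sum_13 sum_2_13 using d01 by (simp add: algebra_simps)
  also have "(\<Sum>j\<in>{2..<13}. d j) = (\<Sum>j\<in>{2..<13}. encodeP a j)" by (intro sum.cong) (auto simp: en)
  \<comment> \<open>Solving 13 a 0 + 78 (a 1 - a 0) + 13 (sum of the d j) = 0 for a 0; the
    coefficient -6 in \<open>decodeP\<close> is -78/13.\<close>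
  finally have a0: "a 0 = - 6 * encodeP a 0 - (\<Sum>j\<in>{2..<13}. encodeP a j)" by (simp add: e0)
  have "decodeP (encodeP a) i = a i" if "i < 13" for i
  proof -
    have if_eq: "(if i < 2 then 0 else encodeP a i) = d i" using en[OF that] d01 by (cases "i = 0"; cases "i = 1") auto
    have "decodeP (encodeP a) i = (- 6 * encodeP a 0 - (\<Sum>j\<in>{2..<13}. encodeP a j)) + int i * encodeP a 0 + 13 * (if i < 2 then 0 else encodeP a i)"
      using that by (simp add: decodeP_def)
    also have "\<dots> = a 0 + int i * (a 1 - a 0) + 13 * d i"
      unfolding a0[symmetric] unfolding if_eq e0 ..
    finally show ?thesis using ai[OF that] by simp
  qed
  moreover have "decodeP (encodeP a) i = a i" if "\<not> i < 13" for i
    using that assms by (auto simp: decodeP_def lattP_def vecs13_def)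
  ultimately show ?thesis by blast
qed

text \<open>The Boolean separates the coordinates of a (\<open>False\<close>) from those of w
  (\<open>True\<close>).\<close>

definition idx24 :: "(bool \<times> nat) set" where "idx24 = UNIV \<times> idx"

definition decode :: "(bool \<times> nat \<Rightarrow> int) \<Rightarrow> (nat \<Rightarrow> int) \<times> (nat \<Rightarrow> int)" where
  "decode y = (decodeP (\<lambda>j. y (False, j)), decodeW (\<lambda>j. y (True, j)))"

definition encode :: "(nat \<Rightarrow> int) \<times> (nat \<Rightarrow> int) \<Rightarrow> bool \<times> nat \<Rightarrow> int" where
  "encode x = (\<lambda>(b, j). if j \<in> idx then (if b then encodeW (snd x) j else encodeP (fst x) j) else 0)"

lemma decodeP_cong: "(\<And>j. j \<in> idx \<Longrightarrow> u j = u' j) \<Longrightarrow> decodeP u = decodeP u'"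
  by (auto simp: decodeP_def idx_def fun_eq_iff intro!: sum.cong)

lemma decodeW_cong: "(\<And>j. j \<in> idx \<Longrightarrow> u j = u' j) \<Longrightarrow> decodeW u = decodeW u'"
  by (auto simp: decodeW_def idx_def fun_eq_iff intro!: sum.cong)

lemma decode_encode: "x \<in> leech13 \<Longrightarrow> decode (encode x) = x"
  using decodeP_cong[of "\<lambda>j. encode x (False, j)" "encodeP (fst x)"] decodeW_cong[of "\<lambda>j. encode x (True, j)" "encodeW (snd x)"]
  by (auto simp: decode_def encode_def leech13_def decodeP_encodeP decodeW_encodeW)

lemma encode_decode: "y \<in> int_vecs idx24 \<Longrightarrow> encode (decode y) = y"
  by (auto simp: encode_def decode_def encodeP_decodeP encodeW_decodeW int_vecs_def idx24_def fun_eq_iff)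

lemma bij_decode: "bij_betw decode (int_vecs idx24) leech13"
  by (rule bij_betwI[where g = encode])
     (auto simp: decode_encode encode_decode, auto simp: decode_def leech13_def decodeP_in decodeW_in encode_def int_vecs_def idx24_def)

lemma decode_add: "decode (x + y) = decode x + decode y"
  by (auto simp: decode_def decodeP_def decodeW_def fun_eq_iff sum.distrib algebra_simps)

lemma leech13_closed: "x \<in> leech13 \<Longrightarrow> y \<in> leech13 \<Longrightarrow> x + y \<in> leech13" "x \<in> leech13 \<Longrightarrow> - x \<in> leech13" "0 \<in> leech13"
  by (auto simp: leech13_def lattP_closed lattW_closed zero_prod_def)

lemma form13_commute: "form13 x y = form13 y x"
  by (simp add: form13_def dot13_commute add.commute)

lemma form13_add:
  assumes "x \<in> leech13" "y \<in> leech13" "z \<in> leech13"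
  shows "form13 (x + y) z = form13 x z + form13 y z"
proof -
  have "13 * form13 (x + y) z = 13 * (form13 x z + form13 y z)"
    unfolding distrib_left form13_times_13[OF assms(1,3)] form13_times_13[OF assms(2,3)]
      form13_times_13[OF leech13_closed(1)[OF assms(1,2)] assms(3)]
    by (simp add: dot13_add)
  thus ?thesis by simp
qed

lemma decode_in: "decode y \<in> leech13"
  by (simp add: decode_def leech13_def decodeP_in decodeW_in)

lemma form13_decode:
  assumes "x \<in> int_vecs idx24" "y \<in> int_vecs idx24"
  shows "form13 (decode x) (decode y) = (\<Sum>i\<in>idx24. x i * form13 (decode (unit_vec i)) (decode y))"
    and "form13 (decode x) (decode y) = int_form idx24 (\<lambda>i j. form13 (decode (unit_vec i)) (decode (unit_vec j))) x y"
proof -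
  have fin: "finite idx24" by (simp add: idx24_def idx_def)
  have 1: "form13 (decode x) (decode y) = (\<Sum>i\<in>idx24. x i * form13 (decode (unit_vec i)) (decode y))" if "x \<in> int_vecs idx24" for x y
    by (rule additive_int_vecs[OF fin _ that]) (simp only: decode_add form13_add decode_in)
  show "form13 (decode x) (decode y) = (\<Sum>i\<in>idx24. x i * form13 (decode (unit_vec i)) (decode y))" by (rule 1[OF assms(1)])
  also have "\<dots> = (\<Sum>i\<in>idx24. \<Sum>j\<in>idx24. form13 (decode (unit_vec i)) (decode (unit_vec j)) * x i * y j)"
  proof (intro sum.cong refl)
    fix i
    show "x i * form13 (decode (unit_vec i)) (decode y) = (\<Sum>j\<in>idx24. form13 (decode (unit_vec i)) (decode (unit_vec j)) * x i * y j)"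
      unfolding form13_commute[of "decode (unit_vec i)"] 1[OF assms(2)] sum_distrib_left by (simp add: mult_ac)
  qed
  finally show "form13 (decode x) (decode y) = int_form idx24 (\<lambda>i j. form13 (decode (unit_vec i)) (decode (unit_vec j))) x y"
    by (simp add: int_form_def)
qed

lemma lattP_subset_lattW: "lattP \<subseteq> lattW"
proof
  fix a assume a: "a \<in> lattP"
  then obtain k c u where u: "\<And>i. i < 13 \<Longrightarrow> a i = k * int i + c + 13 * u i" using lattP_obtain by blast
  have "(\<Sum>i<13. int i * a i) = (\<Sum>i<13. int i * (k * int i + c)) + 13 * (\<Sum>i<13. int i * u i)"
    unfolding sum_distrib_left sum.distrib[symmetric] by (intro sum.cong) (auto simp: u algebra_simps)
  also have "(\<Sum>i<13. int i * (k * int i + c)) = 13 * (50 * k + 6 * c)"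
    unfolding sum_13 by (simp add: algebra_simps)
  finally show "a \<in> lattW" using a by (simp add: lattW_def lattP_def)
qed

lemma lattW_scaled_in_lattP: "w \<in> lattW \<Longrightarrow> (\<lambda>i. 13 * w i) \<in> lattP"
  unfolding lattP_def lattW_def vecs13_def
  by (auto simp: sum_distrib_left[symmetric] cong_0_iff intro!: exI[of _ 0])

text \<open>The inverse Gram matrix applied to the functional with components \<open>f\<close> and \<open>g\<close>.\<close>
lemma form13_dual:
  fixes k :: "bool \<times> nat \<Rightarrow> int"
  shows "\<exists>z\<in>leech13. \<forall>i\<in>idx24. form13 (decode (unit_vec i)) z = k i"
proof -
  define f where "f = decodeW (\<lambda>j. k (False, j))"
  define g where "g = decodeP (\<lambda>j. k (True, j))"
  have f: "f \<in> lattW" and g: "g \<in> lattP" by (simp_all add: f_def g_def decodeW_in decodeP_in)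
  have five: "(\<lambda>i. 5 * x i) = x + x + x + x + x" "(\<lambda>i. 2 * x i) = x + x" for x :: "nat \<Rightarrow> int"
    by (auto simp: fun_eq_iff)
  \<comment> \<open>In block form 13 times \<open>form13\<close> has the matrix with rows (2, 5) and
    (5, 13), of determinant 26 - 25 = 1; the rows (13, -5) and (-5, 2) of its inverse give
    \<open>zP\<close> and \<open>zW\<close>.\<close>
  define zP where "zP = (\<lambda>i. 13 * f i) + (- (\<lambda>i. 5 * g i))"
  define zW where "zW = (\<lambda>i. 2 * g i) + (- (\<lambda>i. 5 * f i))"
  have zP: "zP \<in> lattP" unfolding zP_def five
    by (intro lattP_closed lattW_scaled_in_lattP f g)
  have zW: "zW \<in> lattW" unfolding zW_def five
    using g lattP_subset_lattW by (intro lattW_closed f) auto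
  have dP: "dot13 x zP = 13 * dot13 x f - 5 * dot13 x g" and dW: "dot13 x zW = 2 * dot13 x g - 5 * dot13 x f" for x
    by (simp_all add: dot13_def zP_def zW_def sum_distrib_left sum_subtractf[symmetric] algebra_simps)
  show ?thesis
  proof (intro bexI[of _ "(zP, zW)"] ballI)
    show "(zP, zW) \<in> leech13" using zP zW by (simp add: leech13_def)
    fix i assume "i \<in> idx24"
    then obtain b j where i: "i = (b, j)" "j \<in> idx" by (cases i) (auto simp: idx24_def)
    have delta: "(\<Sum>l\<in>idx. (if l = j then 1 else 0) * h l) = h j" "(\<Sum>l\<in>idx. h l * (if l = j then 1 else 0)) = h j" for h :: "nat \<Rightarrow> int"
      using i(2) by (simp_all add: if_distrib[of "\<lambda>x. x * _"] if_distrib[of "\<lambda>x. _ * x"] idx_def cong: if_cong)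
    have z0: "decodeP (\<lambda>_. 0) = (\<lambda>_. 0)" "decodeW (\<lambda>_. 0) = (\<lambda>_. 0)" by (auto simp: decodeP_def decodeW_def fun_eq_iff)
    show "form13 (decode (unit_vec i)) (zP, zW) = k i"
    proof (cases b)
      case False
      define p where "p = decodeP (\<lambda>l. if l = j then 1 else 0)"
      have "decode (unit_vec i) = (p, \<lambda>_. 0)"
        using False i z0 by (simp add: decode_def unit_vec_def p_def)
      moreover have "dot13 p f = 13 * k (False, j)" unfolding p_def f_def dot13_decode delta ..
      ultimately show ?thesis using False i
        by (simp add: form13_def dP dW) (simp add: dot13_def)
    next
      case True
      define p where "p = decodeW (\<lambda>l. if l = j then 1 else 0)"
      have "decode (unit_vec i) = (\<lambda>_. 0, p)"
        using True i z0 by (simp add: decode_def unit_vec_def p_def)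
      moreover have "dot13 g p = 13 * k (True, j)" unfolding p_def g_def dot13_decode delta ..
      hence "dot13 p g = 13 * k (True, j)" using dot13_commute[of p g] by simp
      moreover have "(5 * (13 * dot13 p f - 5 * (13 * k (True, j)))) div 13 = 5 * dot13 p f - 25 * k (True, j)"
      proof -
        have "5 * (13 * dot13 p f - 5 * (13 * k (True, j))) = 13 * (5 * dot13 p f - 25 * k (True, j))" by simp
        thus ?thesis by (simp only: nonzero_mult_div_cancel_left)
      qed
      moreover have "dot13 (\<lambda>_. 0) x = 0" for x by (simp add: dot13_def)
      ultimately show ?thesis using True i
        by (simp add: form13_def dP dW)
    qed
  qed
qed

lemma unimodular_leech13: "unimodular_gram idx24 (\<lambda>i j. form13 (decode (unit_vec i)) (decode (unit_vec j)))"
proof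
  show "finite idx24" by (simp add: idx24_def idx_def)
  show "form13 (decode (unit_vec i)) (decode (unit_vec j)) = form13 (decode (unit_vec j)) (decode (unit_vec i))" for i j
    by (rule form13_commute)
next
  fix y :: "bool \<times> nat \<Rightarrow> int" assume y: "y \<in> int_vecs idx24" "y \<noteq> (\<lambda>_. 0)"
  have "decode y \<noteq> 0"
  proof
    assume "decode y = 0"
    moreover have "decode (\<lambda>_. 0) = 0" by (auto simp: decode_def decodeP_def decodeW_def fun_eq_iff zero_prod_def)
    ultimately have "y = (\<lambda>_. 0)"
      using y(1) bij_betw_imp_inj_on[OF bij_decode] by (auto simp: inj_on_def int_vecs_def)
    thus False using y(2) by simp
  qed
  thus "int_form idx24 (\<lambda>i j. form13 (decode (unit_vec i)) (decode (unit_vec j))) y y > 0"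
    using form13_pos[OF decode_in[of y]] form13_decode(2)[OF y(1) y(1)] by simp
next
  fix k :: "bool \<times> nat \<Rightarrow> int" assume k: "k \<in> int_vecs idx24"
  obtain z where z: "z \<in> leech13" "\<forall>i\<in>idx24. form13 (decode (unit_vec i)) z = k i" using form13_dual by blast
  obtain y where y: "y \<in> int_vecs idx24" "decode y = z"
    using z(1) bij_betw_imp_surj_on[OF bij_decode] by (metis imageE)
  have "(\<Sum>j\<in>idx24. form13 (decode (unit_vec i)) (decode (unit_vec j)) * y j) = k i" if "i \<in> idx24" for i
    using form13_decode(1)[OF y(1) unit_vec_in[OF that]] z(2) that
    by (simp add: y(2) form13_commute[of z] form13_commute[of "decode (unit_vec i)" "decode (unit_vec _)"] mult.commute)
  thus "\<exists>y\<in>int_vecs idx24. \<forall>i\<in>idx24. (\<Sum>j\<in>idx24. form13 (decode (unit_vec i)) (decode (unit_vec j)) * y j) = k i"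
    using y(1) by blast
qed

lemma leech_type_leech13: "leech_type_lattice leech13 form13"
proof -
  interpret unimodular_gram idx24 "\<lambda>i j. form13 (decode (unit_vec i)) (decode (unit_vec j))"
    by (rule unimodular_leech13)
  have card: "card idx24 = 24" by (simp add: idx24_def idx_def card_cartesian_product)
  note transport = theta_transport[OF card bij_decode form13_decode(2)]
  show ?thesis
  proof
    show "x + y \<in> leech13" if "x \<in> leech13" "y \<in> leech13" for x y by (rule leech13_closed(1)[OF that])
    show "- x \<in> leech13" if "x \<in> leech13" for x by (rule leech13_closed(2)[OF that])
    show "0 \<in> leech13" by (rule leech13_closed(3))
    show "form13 (x + y) z = form13 x z + form13 y z" if "x \<in> leech13" "y \<in> leech13" "z \<in> leech13" for x y z
      by (rule form13_add[OF that])
    show "form13 x y = form13 y x" for x y by (rule form13_commute)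
    show "even (form13 x x)" if "x \<in> leech13" for x by (rule form13_even[OF that])
    show "form13 x x > 0" if "x \<in> leech13" "x \<noteq> 0" for x by (rule form13_pos[OF that])
    show "form13 x x \<noteq> 2" if "x \<in> leech13" for x by (rule form13_not_2[OF that])
    fix t :: real assume t: "t > 0"
    show "(\<lambda>y. exp (- pi * t * of_int (form13 y y))) summable_on leech13" by (rule transport(1)[OF _ _ t])
    show "(\<Sum>\<^sub>\<infinity>y\<in>leech13. complex_of_real (exp (- pi * t * of_int (form13 y y))) * cis (2 * pi * s * of_int (form13 x y)))
      = of_real (\<Sum>\<^sub>\<infinity>y\<in>leech13. (1 / t) ^ 12 *
          exp (- pi * (of_int (form13 y y) - 2 * s * of_int (form13 x y) + s\<^sup>2 * of_int (form13 x x)) / t))"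
      if "x \<in> leech13" for x s
      by (rule transport(2)[OF _ _ t that])
  qed
qed


section \<open>The free action of the cyclic group of order 13\<close>

text \<open>All orbits have exactly p elements: a coincidence among the first p iterates makes x a
  fixed point of the d-th iterate for some 0 < d < p, and as d is invertible modulo p, a fixed point
  of \<sigma> itself.\<close>

lemma prime_dvd_card_of_free_permutation:
  fixes \<sigma> :: "'a \<Rightarrow> 'a"
  assumes "finite S" "prime p" and closed: "\<And>x. x \<in> S \<Longrightarrow> \<sigma> x \<in> S"
    and period: "\<And>x. x \<in> S \<Longrightarrow> (\<sigma> ^^ p) x = x" and free: "\<And>x. x \<in> S \<Longrightarrow> \<sigma> x \<noteq> x"
  shows "p dvd card S"
proof -
  have p: "p > 0" using \<open>prime p\<close> prime_gt_0_nat by blast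
  have pow_closed: "(\<sigma> ^^ n) x \<in> S" if "x \<in> S" for n x
    by (induction n) (use that closed in auto)
  have pow_mult: "(\<sigma> ^^ (d * m)) x = x" if "x \<in> S" "(\<sigma> ^^ d) x = x" for d m x
    by (induction m) (use that in \<open>auto simp: funpow_add algebra_simps\<close>)
  have pow_mod: "(\<sigma> ^^ n) x = (\<sigma> ^^ (n mod p)) x" if "x \<in> S" for n x
  proof -
    have "(\<sigma> ^^ n) x = (\<sigma> ^^ (n mod p + p * (n div p))) x" by simp
    also have "\<dots> = (\<sigma> ^^ (n mod p)) ((\<sigma> ^^ (p * (n div p))) x)" by (simp only: funpow_add o_apply)
    finally show ?thesis using pow_mult[OF that period[OF that]] by simp
  qed
  have inj: "inj_on (\<lambda>n. (\<sigma> ^^ n) x) {..<p}" if x: "x \<in> S" for x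
  proof -
    have neq: False if ij: "i < j" "j < p" "(\<sigma> ^^ i) x = (\<sigma> ^^ j) x" for i j
    proof -
      define d where "d = j - i"
      have d: "0 < d" "d < p" using ij by (auto simp: d_def)
      have "(\<sigma> ^^ d) x = (\<sigma> ^^ d) ((\<sigma> ^^ p) x)" using period[OF x] by simp
      also have "\<dots> = (\<sigma> ^^ (p - i + j)) x"
      proof -
        have "(\<sigma> ^^ d) ((\<sigma> ^^ p) x) = (\<sigma> ^^ (d + p)) x" by (simp only: funpow_add o_apply)
        also have "d + p = p - i + j" using ij by (simp add: d_def)
        finally show ?thesis .
      qed
      also have "\<dots> = (\<sigma> ^^ (p - i)) ((\<sigma> ^^ j) x)" by (simp only: funpow_add o_apply)
      also have "\<dots> = (\<sigma> ^^ (p - i)) ((\<sigma> ^^ i) x)" by (simp only: ij(3))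
      also have "\<dots> = (\<sigma> ^^ (p - i + i)) x" by (simp only: funpow_add o_apply)
      also have "\<dots> = x" using period[OF x] ij by simp
      finally have fix_d: "(\<sigma> ^^ d) x = x" .
      have "coprime d p" using d \<open>prime p\<close>
        by (metis coprime_commute nat_dvd_not_less prime_imp_coprime)
      then obtain m where "[d * m = Suc 0] (mod p)" using cong_solve_coprime_nat by blast
      hence "(d * m) mod p = 1" using prime_gt_1_nat[OF \<open>prime p\<close>] by (simp add: cong_def)
      hence "(\<sigma> ^^ (d * m)) x = \<sigma> x" using pow_mod[OF x, of "d * m"] by simp
      thus False using pow_mult[OF x fix_d, of m] free[OF x] by simp
    qed
    show ?thesis by (rule linorder_inj_onI') (metis lessThan_iff neq)
  qed
  define r where "r = {(x, y). x \<in> S \<and> (\<exists>n. y = (\<sigma> ^^ n) x)}"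
  have cls: "r `` {x} = (\<lambda>n. (\<sigma> ^^ n) x) ` {..<p}" if x: "x \<in> S" for x
  proof -
    have "(\<sigma> ^^ n) x \<in> (\<lambda>n. (\<sigma> ^^ n) x) ` {..<p}" for n
      using pow_mod[OF x, of n] p by (auto intro!: image_eqI[of _ _ "n mod p"])
    thus ?thesis using x by (auto simp: r_def)
  qed
  have "equiv S r"
  proof (rule equivI)
    show "r \<subseteq> S \<times> S" using pow_closed by (auto simp: r_def)
    show "refl_on S r" using pow_closed by (auto simp: r_def refl_on_def intro!: exI[of _ 0])
    show "sym r"
    proof (rule symI)
      fix x y assume "(x, y) \<in> r"
      then obtain n where n: "x \<in> S" "y = (\<sigma> ^^ n) x" by (auto simp: r_def)
      \<comment> \<open>The exponent represents -n modulo the period; p > 0 makes the truncated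
        subtraction exact.\<close>
      have "(\<sigma> ^^ (p * n - n)) y = (\<sigma> ^^ (p * n - n + n)) x" unfolding n(2) by (simp only: funpow_add o_apply)
      also have "p * n - n + n = p * n" using p by simp
      also have "(\<sigma> ^^ (p * n)) x = x" by (rule pow_mult[OF n(1) period[OF n(1)]])
      finally show "(y, x) \<in> r" using n pow_closed by (auto simp: r_def intro!: exI[of _ "p * n - n"])
    qed
    show "trans r"
    proof (rule transI)
      fix x y z assume "(x, y) \<in> r" "(y, z) \<in> r"
      then obtain n m where "x \<in> S" "y = (\<sigma> ^^ n) x" "z = (\<sigma> ^^ m) y" by (auto simp: r_def)
      hence "x \<in> S" "z = (\<sigma> ^^ (m + n)) x" by (simp_all add: funpow_add)
      thus "(x, z) \<in> r" unfolding r_def by blast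
    qed
  qed
  moreover have "p dvd card X" if "X \<in> S // r" for X
    using that by (auto elim!: quotientE simp: cls card_image inj)
  ultimately show ?thesis using equiv_imp_dvd_card[OF \<open>finite S\<close>] by blast
qed

text \<open>Adding 12 modulo 13 is subtracting 1 without leaving the natural numbers.\<close>

definition rot13 :: "(nat \<Rightarrow> int) \<Rightarrow> nat \<Rightarrow> int" where
  "rot13 a i = (if i < 13 then a ((i + 12) mod 13) else 0)"

lemma rot13_power:
  assumes "i < 13" shows "(rot13 ^^ n) a i = a ((i + 12 * n) mod 13)"
  using assms
proof (induction n arbitrary: i)
  case (Suc n)
  have "(rot13 ^^ Suc n) a i = (rot13 ^^ n) a ((i + 12) mod 13)" using Suc.prems by (simp add: rot13_def)
  also have "\<dots> = a (((i + 12) mod 13 + 12 * n) mod 13)" by (rule Suc.IH) simp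
  also have "((i + 12) mod 13 + 12 * n) mod 13 = (i + 12 * Suc n) mod 13"
    by (subst mod_add_left_eq) (simp add: algebra_simps)
  finally show ?case .
qed simp

lemma rot13_vecs13: "a \<in> vecs13 \<Longrightarrow> rot13 a \<in> vecs13"
  unfolding vecs13_def sum_13 by (simp add: rot13_def)

lemma rot13_period: "a \<in> vecs13 \<Longrightarrow> (rot13 ^^ 13) a = a"
proof
  fix i assume a: "a \<in> vecs13"
  show "(rot13 ^^ 13) a i = a i"
  proof (cases "i < 13")
    case True
    have "(i + 12 * 13) mod 13 = i" using True by (simp only: mod_mult_self1 mod_less)
    thus ?thesis using rot13_power[OF True, of 13 a] by simp
  next
    case False
    have "(rot13 ^^ 13) a = rot13 ((rot13 ^^ 12) a)" by (simp add: numeral_eq_Suc)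
    thus ?thesis using False a by (simp add: rot13_def vecs13_def)
  qed
qed

text \<open>A vector fixed by the shift is constant, and sum 0 leaves only the zero vector.\<close>

lemma rot13_free: "a \<in> vecs13 \<Longrightarrow> rot13 a = a \<Longrightarrow> a = 0"
proof (rule vecs13_eq_0)
  fix i :: nat assume a: "a \<in> vecs13" "rot13 a = a" "i < 13"
  have const: "a i = a 0" if "i < 13" for i
    using that
  proof (induction i)
    case (Suc i)
    have "a (Suc i) = rot13 a (Suc i)" using a by simp
    also have "\<dots> = a ((Suc i + 12) mod 13)" using Suc.prems by (simp add: rot13_def)
    also have "(Suc i + 12) mod 13 = i" using Suc.prems by simp
    finally show ?case using Suc by simp
  qed simp
  have "(\<Sum>i<13. a i) = (\<Sum>i<13::nat. a 0)" by (rule sum.cong[OF refl], rule const) simp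
  hence "a 0 = 0" using a(1) by (simp add: vecs13_def)
  thus "a i = 0" using const[OF a(3)] by simp
qed

text \<open>Shifting an affine function of slope k changes its constant by -k, and the wrap-around
  is invisible modulo 13.\<close>

lemma rot13_lattP: "a \<in> lattP \<Longrightarrow> rot13 a \<in> lattP"
proof -
  assume a: "a \<in> lattP"
  then obtain k c where kc: "\<And>i. i < 13 \<Longrightarrow> [a i = k * int i + c] (mod 13)" by (auto simp: lattP_def)
  have "[rot13 a i = k * int i + (c - k)] (mod 13)" if i: "i < 13" for i
  proof -
    have "[rot13 a i = k * int ((i + 12) mod 13) + c] (mod 13)" using kc[of "(i + 12) mod 13"] i by (simp add: rot13_def)
    also have "[k * int ((i + 12) mod 13) + c = k * (int i + 12) + c] (mod 13)"
    proof (intro cong_add cong_mult cong_refl)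
      show "[int ((i + 12) mod 13) = int i + 12] (mod 13)" by (simp add: cong_def zmod_int)
    qed
    also have "[k * (int i + 12) + c = k * int i + (c - k)] (mod 13)"
      by (simp add: cong_iff_dvd_diff algebra_simps)
    finally show ?thesis .
  qed
  moreover have "rot13 a \<in> vecs13" using a by (intro rot13_vecs13) (simp add: lattP_def)
  ultimately show ?thesis unfolding lattP_def by blast
qed

text \<open>The weighted sum grows by the plain sum, which is 0, up to the wrap-around of the last
  entry, which costs a multiple of 13.\<close>

lemma rot13_lattW: "w \<in> lattW \<Longrightarrow> rot13 w \<in> lattW"
proof -
  assume w: "w \<in> lattW"
  have "(\<Sum>i<13. int i * rot13 w i) = (\<Sum>i<13. int i * w i) + (\<Sum>i<13. w i) - 13 * w 12"
    unfolding sum_13 by (simp add: rot13_def algebra_simps)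
  moreover have "rot13 w \<in> vecs13" using w by (intro rot13_vecs13) (simp add: lattW_def)
  ultimately show ?thesis using w lattW_sumD[OF w] by (simp add: lattW_def)
qed

lemma dot13_rot13: "dot13 (rot13 x) (rot13 y) = dot13 x y"
  unfolding dot13_def sum_13 by (simp add: rot13_def)

definition rot13_pair :: "(nat \<Rightarrow> int) \<times> (nat \<Rightarrow> int) \<Rightarrow> (nat \<Rightarrow> int) \<times> (nat \<Rightarrow> int)" where
  "rot13_pair = map_prod rot13 rot13"

lemma form13_rot13: "form13 (rot13_pair x) (rot13_pair y) = form13 x y"
  by (simp add: form13_def dot13_rot13 rot13_pair_def)

lemma rot13_leech13: "x \<in> leech13 \<Longrightarrow> rot13_pair x \<in> leech13"
  by (auto simp: leech13_def rot13_lattP rot13_lattW rot13_pair_def)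

lemma leech13_vecs13: "x \<in> leech13 \<Longrightarrow> fst x \<in> vecs13 \<and> snd x \<in> vecs13"
  by (auto simp: leech13_def lattP_def lattW_def)

interpretation leech13: leech_type_lattice leech13 form13
  by (rule leech_type_leech13)

lemma prime_13_dvd_pair_count:
  assumes "m \<noteq> 0 \<or> n \<noteq> 0"
  shows "13 dvd leech13.pair_count m r n"
  unfolding leech13.pair_count_def
proof (rule prime_dvd_card_of_free_permutation[where \<sigma> = "map_prod rot13_pair rot13_pair"])
  let ?\<rho> = rot13_pair
  let ?S = "{(x, y). x \<in> leech13.shell m \<and> y \<in> leech13.shell n \<and> form13 x y = r}"
  have S_iff: "z \<in> ?S \<longleftrightarrow> fst z \<in> leech13.shell m \<and> snd z \<in> leech13.shell n \<and> form13 (fst z) (snd z) = r" for z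
    by (simp add: case_prod_unfold)
  show "finite ?S" by (rule leech13.finite_pairs)
  show "prime (13 :: nat)" by simp
  show "map_prod ?\<rho> ?\<rho> z \<in> ?S" if "z \<in> ?S" for z
    using that unfolding S_iff by (simp add: leech13.shell_def rot13_leech13 form13_rot13)
  have pow: "(map_prod f g ^^ k) z = ((f ^^ k) (fst z), (g ^^ k) (snd z))" for f :: "'a \<Rightarrow> 'a" and g :: "'b \<Rightarrow> 'b" and k z
    by (induction k) auto
  have period: "(?\<rho> ^^ 13) x = x" if "x \<in> leech13" for x
    unfolding rot13_pair_def pow using leech13_vecs13[OF that] by (simp add: rot13_period)
  show "(map_prod ?\<rho> ?\<rho> ^^ 13) z = z" if "z \<in> ?S" for z
  proof -
    have "fst z \<in> leech13" "snd z \<in> leech13" using that by (auto simp: leech13.shell_def)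
    thus ?thesis by (simp only: pow period prod.collapse)
  qed
  have free: "x = 0" if "x \<in> leech13" "?\<rho> x = x" for x
    using leech13_vecs13[OF that(1)] that(2) rot13_free[of "fst x"] rot13_free[of "snd x"]
    by (cases x) (auto simp: zero_prod_def rot13_pair_def)
  show "map_prod ?\<rho> ?\<rho> z \<noteq> z" if z: "z \<in> ?S" for z
  proof
    assume eq: "map_prod ?\<rho> ?\<rho> z = z"
    have in_leech: "fst z \<in> leech13" "snd z \<in> leech13" using z by (auto simp: leech13.shell_def)
    have "?\<rho> (fst z) = fst z" "?\<rho> (snd z) = snd z" using eq by (metis fst_map_prod, metis snd_map_prod)
    hence "fst z = 0" "snd z = 0" using free in_leech by blast+
    hence "form13 0 0 = 2 * int m" "form13 0 0 = 2 * int n" using z by (auto simp: leech13.shell_def)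
    moreover have "form13 0 0 = 0" by (rule leech13.\<beta>_zero_left[OF leech13.zero_closed])
    ultimately show False using assms by simp
  qed
qed

section \<open>The lattice of the given Gram matrix\<close>

lemma det_of_int: "det (\<chi> i j. real_of_int (M $ i $ j)) = of_int (det (M :: int^'n^'n))"
  by (simp add: det_def)

text \<open>Cramer's rule with determinant 1. It is applied over the reals, and the resulting
  determinants are integers because their entries are.\<close>

lemma unimodular_int_solvable:
  fixes L :: "int^'n^'n"
  assumes "det L = 1"
  shows "\<exists>y :: int^'n. \<forall>i. (\<Sum>j\<in>UNIV. L $ i $ j * y $ j) = k i"
proof -
  define A where "A = (\<chi> i j. real_of_int (L $ i $ j))"
  define b where "b = (\<chi> i. real_of_int (k i))"
  have dA: "det A = 1" unfolding A_def det_of_int assms by simp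
  define y :: "int^'n" where "y = (\<chi> l. det (\<chi> i j. if j = l then k i else L $ i $ j))"
  have "A *v (\<chi> l. det (\<chi> i j. if j = l then b $ i else A $ i $ j) / det A) = b"
    using cramer[of A "\<chi> l. det (\<chi> i j. if j = l then b $ i else A $ i $ j) / det A" b] dA by simp
  moreover have "(\<chi> l. det (\<chi> i j. if j = l then b $ i else A $ i $ j) / det A) = (\<chi> l. real_of_int (y $ l))"
  proof -
    have "det (\<chi> i j. if j = l then b $ i else A $ i $ j) = real_of_int (y $ l)" for l
    proof -
      define M :: "int^'n^'n" where "M = (\<chi> i j. if j = l then k i else L $ i $ j)"
      have "(\<chi> i j. if j = l then b $ i else A $ i $ j) = (\<chi> i j. real_of_int (M $ i $ j))"
        by (simp add: vec_eq_iff A_def b_def M_def)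
      moreover have "y $ l = det M" by (simp add: y_def M_def)
      ultimately show ?thesis by (simp only: det_of_int)
    qed
    thus ?thesis by (simp add: dA)
  qed
  ultimately have "A *v (\<chi> l. real_of_int (y $ l)) = b" by simp
  hence "(\<Sum>j\<in>UNIV. real_of_int (L $ i $ j) * real_of_int (y $ j)) = real_of_int (k i)" for i
    by (simp add: vec_eq_iff matrix_vector_mult_def A_def b_def)
  hence "real_of_int (\<Sum>j\<in>UNIV. L $ i $ j * y $ j) = real_of_int (k i)" for i by simp
  hence "(\<Sum>j\<in>UNIV. L $ i $ j * y $ j) = k i" for i using of_int_eq_iff by blast
  thus ?thesis by blast
qed

lemma leech_type_leech_gram:
  assumes L: "leech_gram L"
  shows "leech_type_lattice UNIV (bform L)"
proof -
  have symL: "L $ i $ j = L $ j $ i" for i j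
  proof -
    have "transpose L = L" using L by (simp add: leech_gram_def)
    hence "transpose L $ i $ j = L $ i $ j" by simp
    thus ?thesis by (simp add: transpose_def)
  qed
  have bform_pos: "x \<noteq> 0 \<Longrightarrow> bform L x x > 0" for x using L by (simp add: leech_gram_def)
  have form: "bform L x y = int_form UNIV (\<lambda>i j. L $ i $ j) (vec_nth x) (vec_nth y)" for x y
    by (simp add: bform_def int_form_def mult_ac)
  have vec_nth_lambda: "vec_nth (vec_lambda y) = y" for y :: "24 \<Rightarrow> int" by (simp add: fun_eq_iff)
  have vecs: "int_vecs (UNIV :: 24 set) = UNIV" by (auto simp: int_vecs_def)
  interpret unimodular_gram "UNIV :: 24 set" "\<lambda>i j. L $ i $ j"
  proof
    fix y :: "24 \<Rightarrow> int" assume "y \<noteq> (\<lambda>_. 0)"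
    hence "(\<chi> i. y i) \<noteq> 0" by (auto simp: vec_eq_iff)
    from bform_pos[OF this] show "int_form UNIV (\<lambda>i j. L $ i $ j) y y > 0" by (simp add: form vec_nth_lambda)
  next
    fix k :: "24 \<Rightarrow> int"
    have "det L = 1" using L by (simp add: leech_gram_def)
    from unimodular_int_solvable[OF this, of k]
    show "\<exists>y\<in>int_vecs UNIV. \<forall>i\<in>UNIV. (\<Sum>j\<in>UNIV. L $ i $ j * y j) = k i" by (auto simp: vecs)
  qed (auto simp: symL)
  have bij: "bij_betw vec_lambda (int_vecs (UNIV :: 24 set)) (UNIV :: (int^24) set)"
    by (rule bij_betwI[where g = vec_nth]) (auto simp: vecs)
  have card: "card (UNIV :: 24 set) = 24" by simp
  note transport = theta_transport[OF card bij, of "bform L"]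
  show ?thesis
  proof
    show "bform L (x + y) z = bform L x z + bform L y z" for x y z
      by (simp add: bform_def distrib_right sum.distrib)
    show "bform L x y = bform L y x" for x y
      unfolding bform_def by (subst sum.swap) (simp add: symL mult_ac)
    show "even (bform L x x)" for x
    proof -
      have diag: "even (L $ i $ i)" for i using L by (simp add: leech_gram_def)
      define f where "f i j = x $ i * L $ i $ j * x $ j" for i j
      have f_sym: "f i j = f j i" for i j unfolding f_def symL[of i j] by (simp only: mult_ac)
      have f_diag: "even (f i i)" for i unfolding f_def using diag[of i] by simp
      \<comment> \<open>Off-diagonal terms occur in equal pairs; the induction over index sets adds
        one diagonal term and a doubled row at a time.\<close>
      have "even (\<Sum>i\<in>S. \<Sum>j\<in>S. f i j)" if "finite S" for S
        using that
      proof induction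
        case (insert i S)
        have "(\<Sum>k\<in>insert i S. \<Sum>j\<in>insert i S. f k j) =
            f i i + (\<Sum>j\<in>S. f i j) + ((\<Sum>k\<in>S. f k i) + (\<Sum>k\<in>S. \<Sum>j\<in>S. f k j))"
          using insert.hyps by (simp add: sum.distrib)
        also have "(\<Sum>k\<in>S. f k i) = (\<Sum>k\<in>S. f i k)" by (rule sum.cong[OF refl], rule f_sym)
        finally show ?case using insert.IH f_diag[of i] by presburger
      qed simp
      from this[of UNIV] show ?thesis by (simp add: bform_def f_def)
    qed
    show "bform L x x \<noteq> 2" for x using L by (simp add: leech_gram_def)
    show "bform L x x > 0" if "x \<noteq> 0" for x by (rule bform_pos[OF that])
  qed (use transport in \<open>auto simp: form vec_nth_lambda\<close>)
qed

theorem theorem3p6: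
  fixes L :: "int^24^24"
  assumes "leech_gram L"
  shows "theta2_coeff L 0 0 0 = 1
    \<and> (\<forall>a b c. psd2 a b c \<and> (a, b, c) \<noteq> (0, 0, 0) \<longrightarrow> (13::nat) dvd theta2_coeff L a b c)"
proof -
  interpret two_leech_type_lattices UNIV "bform L" leech13 form13
    by (intro two_leech_type_lattices.intro leech_type_leech_gram[OF assms] leech_type_leech13)
  have coeff: "theta2_coeff L a b c = L1.pair_count (nat a) b (nat c)" if "a \<ge> 0" "c \<ge> 0" for a b c
    using that by (simp add: theta2_coeff_def L1.pair_count_def L1.shell_def conj_ac)
  show ?thesis
  proof (intro conjI allI impI)
    show "theta2_coeff L 0 0 0 = 1" by (simp add: coeff L1.pair_count_shell_0 L1.shell_0)
    fix a b c assume abc: "psd2 a b c \<and> (a, b, c) \<noteq> (0, 0, 0)"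
    hence ac: "a \<ge> 0" "c \<ge> 0" "b\<^sup>2 \<le> 4 * a * c" by (auto simp: psd2_def)
    \<comment> \<open>A semidefinite T with zero diagonal is 0, so a nonzero T always provides the
      nonzero norm that makes the action free.\<close>
    have "a \<noteq> 0 \<or> c \<noteq> 0"
    proof (rule ccontr)
      assume "\<not> (a \<noteq> 0 \<or> c \<noteq> 0)"
      hence "b\<^sup>2 \<le> 0" using ac by simp
      thus False using abc \<open>\<not> (a \<noteq> 0 \<or> c \<noteq> 0)\<close> by simp
    qed
    hence "nat a \<noteq> 0 \<or> nat c \<noteq> 0" using ac by auto
    thus "13 dvd theta2_coeff L a b c"
      unfolding coeff[OF ac(1,2)] pair_count_eq by (rule prime_13_dvd_pair_count)
  qed
qed

end
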